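(* Let $\mathfrak g$ be of type $A$ or $D$ with non-trivial diagram automorphism $\sigma$ of order two. For all $i\in I_0$ and $m\in\mathbb Z_+$, the $\mathfrak g[t]^\sigma$-module $KR^\sigma(m\omega_i)$ is finite-dimensional.
   Context: $\mathbb Z_+$ (resp. $\mathbb N$) is the set of non-negative (resp. positive) integers; $\epsilon\in\{0,1\}$ throughout. $\mathfrak g$ is a complex simple Lie algebra of type $A_{2n}$ ($n\ge1$), $A_{2n-1}$ ($n\ge2$) or $D_{n+1}$ ($n\ge3$), with Cartan subalgebra $\mathfrak h$ and triangular decomposition $\mathfrak n^-\oplus\mathfrak h\oplus\mathfrak n^+$, and $\sigma$ is the non-trivial diagram automorphism of order two. $\mathfrak g_0,\mathfrak g_1$ are the $+1,-1$ eigenspaces of $\sigma$, and $\mathfrak a_\epsilon=\mathfrak a\cap\mathfrak g_\epsilon$ for a $\sigma$-stable subalgebra $\mathfrak a$. $\mathfrak g_0$ is simple with Cartan subalgebra $\mathfrak h_0$, of type $C_n$ if $\mathfrak g=A_{2n-1}$ and of type $B_n$ if $\mathfrak g=A_{2n}$ or $D_{n+1}$. All roots and weights are those of $\mathfrak g_0$: $I_0=\{1,\dots,n\}$, simple roots $\alpha_i$ and fundamental weights $\omega_i$ numbered as in Bourbaki, $R_0^+$ the positive roots, $Q_0^+$ the $\mathbb Z_+$-span of the simple roots. $R_1$ is the set of non-zero weights of $\mathfrak h_0$ on $\mathfrak g_1$, $R_1^+=R_1\cap Q_0^+$; the weight spaces $(\mathfrak g_1)_\alpha$, $\alpha\in R_1$,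 are one-dimensional. For $\alpha\in R_0^+$, $x^\pm_\alpha$ is a non-zero element of $(\mathfrak g_0)_{\pm\alpha}$; for $\alpha\in R_1^+$, $y^\pm_\alpha$ is any non-zero element of $(\mathfrak g_1)_{\pm\alpha}$; $y^\pm_\alpha=0$ if $\alpha\in R_0^+\setminus R_1^+$. The twisted current algebra is $\mathfrak g[t]^\sigma=\mathfrak g_0\otimes\mathbb C[t^2]\oplus\mathfrak g_1\otimes t\mathbb C[t^2]$; similarly $\mathfrak n^\pm[t]^\sigma=\mathfrak n^\pm_0\otimes\mathbb C[t^2]\oplus\mathfrak n_1^\pm\otimes t\mathbb C[t^2]$. $KR^\sigma(m\omega_i)$ is the $\mathfrak g[t]^\sigma$-module generated by $v^\sigma_{i,m}$ with defining relations $$\mathfrak n^+[t]^\sigma v^\sigma_{i,m}=0,\quad h_0v^\sigma_{i,m}=m\omega_i(h_0)v^\sigma_{i,m},\quad (h_\epsilon\otimes t^{2r-\epsilon})v^\sigma_{i,m}=x^-_{\alpha_j}v^\sigma_{i,m}=0\ \ (h_\epsilon\in\mathfrak h_\epsilon,\ h_0\in\mathfrak h_0,\ r\in\mathbb N,\ j\ne i),$$ $$(x^-_{\alpha_i})^{m+1}v^\sigma_{i,m}=0,\qquad (x^-_{\alpha_i}\otimes t^2)v^\sigma_{i,m}=(y^-_{\alpha_i}\otimes t)v^\sigma_{i,m}=0.$$ *)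

theory Defs
  imports
    "Jordan_Normal_Form.VS_Connect"
    "HOL-Library.Poly_Mapping"
    "HOL-Computational_Algebra.Polynomial"
begin

section \<open>Cyclic modules given by generators and relations\<close>

text \<open>
  The tensor algebra of a Lie algebra with carrier \<open>L\<close> is presented as the complex vector space
  with basis the words over \<open>L\<close>, modulo multilinearity.  The word \<open>[a1,\<dots>,ak]\<close> stands for the
  product \<open>a1 \<cdots> ak\<close>, or for \<open>a1 \<cdots> ak v\<close> once a cyclic generator \<open>v\<close> is fixed.
\<close>

definition wscale :: "complex \<Rightarrow> ('l list \<Rightarrow>\<^sub>0 complex) \<Rightarrow> ('l list \<Rightarrow>\<^sub>0 complex)" where
  "wscale c p = Poly_Mapping.map (\<lambda>z. c * z) p"

lemma lookup_wscale [simp]: "Poly_Mapping.lookup (wscale c p) w = c * Poly_Mapping.lookup p w"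
  unfolding wscale_def by transfer (simp add: when_def)

global_interpretation words: vector_space wscale
  by unfold_locales (auto intro!: poly_mapping_eqI simp: lookup_add algebra_simps)

abbreviation word :: "'l list \<Rightarrow> ('l list \<Rightarrow>\<^sub>0 complex)" where
  "word w \<equiv> Poly_Mapping.single w 1"

text \<open>The product \<open>u p w\<close> of a linear combination \<open>p\<close> of words with two words.\<close>

definition sandwich ::
  "'l list \<Rightarrow> ('l list \<Rightarrow>\<^sub>0 complex) \<Rightarrow> 'l list \<Rightarrow> ('l list \<Rightarrow>\<^sub>0 complex)" where
  "sandwich u p w = (\<Sum>z\<in>Poly_Mapping.keys p. Poly_Mapping.single (u @ z @ w) (Poly_Mapping.lookup p z))"

definition enveloping_relations ::
  "(complex \<Rightarrow> 'l \<Rightarrow> 'l) \<Rightarrow> ('l \<Rightarrow> 'l \<Rightarrow> 'l) \<Rightarrow> ('l::ab_group_add) set \<Rightarrow> ('l list \<Rightarrow>\<^sub>0 complex) set"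
where
  "enveloping_relations sc br L =
     {word [a + b] - word [a] - word [b] | a b. a \<in> L \<and> b \<in> L} \<union>
     {word [sc c a] - wscale c (word [a]) | c a. a \<in> L} \<union>
     {word [a, b] - word [b, a] - word [br a b] | a b. a \<in> L \<and> b \<in> L}"

text \<open>
  The two-sided ideal generated by the relations of the enveloping algebra, plus the left ideal
  generated by \<open>S\<close>.
\<close>

definition relation_space ::
  "(complex \<Rightarrow> 'l \<Rightarrow> 'l) \<Rightarrow> ('l \<Rightarrow> 'l \<Rightarrow> 'l) \<Rightarrow> ('l::ab_group_add) set
    \<Rightarrow> ('l list \<Rightarrow>\<^sub>0 complex) set \<Rightarrow> ('l list \<Rightarrow>\<^sub>0 complex) set"
where
  "relation_space sc br L S =
     words.span
       ({sandwich u r w | u r w.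
           u \<in> lists L \<and> w \<in> lists L \<and> r \<in> enveloping_relations sc br L} \<union>
        {sandwich u s [] | u s. u \<in> lists L \<and> s \<in> S})"

definition rel_coset :: "('l list \<Rightarrow>\<^sub>0 complex) set \<Rightarrow> ('l list \<Rightarrow>\<^sub>0 complex) \<Rightarrow> ('l list \<Rightarrow>\<^sub>0 complex) set"
where "rel_coset N p = (\<lambda>q. p + q) ` N"

text \<open>
  The module over the Lie algebra \<open>L\<close> generated by a vector \<open>v\<close> with defining relations \<open>s v = 0\<close>
  for \<open>s \<in> S\<close>, i.e. \<open>U(L) / U(L) S\<close>, realised by cosets.  The record gives its
  vector space structure (the fields \<open>mult\<close> and \<open>one\<close> of a HOL-Algebra module are irrelevant);
  \<open>cyclic_act\<close> and \<open>cyclic_gen\<close> give the action of \<open>L\<close> and the generator.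
\<close>

definition cyclic_module ::
  "(complex \<Rightarrow> 'l \<Rightarrow> 'l) \<Rightarrow> ('l \<Rightarrow> 'l \<Rightarrow> 'l) \<Rightarrow> ('l::ab_group_add) set
    \<Rightarrow> ('l list \<Rightarrow>\<^sub>0 complex) set \<Rightarrow> (complex, ('l list \<Rightarrow>\<^sub>0 complex) set) module"
where
  "cyclic_module sc br L S =
     (let N = relation_space sc br L S in
      \<lparr> carrier = {rel_coset N p | p. Poly_Mapping.keys p \<subseteq> lists L},
        mult = undefined, one = undefined,
        zero = rel_coset N 0,
        add = (\<lambda>A B. {a + b | a b. a \<in> A \<and> b \<in> B}),
        smult = (\<lambda>c A. {wscale c a + q | a q. a \<in> A \<and> q \<in> N}) \<rparr>)"

definition cyclic_act ::
  "(complex \<Rightarrow> 'l \<Rightarrow> 'l) \<Rightarrow> ('l \<Rightarrow> 'l \<Rightarrow> 'l) \<Rightarrow> ('l::ab_group_add) set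
    \<Rightarrow> ('l list \<Rightarrow>\<^sub>0 complex) set
    \<Rightarrow> 'l \<Rightarrow> ('l list \<Rightarrow>\<^sub>0 complex) set \<Rightarrow> ('l list \<Rightarrow>\<^sub>0 complex) set"
where
  "cyclic_act sc br L S z A =
     {sandwich [z] a [] + q | a q. a \<in> A \<and> q \<in> relation_space sc br L S}"

definition cyclic_gen ::
  "(complex \<Rightarrow> 'l \<Rightarrow> 'l) \<Rightarrow> ('l \<Rightarrow> 'l \<Rightarrow> 'l) \<Rightarrow> ('l::ab_group_add) set
    \<Rightarrow> ('l list \<Rightarrow>\<^sub>0 complex) set \<Rightarrow> ('l list \<Rightarrow>\<^sub>0 complex) set"
where
  "cyclic_gen sc br L S = rel_coset (relation_space sc br L S) (word [])"

text \<open>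
  \<open>cyclic_module\<close> is a complex vector space on which \<open>L\<close> acts, and it is
  generated by \<open>cyclic_gen\<close>, which satisfies the relations \<open>S\<close>.
\<close>

lemma sandwich_eq_sum:
  "sandwich u p w = (\<Sum>z\<in>A. Poly_Mapping.single (u @ z @ w) (Poly_Mapping.lookup p z))"
  if "finite A" "Poly_Mapping.keys p \<subseteq> A"
  unfolding sandwich_def using that
  by (intro sum.mono_neutral_left) (auto simp: in_keys_iff)

lemma sandwich_add: "sandwich u (p + q) w = sandwich u p w + sandwich u q w"
proof -
  let ?A = "Poly_Mapping.keys p \<union> Poly_Mapping.keys q"
  have "Poly_Mapping.keys (p + q) \<subseteq> ?A" by (rule Poly_Mapping.keys_add)
  then show ?thesis
    by (simp add: sandwich_eq_sum[of ?A] lookup_add single_add sum.distrib)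
qed

lemma wscale_single: "wscale c (Poly_Mapping.single w d) = Poly_Mapping.single w (c * d)"
  by (rule poly_mapping_eqI) (simp add: lookup_single when_def)

lemma keys_wscale: "Poly_Mapping.keys (wscale c p) \<subseteq> Poly_Mapping.keys p"
  by (auto simp: in_keys_iff)

lemma sandwich_wscale: "sandwich u (wscale c p) w = wscale c (sandwich u p w)"
proof -
  have "sandwich u (wscale c p) w =
    (\<Sum>z\<in>Poly_Mapping.keys p. Poly_Mapping.single (u @ z @ w) (c * Poly_Mapping.lookup p z))"
    by (subst sandwich_eq_sum[of "Poly_Mapping.keys p"]) (simp_all add: keys_wscale)
  then show ?thesis by (simp add: sandwich_def words.scale_sum_right wscale_single)
qed

lemma sandwich_single [simp]:
  "sandwich u (Poly_Mapping.single z c) w = Poly_Mapping.single (u @ z @ w) c"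
  by (subst sandwich_eq_sum[of "{z}"]) auto

lemma sandwich_sum: "sandwich u (\<Sum>a\<in>A. f a) w = (\<Sum>a\<in>A. sandwich u (f a) w)"
proof (cases "finite A")
  case True
  then show ?thesis
    by (induction A) (simp_all add: sandwich_add, simp_all add: sandwich_def)
qed (simp add: sandwich_def)

lemma sandwich_sandwich: "sandwich u (sandwich u' p w') w = sandwich (u @ u') p (w' @ w)"
  by (simp add: sandwich_def[of u' p w'] sandwich_sum) (simp add: sandwich_def)

lemma sandwich_minus: "sandwich u (p - q) w = sandwich u p w - sandwich u q w"
  using sandwich_add[of u "p - q" q w] by (simp add: algebra_simps)

context
  fixes sc :: "complex \<Rightarrow> 'l::ab_group_add \<Rightarrow> 'l" and br :: "'l \<Rightarrow> 'l \<Rightarrow> 'l"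
    and L :: "'l set" and S :: "('l list \<Rightarrow>\<^sub>0 complex) set"
begin

private abbreviation "N \<equiv> relation_space sc br L S"
private abbreviation "M \<equiv> cyclic_module sc br L S"

lemma relation_space_subspace: "words.subspace N"
  unfolding relation_space_def by (rule words.subspace_span)

lemmas relation_space_closed =
  words.subspace_add[OF relation_space_subspace] words.subspace_diff[OF relation_space_subspace]
  words.subspace_scale[OF relation_space_subspace] words.subspace_0[OF relation_space_subspace]
  words.subspace_neg[OF relation_space_subspace]

lemma sandwich_relation_space:
  assumes "a \<in> L" "q \<in> N"
  shows "sandwich [a] q [] \<in> N"
  using assms(2) unfolding relation_space_def
proof (induction rule: words.span_induct_alt)
  case base
  show ?case by (simp add: sandwich_def words.span_zero)
next
  case (step c g q)
  have "sandwich [a] g [] \<in> words.span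
       ({sandwich u r w | u r w.
           u \<in> lists L \<and> w \<in> lists L \<and> r \<in> enveloping_relations sc br L} \<union>
        {sandwich u s [] | u s. u \<in> lists L \<and> s \<in> S})"
  proof (rule words.span_base)
    consider (1) u r w where "g = sandwich u r w" "u \<in> lists L" "w \<in> lists L"
        "r \<in> enveloping_relations sc br L"
      | (2) u s where "g = sandwich u s []" "u \<in> lists L" "s \<in> S"
      using step.hyps(1) by blast
    then show "sandwich [a] g [] \<in>
       ({sandwich u r w | u r w.
           u \<in> lists L \<and> w \<in> lists L \<and> r \<in> enveloping_relations sc br L} \<union>
        {sandwich u s [] | u s. u \<in> lists L \<and> s \<in> S})"
    proof cases
      case 1
      then have "sandwich [a] g [] = sandwich (a # u) r w" "a # u \<in> lists L"
        using assms(1) by (simp_all add: sandwich_sandwich)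
      with 1 show ?thesis by blast
    next
      case 2
      then have "sandwich [a] g [] = sandwich (a # u) s []" "a # u \<in> lists L"
        using assms(1) by (simp_all add: sandwich_sandwich)
      with 2 show ?thesis by blast
    qed
  qed
  then show ?case
    using step.IH by (simp add: sandwich_add sandwich_wscale words.span_add words.span_scale)
qed

lemma rel_coset_eq_iff: "rel_coset N p = rel_coset N q \<longleftrightarrow> p - q \<in> N"
proof
  assume "rel_coset N p = rel_coset N q"
  moreover have "p \<in> rel_coset N p"
    unfolding rel_coset_def using relation_space_closed(4) by (rule rev_image_eqI) simp
  ultimately show "p - q \<in> N" by (auto simp: rel_coset_def)
next
  assume d: "p - q \<in> N"
  have "p + r \<in> rel_coset N q" if "r \<in> N" for r
    unfolding rel_coset_def using relation_space_closed(1)[OF d that]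
    by (rule rev_image_eqI) simp
  moreover have "q + r \<in> rel_coset N p" if "r \<in> N" for r
    unfolding rel_coset_def using relation_space_closed(2)[OF that d]
    by (rule rev_image_eqI) simp
  ultimately show "rel_coset N p = rel_coset N q" by (auto simp: rel_coset_def)
qed

lemma cyclic_module_simps:
  "carrier M = {rel_coset N p | p. Poly_Mapping.keys p \<subseteq> lists L}"
  "\<zero>\<^bsub>M\<^esub> = rel_coset N 0"
  "rel_coset N p \<oplus>\<^bsub>M\<^esub> rel_coset N q = rel_coset N (p + q)"
  "c \<odot>\<^bsub>M\<^esub> rel_coset N p = rel_coset N (wscale c p)"
proof -
  show "rel_coset N p \<oplus>\<^bsub>M\<^esub> rel_coset N q = rel_coset N (p + q)"
  proof (intro equalityI subsetI)
    fix z assume "z \<in> rel_coset N p \<oplus>\<^bsub>M\<^esub> rel_coset N q"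
    then obtain a b where "a \<in> N" "b \<in> N" "z = (p + a) + (q + b)"
      by (auto simp: cyclic_module_def Let_def rel_coset_def)
    then show "z \<in> rel_coset N (p + q)"
      unfolding rel_coset_def
      by (intro image_eqI[of _ _ "a + b"]) (simp_all add: relation_space_closed algebra_simps)
  next
    fix z assume "z \<in> rel_coset N (p + q)"
    then obtain a where a: "a \<in> N" "z = (p + a) + (q + 0)" by (auto simp: rel_coset_def ac_simps)
    have "p + a \<in> rel_coset N p" "q + 0 \<in> rel_coset N q"
      unfolding rel_coset_def using a(1) relation_space_closed(4) by (blast intro: imageI)+
    with a(2) show "z \<in> rel_coset N p \<oplus>\<^bsub>M\<^esub> rel_coset N q"
      by (auto simp: cyclic_module_def Let_def)
  qed
  show "c \<odot>\<^bsub>M\<^esub> rel_coset N p = rel_coset N (wscale c p)"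
  proof (intro equalityI subsetI)
    fix z assume "z \<in> c \<odot>\<^bsub>M\<^esub> rel_coset N p"
    then obtain a q where "a \<in> N" "q \<in> N" "z = wscale c (p + a) + q"
      by (auto simp: cyclic_module_def Let_def rel_coset_def)
    then show "z \<in> rel_coset N (wscale c p)"
      unfolding rel_coset_def
      by (intro image_eqI[of _ _ "wscale c a + q"])
        (simp_all add: relation_space_closed words.scale_right_distrib algebra_simps)
  next
    fix z assume "z \<in> rel_coset N (wscale c p)"
    then obtain q where "q \<in> N" "z = wscale c (p + 0) + q" by (auto simp: rel_coset_def)
    then show "z \<in> c \<odot>\<^bsub>M\<^esub> rel_coset N p"
      using relation_space_closed(4) unfolding cyclic_module_def Let_def rel_coset_def
      by (fastforce)
  qed
qed (simp_all add: cyclic_module_def Let_def)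

lemma cyclic_module_vectorspace: "vectorspace class_ring M"
proof -
  have add_keys: "Poly_Mapping.keys (p + q) \<subseteq> lists L"
    if "Poly_Mapping.keys p \<subseteq> lists L" "Poly_Mapping.keys q \<subseteq> lists L"
    for p q :: "'l list \<Rightarrow>\<^sub>0 complex"
    using that Poly_Mapping.keys_add[of p q] by blast
  have scale_keys: "Poly_Mapping.keys (wscale c p) \<subseteq> lists L"
    if "Poly_Mapping.keys p \<subseteq> lists L" for c and p :: "'l list \<Rightarrow>\<^sub>0 complex"
    using that keys_wscale[of c p] by blast
  have zero_keys: "Poly_Mapping.keys (0 :: 'l list \<Rightarrow>\<^sub>0 complex) \<subseteq> lists L"
    by simp
  have carrierE: "\<exists>p. A = rel_coset N p \<and> Poly_Mapping.keys p \<subseteq> lists L" if "A \<in> carrier M" for A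
    using that by (auto simp: cyclic_module_simps)
  have carrierI: "rel_coset N p \<in> carrier M" if "Poly_Mapping.keys p \<subseteq> lists L" for p
    using that by (auto simp: cyclic_module_simps)
  have "abelian_group M"
  proof (rule abelian_groupI)
    show "\<zero>\<^bsub>M\<^esub> \<in> carrier M"
      using carrierI[OF zero_keys] by (simp add: cyclic_module_simps(2))
    fix A assume "A \<in> carrier M"
    then obtain p where p: "A = rel_coset N p" "Poly_Mapping.keys p \<subseteq> lists L"
      using carrierE by blast
    show "\<zero>\<^bsub>M\<^esub> \<oplus>\<^bsub>M\<^esub> A = A" by (simp add: p cyclic_module_simps(2,3))
    show "\<exists>B\<in>carrier M. B \<oplus>\<^bsub>M\<^esub> A = \<zero>\<^bsub>M\<^esub>"
      using p by (intro bexI[of _ "rel_coset N (- p)"] carrierI) (simp_all add: cyclic_module_simps(2,3))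
    fix B assume "B \<in> carrier M"
    then obtain q where q: "B = rel_coset N q" "Poly_Mapping.keys q \<subseteq> lists L"
      using carrierE by blast
    show "A \<oplus>\<^bsub>M\<^esub> B \<in> carrier M"
      using p q by (simp add: cyclic_module_simps(3) carrierI add_keys)
    show "A \<oplus>\<^bsub>M\<^esub> B = B \<oplus>\<^bsub>M\<^esub> A"
      using p q by (simp add: cyclic_module_simps(3) add.commute)
    fix C assume "C \<in> carrier M"
    then obtain r where r: "C = rel_coset N r" using carrierE by blast
    show "A \<oplus>\<^bsub>M\<^esub> B \<oplus>\<^bsub>M\<^esub> C = A \<oplus>\<^bsub>M\<^esub> (B \<oplus>\<^bsub>M\<^esub> C)"
      using p q r by (simp add: cyclic_module_simps(3) add.assoc)
  qed
  moreover have fld: "field (class_ring :: complex ring)" by (rule class_field)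
  moreover have "cring (class_ring :: complex ring)"
    using fld by (simp add: field_def domain_def)
  moreover have "module_axioms class_ring M"
  proof (rule module_axioms.intro)
    fix c d :: complex and A B assume "A \<in> carrier M" "B \<in> carrier M"
    then obtain p q where p: "A = rel_coset N p" "Poly_Mapping.keys p \<subseteq> lists L"
      and q: "B = rel_coset N q"
      using carrierE by blast
    show "c \<odot>\<^bsub>M\<^esub> A \<in> carrier M"
      using p by (simp add: cyclic_module_simps(4) carrierI scale_keys)
    show "(c \<oplus>\<^bsub>class_ring\<^esub> d) \<odot>\<^bsub>M\<^esub> A = c \<odot>\<^bsub>M\<^esub> A \<oplus>\<^bsub>M\<^esub> d \<odot>\<^bsub>M\<^esub> A"
      using p by (simp add: cyclic_module_simps(3,4) words.scale_left_distrib)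
    show "c \<odot>\<^bsub>M\<^esub> (A \<oplus>\<^bsub>M\<^esub> B) = c \<odot>\<^bsub>M\<^esub> A \<oplus>\<^bsub>M\<^esub> c \<odot>\<^bsub>M\<^esub> B"
      using p q by (simp add: cyclic_module_simps(3,4) words.scale_right_distrib)
    show "(c \<otimes>\<^bsub>class_ring\<^esub> d) \<odot>\<^bsub>M\<^esub> A = c \<odot>\<^bsub>M\<^esub> (d \<odot>\<^bsub>M\<^esub> A)"
      using p by (simp add: cyclic_module_simps(4))
    show "\<one>\<^bsub>class_ring\<^esub> \<odot>\<^bsub>M\<^esub> A = A"
      using p by (simp add: cyclic_module_simps(4))
  qed
  ultimately show ?thesis
    by (intro vectorspace.intro Module.module.intro)
qed

lemma cyclic_act_rel_coset:
  assumes "a \<in> L"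
  shows "cyclic_act sc br L S a (rel_coset N p) = rel_coset N (sandwich [a] p [])"
proof (intro equalityI subsetI)
  fix z assume "z \<in> cyclic_act sc br L S a (rel_coset N p)"
  then obtain b q where "b \<in> N" "q \<in> N" "z = sandwich [a] (p + b) [] + q"
    by (auto simp: cyclic_act_def rel_coset_def)
  then show "z \<in> rel_coset N (sandwich [a] p [])"
    unfolding rel_coset_def
    by (intro image_eqI[of _ _ "sandwich [a] b [] + q"])
      (simp_all add: relation_space_closed sandwich_relation_space assms sandwich_add algebra_simps)
next
  fix z assume "z \<in> rel_coset N (sandwich [a] p [])"
  then obtain q where "q \<in> N" "z = sandwich [a] (p + 0) [] + q" by (auto simp: rel_coset_def)
  moreover have "p + 0 \<in> rel_coset N p"
    unfolding rel_coset_def using relation_space_closed(4) by (rule imageI)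
  ultimately show "z \<in> cyclic_act sc br L S a (rel_coset N p)"
    unfolding cyclic_act_def by blast
qed

lemma cyclic_act_bracket:
  assumes "a \<in> L" "b \<in> L" "br a b \<in> L" "A \<in> carrier M"
  shows "cyclic_act sc br L S (br a b) A \<oplus>\<^bsub>M\<^esub>
           cyclic_act sc br L S b (cyclic_act sc br L S a A)
         = cyclic_act sc br L S a (cyclic_act sc br L S b A)"
proof -
  obtain p where p: "A = rel_coset N p" "Poly_Mapping.keys p \<subseteq> lists L"
    using assms(4) by (auto simp: cyclic_module_simps)
  let ?r = "word [a, b] - word [b, a] - word [br a b]"
  have r: "?r \<in> enveloping_relations sc br L"
    using assms(1,2) unfolding enveloping_relations_def by blast
  have "sandwich [] ?r z \<in> N" if "z \<in> Poly_Mapping.keys p" for z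
  proof -
    have "z \<in> lists L" using p(2) that by blast
    with r show ?thesis
      unfolding relation_space_def by (intro words.span_base) blast
  qed
  then have "(\<Sum>z\<in>Poly_Mapping.keys p. wscale (Poly_Mapping.lookup p z) (sandwich [] ?r z)) \<in> N"
    by (intro words.subspace_sum[OF relation_space_subspace] relation_space_closed(3))
  also have "(\<Sum>z\<in>Poly_Mapping.keys p. wscale (Poly_Mapping.lookup p z) (sandwich [] ?r z)) =
      sandwich [a, b] p [] - sandwich [b, a] p [] - sandwich [br a b] p []"
    by (simp add: sandwich_minus words.scale_right_diff_distrib wscale_single sum_subtractf)
      (simp add: sandwich_def)
  finally have "sandwich [a, b] p [] - (sandwich [br a b] p [] + sandwich [b, a] p []) \<in> N"
    by (simp add: algebra_simps)
  then show ?thesis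
    using assms p(1)
    by (simp add: cyclic_act_rel_coset sandwich_sandwich cyclic_module_simps rel_coset_eq_iff[symmetric])
qed

lemma cyclic_act_linear_left:
  assumes "a \<in> L" "b \<in> L" "a + b \<in> L" "sc c a \<in> L" "A \<in> carrier M"
  shows "cyclic_act sc br L S (a + b) A = cyclic_act sc br L S a A \<oplus>\<^bsub>M\<^esub> cyclic_act sc br L S b A"
    and "cyclic_act sc br L S (sc c a) A = c \<odot>\<^bsub>M\<^esub> cyclic_act sc br L S a A"
proof -
  obtain p where p: "A = rel_coset N p" "Poly_Mapping.keys p \<subseteq> lists L"
    using assms(5) by (auto simp: cyclic_module_simps)
  have aux: "(\<Sum>z\<in>Poly_Mapping.keys p. wscale (Poly_Mapping.lookup p z) (sandwich [] r z)) \<in> N"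
    if "r \<in> enveloping_relations sc br L" for r
  proof (intro words.subspace_sum[OF relation_space_subspace] relation_space_closed(3))
    fix z assume "z \<in> Poly_Mapping.keys p"
    then have "z \<in> lists L" using p(2) by blast
    with that show "sandwich [] r z \<in> N"
      unfolding relation_space_def by (intro words.span_base) blast
  qed
  have "word [a + b] - word [a] - word [b] \<in> enveloping_relations sc br L"
    using assms(1,2) unfolding enveloping_relations_def by blast
  from aux[OF this] have "sandwich [a + b] p [] - (sandwich [a] p [] + sandwich [b] p []) \<in> N"
    by (simp add: sandwich_minus words.scale_right_diff_distrib wscale_single sum_subtractf)
      (simp add: sandwich_def algebra_simps)
  then show "cyclic_act sc br L S (a + b) A =
      cyclic_act sc br L S a A \<oplus>\<^bsub>M\<^esub> cyclic_act sc br L S b A"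
    using assms p(1) by (simp add: cyclic_act_rel_coset cyclic_module_simps rel_coset_eq_iff)
  have "word [sc c a] - wscale c (word [a]) \<in> enveloping_relations sc br L"
    using assms(1) unfolding enveloping_relations_def by blast
  from aux[OF this] have "sandwich [sc c a] p [] - wscale c (sandwich [a] p []) \<in> N"
    by (simp add: sandwich_minus words.scale_right_diff_distrib wscale_single sum_subtractf)
      (simp add: sandwich_def words.scale_sum_right wscale_single algebra_simps)
  then show "cyclic_act sc br L S (sc c a) A = c \<odot>\<^bsub>M\<^esub> cyclic_act sc br L S a A"
    using assms p(1) by (simp add: cyclic_act_rel_coset cyclic_module_simps rel_coset_eq_iff)
qed

lemma cyclic_gen_word:
  "w \<in> lists L \<Longrightarrow>
     foldr (cyclic_act sc br L S) w (cyclic_gen sc br L S) = rel_coset N (word w)"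
  by (induction w) (auto simp: cyclic_gen_def cyclic_act_rel_coset)

lemma cyclic_gen_relations:
  assumes "s \<in> S"
  shows "rel_coset N s = \<zero>\<^bsub>M\<^esub>"
proof -
  have "sandwich [] s [] = s"
    by (simp add: sandwich_def poly_mapping_eqI lookup_sum lookup_single when_def sum.delta' in_keys_iff)
  moreover have "sandwich [] s [] \<in> N"
    using assms unfolding relation_space_def by (intro words.span_base) blast
  ultimately show ?thesis by (simp add: cyclic_module_simps rel_coset_eq_iff)
qed

end


section \<open>Simple Lie algebras of type A and D with their diagram automorphisms\<close>

locale simple_lie_algebra = vector_space scale
  for scale :: "complex \<Rightarrow> 'a::ab_group_add \<Rightarrow> 'a" +
  fixes br :: "'a \<Rightarrow> 'a \<Rightarrow> 'a"
  assumes br_add_left: "br (a + b) c = br a c + br b c"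
    and br_add_right: "br a (b + c) = br a b + br a c"
    and br_scale_left: "br (scale r a) b = scale r (br a b)"
    and br_scale_right: "br a (scale r b) = scale r (br a b)"
    and br_self: "br a a = 0"
    and jacobi: "br a (br b c) + br b (br c a) + br c (br a b) = 0"
    and finite_dim: "\<exists>B. finite B \<and> span B = UNIV"
    and non_abelian: "\<exists>a b. br a b \<noteq> 0"
    and simple: "subspace J \<Longrightarrow> (\<And>a b. b \<in> J \<Longrightarrow> br a b \<in> J) \<Longrightarrow> J = {0} \<or> J = UNIV"
begin

definition lie_generated :: "'a set \<Rightarrow> 'a set" where
  "lie_generated S = \<Inter>{T. subspace T \<and> S \<subseteq> T \<and> (\<forall>a\<in>T. \<forall>b\<in>T. br a b \<in> T)}"

end

text \<open>\<open>A_even\<close>, \<open>A_odd\<close>, \<open>D\<close> with parameter \<open>n\<close>: types $A_{2n}$, $A_{2n-1}$, $D_{n+1}$.\<close>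

datatype twisted_type = A_even | A_odd | D

fun admissible :: "twisted_type \<Rightarrow> nat \<Rightarrow> bool" where
  "admissible A_even n \<longleftrightarrow> n \<ge> 1"
| "admissible A_odd n \<longleftrightarrow> n \<ge> 2"
| "admissible D n \<longleftrightarrow> n \<ge> 3"

fun lie_rank :: "twisted_type \<Rightarrow> nat \<Rightarrow> nat" where
  "lie_rank A_even n = 2 * n"
| "lie_rank A_odd n = 2 * n - 1"
| "lie_rank D n = n + 1"

text \<open>In all Cartan matrices the \<open>(i, j)\<close> entry is \<open>\<alpha>\<^sub>j(\<alpha>\<^sub>i\<^sup>\<or>)\<close>; nodes as in Bourbaki, from 1.\<close>

definition cartan_A :: "nat \<Rightarrow> nat \<Rightarrow> int" where
  "cartan_A i j = (if i = j then 2 else if i = j + 1 \<or> j = i + 1 then -1 else 0)"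

definition cartan_D :: "nat \<Rightarrow> nat \<Rightarrow> nat \<Rightarrow> int" where
  "cartan_D N i j =
     (if i = j then 2
      else if i < N \<and> j < N \<and> (i = j + 1 \<or> j = i + 1) then -1
      else if (i = N \<and> j = N - 2) \<or> (i = N - 2 \<and> j = N) then -1
      else 0)"

text \<open>\<open>\<alpha>\<^sub>n\<close> is short in type B and long in type C.\<close>

definition cartan_B :: "nat \<Rightarrow> nat \<Rightarrow> nat \<Rightarrow> int" where
  "cartan_B n i j = (if i = n \<and> j + 1 = n then -2 else cartan_A i j)"

definition cartan_C :: "nat \<Rightarrow> nat \<Rightarrow> nat \<Rightarrow> int" where
  "cartan_C n i j = (if i + 1 = n \<and> j = n then -2 else cartan_A i j)"

fun cartan :: "twisted_type \<Rightarrow> nat \<Rightarrow> nat \<Rightarrow> nat \<Rightarrow> int" where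
  "cartan A_even n = cartan_A"
| "cartan A_odd n = cartan_A"
| "cartan D n = cartan_D (n + 1)"

fun fixed_cartan :: "twisted_type \<Rightarrow> nat \<Rightarrow> nat \<Rightarrow> nat \<Rightarrow> int" where
  "fixed_cartan A_even n = cartan_B n"
| "fixed_cartan A_odd n = cartan_C n"
| "fixed_cartan D n = cartan_B n"

fun diagram_aut :: "twisted_type \<Rightarrow> nat \<Rightarrow> nat \<Rightarrow> nat" where
  "diagram_aut A_even n i = 2 * n + 1 - i"
| "diagram_aut A_odd n i = 2 * n - i"
| "diagram_aut D n i = (if i = n then n + 1 else if i = n + 1 then n else i)"

text \<open>
  A simple Lie algebra of the given type, with Cartan subalgebra and triangular decomposition
  coming from Chevalley generators, and the automorphism of order two which permutes the
  Chevalley generators according to the diagram automorphism.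
\<close>

locale twisted_lie_algebra = simple_lie_algebra scale br
  for scale :: "complex \<Rightarrow> 'a::ab_group_add \<Rightarrow> 'a" and br :: "'a \<Rightarrow> 'a \<Rightarrow> 'a" +
  fixes X :: twisted_type and n :: nat
    and E F H :: "nat \<Rightarrow> 'a"
    and \<sigma> :: "'a \<Rightarrow> 'a"
  assumes admissible: "admissible X n"
    and HH: "\<lbrakk>i \<in> {1..lie_rank X n}; j \<in> {1..lie_rank X n}\<rbrakk> \<Longrightarrow> br (H i) (H j) = 0"
    and EF: "\<lbrakk>i \<in> {1..lie_rank X n}; j \<in> {1..lie_rank X n}\<rbrakk> \<Longrightarrow>
               br (E i) (F j) = (if i = j then H i else 0)"
    and HE: "\<lbrakk>i \<in> {1..lie_rank X n}; j \<in> {1..lie_rank X n}\<rbrakk> \<Longrightarrow>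
               br (H i) (E j) = scale (of_int (cartan X n i j)) (E j)"
    and HF: "\<lbrakk>i \<in> {1..lie_rank X n}; j \<in> {1..lie_rank X n}\<rbrakk> \<Longrightarrow>
               br (H i) (F j) = scale (- of_int (cartan X n i j)) (F j)"
    and generated: "lie_generated (E ` {1..lie_rank X n} \<union> F ` {1..lie_rank X n}) = UNIV"
    and \<sigma>_linear: "Vector_Spaces.linear scale scale \<sigma>"
    and \<sigma>_bij: "bij \<sigma>"
    and \<sigma>_br: "\<sigma> (br a b) = br (\<sigma> a) (\<sigma> b)"
    and \<sigma>_E: "i \<in> {1..lie_rank X n} \<Longrightarrow> \<sigma> (E i) = E (diagram_aut X n i)"
    and \<sigma>_F: "i \<in> {1..lie_rank X n} \<Longrightarrow> \<sigma> (F i) = F (diagram_aut X n i)"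
begin

definition \<h> :: "'a set" where "\<h> = span (H ` {1..lie_rank X n})"
definition npos :: "'a set" where "npos = lie_generated (E ` {1..lie_rank X n})"

text \<open>The eigenspaces \<open>\<g>\<^sub>\<epsilon>\<close> of \<open>\<sigma>\<close>, \<open>\<epsilon> \<in> {0, 1}\<close>, and \<open>\<a>\<^sub>\<epsilon> = \<a> \<inter> \<g>\<^sub>\<epsilon>\<close>.\<close>

definition part :: "'a set \<Rightarrow> nat \<Rightarrow> 'a set" where
  "part A \<epsilon> = {a \<in> A. \<sigma> a = scale ((-1) ^ \<epsilon>) a}"

definition h0 :: "'a set" where "h0 = part \<h> 0"

text \<open>Linear forms on \<open>h0\<close> are represented by functions vanishing outside \<open>h0\<close>.\<close>

definition h0_dual :: "('a \<Rightarrow> complex) set" where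
  "h0_dual = {\<phi>. (\<forall>a. a \<notin> h0 \<longrightarrow> \<phi> a = 0) \<and>
                 (\<forall>a\<in>h0. \<forall>b\<in>h0. \<phi> (a + b) = \<phi> a + \<phi> b) \<and>
                 (\<forall>c. \<forall>a\<in>h0. \<phi> (scale c a) = c * \<phi> a)}"

definition weight_space :: "nat \<Rightarrow> ('a \<Rightarrow> complex) \<Rightarrow> 'a set" where
  "weight_space \<epsilon> \<phi> = {a \<in> part UNIV \<epsilon>. \<forall>b\<in>h0. br b a = scale (\<phi> b) a}"

text \<open>Non-zero weights of \<open>h0\<close> on \<open>\<g>\<^sub>\<epsilon>\<close>: \<open>roots 0\<close> is $R_0$ and \<open>roots 1\<close> is $R_1$.\<close>

definition roots :: "nat \<Rightarrow> ('a \<Rightarrow> complex) set" where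
  "roots \<epsilon> = {\<phi> \<in> h0_dual. (\<exists>a. \<phi> a \<noteq> 0) \<and> weight_space \<epsilon> \<phi> \<noteq> {0}}"

definition nonneg_span :: "(nat \<Rightarrow> 'a \<Rightarrow> complex) \<Rightarrow> ('a \<Rightarrow> complex) set" where
  "nonneg_span \<alpha> = {(\<lambda>a. \<Sum>i=1..n. of_nat (c i) * \<alpha> i a) | c :: nat \<Rightarrow> nat. True}"

definition R0_pos :: "('a \<Rightarrow> complex) set" where
  "R0_pos = {\<phi> \<in> roots 0. weight_space 0 \<phi> \<subseteq> npos}"

definition is_coroot :: "('a \<Rightarrow> complex) \<Rightarrow> 'a \<Rightarrow> bool" where
  "is_coroot \<phi> b \<longleftrightarrow>
     (\<exists>u\<in>weight_space 0 \<phi>. \<exists>v\<in>weight_space 0 (\<lambda>a. - \<phi> a). b = br u v) \<and> \<phi> b = 2"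

text \<open>\<open>\<a>[t]\<^sup>\<sigma>\<close> for a \<open>\<sigma>\<close>-stable \<open>\<a>\<close>; the element \<open>a \<otimes> t\<^sup>k\<close> is \<open>monom a k\<close>.\<close>

definition twisted_current :: "'a set \<Rightarrow> 'a poly set" where
  "twisted_current A = {p. \<forall>k. coeff p k \<in> part A (k mod 2)}"

definition current_scale :: "complex \<Rightarrow> 'a poly \<Rightarrow> 'a poly" where
  "current_scale c p = map_poly (scale c) p"

definition current_br :: "'a poly \<Rightarrow> 'a poly \<Rightarrow> 'a poly" where
  "current_br p q =
     (\<Sum>k\<le>degree p. \<Sum>l\<le>degree q. monom (br (coeff p k) (coeff q l)) (k + l))"

end


section \<open>Twisted Kirillov-Reshetikhin modules\<close>

text \<open>
  \<open>\<alpha> i\<close>, \<open>\<alpha>c i\<close>, \<open>\<omega> i\<close> are the simple roots, simple coroots and fundamental weights of $g_0$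
  ($Q_0^+$ is \<open>nonneg_span \<alpha>\<close>), and \<open>x i\<close> and \<open>y i\<close> are the elements $x^-_{\alpha_i}$ and $y^-_{\alpha_i}$.
\<close>

locale twisted_KR = twisted_lie_algebra scale br X n E F H \<sigma>
  for scale :: "complex \<Rightarrow> 'a::ab_group_add \<Rightarrow> 'a" and br :: "'a \<Rightarrow> 'a \<Rightarrow> 'a"
    and X n E F H \<sigma> +
  fixes \<alpha> :: "nat \<Rightarrow> 'a \<Rightarrow> complex" and \<alpha>c :: "nat \<Rightarrow> 'a" and \<omega> :: "nat \<Rightarrow> 'a \<Rightarrow> complex"
    and x y :: "nat \<Rightarrow> 'a"
  assumes \<alpha>_pos: "i \<in> {1..n} \<Longrightarrow> \<alpha> i \<in> R0_pos"
    and \<alpha>_base: "R0_pos \<subseteq> nonneg_span \<alpha>"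
    and \<alpha>c: "i \<in> {1..n} \<Longrightarrow> is_coroot (\<alpha> i) (\<alpha>c i)"
    and \<alpha>_bourbaki: "\<lbrakk>i \<in> {1..n}; j \<in> {1..n}\<rbrakk> \<Longrightarrow> \<alpha> j (\<alpha>c i) = of_int (fixed_cartan X n i j)"
    and \<omega>_dual: "i \<in> {1..n} \<Longrightarrow> \<omega> i \<in> h0_dual"
    and \<omega>: "\<lbrakk>i \<in> {1..n}; j \<in> {1..n}\<rbrakk> \<Longrightarrow> \<omega> i (\<alpha>c j) = (if i = j then 1 else 0)"
    and x: "i \<in> {1..n} \<Longrightarrow> x i \<in> weight_space 0 (\<lambda>a. - \<alpha> i a) - {0}"
    and y: "\<lbrakk>i \<in> {1..n}; \<alpha> i \<in> roots 1 \<inter> nonneg_span \<alpha>\<rbrakk> \<Longrightarrow> y i \<in> weight_space 1 (\<lambda>a. - \<alpha> i a) - {0}"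
    and y_zero: "\<lbrakk>i \<in> {1..n}; \<alpha> i \<notin> roots 1 \<inter> nonneg_span \<alpha>\<rbrakk> \<Longrightarrow> y i = 0"
begin

definition KR_relations :: "nat \<Rightarrow> nat \<Rightarrow> ('a poly list \<Rightarrow>\<^sub>0 complex) set" where
  "KR_relations m i =
     {word [p] | p. p \<in> twisted_current npos} \<union>
     {word [monom b 0] - Poly_Mapping.single [] (of_nat m * \<omega> i b) | b. b \<in> h0} \<union>
     {word [monom b (2 * r - \<epsilon>)] | b r \<epsilon>. \<epsilon> \<in> {0, 1} \<and> b \<in> part \<h> \<epsilon> \<and> r \<ge> 1} \<union>
     {word [monom (x j) 0] | j. j \<in> {1..n} \<and> j \<noteq> i} \<union>
     {word (replicate (m + 1) (monom (x i) 0)), word [monom (x i) 2], word [monom (y i) 1]}"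

definition KR :: "nat \<Rightarrow> nat \<Rightarrow> (complex, ('a poly list \<Rightarrow>\<^sub>0 complex) set) module" where
  "KR m i = cyclic_module current_scale current_br (twisted_current UNIV) (KR_relations m i)"

end

end

theory Submission
  imports Defs
begin

text \<open>
  Call \<open>z \<in> \<g>[t]\<^sup>\<sigma>\<close> nilpotent if both \<open>ad z\<close> and the action of \<open>z\<close> on the module are locally nilpotent.
  Conjugating by \<open>exp z\<close> shows that the span of the nilpotent elements is a Lie subalgebra.  It contains
  the positive part, which kills the generator, and, by the defining relations, the negative simple root
  vectors of \<open>\<g>\<^sub>0\<close> and \<open>\<g>\<^sub>1\<close> in all degrees; these generate \<open>\<g>[t]\<^sup>\<sigma>\<close>.  The relations also imply that
  elements of high degree in \<open>t\<close> kill the generator, hence the module, so a finite-dimensional quotient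
  of \<open>\<g>[t]\<^sup>\<sigma>\<close> acts, and it is spanned by finitely many nilpotent elements \<open>z\<^sub>1, \<dots>, z\<^sub>d\<close>.  By the spanning half of
  Poincare-Birkhoff-Witt, the ordered monomials in the \<open>z\<^sub>j\<close> applied to the generator span the module,
  and only finitely many of these are non-zero.  This avoids weights of the module and the Weyl group.
\<close>

section \<open>Local nilpotency\<close>

text \<open>Two points carry the proof. The curve exp(s ad a)(b) is polynomial in \<open>s\<close>
  and consists of nilpotent elements, so its linear coefficient [a, b] lies in their span, although
  it need not be nilpotent itself. The other point is degree 0. In positive degree a bracket can be
  split between neighbouring degrees, so both eigencomponents of a generator are at hand. In degree
  0 only \<g>_0 is present, and its negative part has to come from the vectors F i + F (\<tau> i)
  alone. Instead of root strings, words in the F i are treated by induction on length: a word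
  symmetrised by \<sigma> has negative weight on some folded coroot, bracketing with E i + E (\<tau>
  i) shortens it, and an sl2 argument applies. Elsewhere a single \<sigma>-fixed element \<rho>,
  half the sum of the positive coroots, stands in for the root system. Its adjoint action is the
  height; since only finitely many heights occur, ad-nilpotency and the vanishing of long words
  follow, and comparing values at \<rho> identifies each restricted simple root of \<g> with one of
  the given \<open>\<alpha> j\<close>.\<close>

context vector_space
begin

text \<open>Compare \<open>p(2s)\<close> with \<open>2\<^sup>d p(s)\<close> to remove the leading coefficient.\<close>

lemma subspace_polynomial_coeffs:
  fixes c :: "nat \<Rightarrow> 'b"
  assumes "subspace S" "\<And>s::'a. (\<Sum>k<d. scale (s ^ k) (c k)) \<in> S" "k < d"
    "\<And>i j. i < j \<Longrightarrow> (2::'a) ^ i - 2 ^ j \<noteq> 0"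
  shows "c k \<in> S"
  using assms(2,3)
proof (induction d arbitrary: c k)
  case (Suc d)
  have low: "c k \<in> S" if "k < d" for k
  proof -
    have "scale (2 ^ k - 2 ^ d) (c k) \<in> S"
    proof (rule Suc.IH[where c = "\<lambda>k. scale (2 ^ k - 2 ^ d) (c k)", OF _ that])
      fix s :: 'a
      have "(\<Sum>k<Suc d. scale ((2 * s) ^ k) (c k)) - scale (2 ^ d) (\<Sum>k<Suc d. scale (s ^ k) (c k))
        = (\<Sum>k<d. scale (s ^ k) (scale (2 ^ k - 2 ^ d) (c k)))"
        by (simp add: scale_sum_right power_mult_distrib sum_subtractf[symmetric]
            scale_left_diff_distrib scale_right_distrib algebra_simps)
      moreover have "(\<Sum>k<Suc d. scale ((2 * s) ^ k) (c k))
          - scale (2 ^ d) (\<Sum>k<Suc d. scale (s ^ k) (c k)) \<in> S"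
        by (intro subspace_diff subspace_scale assms(1) Suc.prems)
      ultimately show "(\<Sum>k<d. scale (s ^ k) (scale (2 ^ k - 2 ^ d) (c k))) \<in> S" by simp
    qed
    then have "scale (inverse (2 ^ k - 2 ^ d)) (scale (2 ^ k - 2 ^ d) (c k)) \<in> S"
      by (rule subspace_scale[OF assms(1)])
    then show ?thesis using assms(4)[OF that] by simp
  qed
  \<comment> \<open>The value at s = 1 is the sum of all coefficients; removing the lower ones
    leaves the top one.\<close>
  have "(\<Sum>k<Suc d. scale (1 ^ k) (c k)) - (\<Sum>k<d. c k) \<in> S"
    by (intro subspace_diff subspace_sum assms(1) Suc.prems(1)) (simp add: low)
  then have "c d \<in> S" by simp
  with low Suc.prems(2) show ?case by (cases "k = d") auto
qed simp

end

text \<open>Both \<g> and its current algebra are instances, so brackets and exponentials are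
  treated once.\<close>

locale lie_algebra = vector_space sc
  for sc :: "complex \<Rightarrow> 'l::ab_group_add \<Rightarrow> 'l" +
  fixes br :: "'l \<Rightarrow> 'l \<Rightarrow> 'l"
  assumes br_add_left: "br (a + b) c = br a c + br b c"
    and br_add_right: "br a (b + c) = br a b + br a c"
    and br_scale_left: "br (sc r a) b = sc r (br a b)"
    and br_scale_right: "br a (sc r b) = sc r (br a b)"
    and br_self: "br a a = 0"
    and jacobi: "br a (br b c) + br b (br c a) + br c (br a b) = 0"
begin

lemma br_linear: "Vector_Spaces.linear sc sc (br a)"
  by (rule Vector_Spaces.linear_iff[THEN iffD2])
    (simp add: br_add_right br_scale_right vector_space_axioms)

lemma br_anti: "br b a = - br a b"
proof -
  have "br a b + br b a = br (a + b) (a + b)"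
    by (simp add: br_add_left br_add_right) (simp add: br_self)
  also have "\<dots> = 0" by (rule br_self)
  finally show ?thesis by (simp add: eq_neg_iff_add_eq_0 add.commute)
qed

lemma br_0 [simp]: "br 0 a = 0" "br a 0 = 0"
  using br_add_left[of 0 0 a] br_add_right[of a 0 0] by simp_all

lemma br_minus_right: "br a (- b) = - br a b"
  using br_add_right[of a b "- b"] by (simp add: add_eq_0_iff)

lemma br_minus_left: "br (- a) b = - br a b"
  using br_add_left[of a "- a" b] by (simp add: add_eq_0_iff)

lemma br_diff_right: "br a (b - c) = br a b - br a c"
  using br_add_right[of a b "- c"] by (simp add: br_minus_right)

lemma br_diff_left: "br (a - b) c = br a c - br b c"
  using br_add_left[of a "- b" c] by (simp add: br_minus_left)

lemma br_sum_left: "br (\<Sum>i\<in>A. f i) b = (\<Sum>i\<in>A. br (f i) b)"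
  by (induction A rule: infinite_finite_induct) (auto simp: br_add_left)

lemma br_br: "br (br a b) c = br a (br b c) - br b (br a c)"
  using jacobi[of a b c] br_anti[of c a] br_anti[of c "br a b"]
  by (simp add: br_minus_right algebra_simps)

lemma funpow_br_add: "(br a ^^ k) (b + c) = (br a ^^ k) b + (br a ^^ k) c"
  by (induction k) (simp_all add: br_add_right)

lemma funpow_br_0: "(br a ^^ k) 0 = 0"
  by (induction k) simp_all

lemma funpow_br_le: "(br a ^^ k) b = 0 \<Longrightarrow> k \<le> l \<Longrightarrow> (br a ^^ l) b = 0"
  using funpow_add[of "l - k" k "br a"] by (simp add: funpow_br_0)

lemma funpow_br_scale: "(br a ^^ k) (sc c b) = sc c ((br a ^^ k) b)"
  by (induction k) (simp_all add: br_scale_right)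

lemma funpow_scale_br: "(br (sc c a) ^^ k) b = sc (c ^ k) ((br a ^^ k) b)"
  by (induction k) (simp_all add: br_scale_left br_scale_right)

end

definition locally_nilpotent :: "('v::zero \<Rightarrow> 'v) \<Rightarrow> bool" where
  "locally_nilpotent A \<longleftrightarrow> (\<forall>u. \<exists>k. (A ^^ k) u = 0)"

lemma linear_funpow:
  assumes "Vector_Spaces.linear s s A"
  shows "Vector_Spaces.linear s s (A ^^ k)"
proof (induction k)
  case 0
  interpret Vector_Spaces.linear s s A by fact
  show ?case using vs1.linear_id by (simp add: id_def)
next
  case (Suc k)
  then show ?case unfolding funpow.simps by (rule Vector_Spaces.linear_compose[OF _ assms])
qed

lemma linear_funpow_mono:
  assumes "Vector_Spaces.linear s s A" "(A ^^ k) u = 0" "k \<le> l"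
  shows "(A ^^ l) u = 0"
proof -
  interpret Ak: Vector_Spaces.linear s s "A ^^ (l - k)" by (rule linear_funpow[OF assms(1)])
  have "(A ^^ l) u = (A ^^ (l - k)) ((A ^^ k) u)"
    using funpow_add[of "l - k" k A] assms(3) by simp
  then show ?thesis using assms(2) Ak.zero by simp
qed

text \<open>The bracket is a Lie bracket on the whole type, but only the subspace \<open>L\<close>
  acts: the twisted current algebra is a subset of the polynomials over \<g>. The module fills its
  type, so operators can be iterated freely.\<close>

locale lie_representation = lie_algebra sc br + V: vector_space vsc
  for sc :: "complex \<Rightarrow> 'l::ab_group_add \<Rightarrow> 'l" and br :: "'l \<Rightarrow> 'l \<Rightarrow> 'l"
    and vsc :: "complex \<Rightarrow> 'v::ab_group_add \<Rightarrow> 'v" +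
  fixes L :: "'l set" and act :: "'l \<Rightarrow> 'v \<Rightarrow> 'v"
  assumes L_subspace: "subspace L"
    and L_br: "a \<in> L \<Longrightarrow> b \<in> L \<Longrightarrow> br a b \<in> L"
    and act_linear: "a \<in> L \<Longrightarrow> Vector_Spaces.linear vsc vsc (act a)"
    and act_add_left: "a \<in> L \<Longrightarrow> b \<in> L \<Longrightarrow> act (a + b) u = act a u + act b u"
    and act_scale_left: "a \<in> L \<Longrightarrow> act (sc c a) u = vsc c (act a u)"
    and act_br: "a \<in> L \<Longrightarrow> b \<in> L \<Longrightarrow> act (br a b) u = act a (act b u) - act b (act a u)"
begin

lemma act_0_left: "act 0 u = 0"
  using act_scale_left[of 0 0 u] subspace_0[OF L_subspace] by simp

lemma act_sum_left:
  assumes "\<And>i. i \<in> A \<Longrightarrow> f i \<in> L"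
  shows "act (\<Sum>i\<in>A. f i) u = (\<Sum>i\<in>A. act (f i) u)"
  using assms
  by (induction A rule: infinite_finite_induct)
    (auto simp: act_add_left act_0_left subspace_sum[OF L_subspace])

lemma act_right:
  assumes "a \<in> L"
  shows "act a (u + w) = act a u + act a w" "act a (vsc c u) = vsc c (act a u)" "act a 0 = 0"
    "act a (u - w) = act a u - act a w" "act a (sum g A) = (\<Sum>i\<in>A. act a (g i))"
proof -
  interpret a: Vector_Spaces.linear vsc vsc "act a" by (rule act_linear[OF assms])
  show "act a (u + w) = act a u + act a w" "act a (vsc c u) = vsc c (act a u)" "act a 0 = 0"
    "act a (u - w) = act a u - act a w" "act a (sum g A) = (\<Sum>i\<in>A. act a (g i))"
    by (simp_all add: a.add a.scale a.zero a.diff a.sum)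
qed

lemma L_funpow_br: "a \<in> L \<Longrightarrow> b \<in> L \<Longrightarrow> (br a ^^ k) b \<in> L"
  by (induction k) (auto simp: L_br)

text \<open>The terms of exp(ad a); \<open>div_pow\<close> gives those of exp(a) on the module. The
  factorials turn the Leibniz rule into a convolution without binomial coefficients.\<close>

definition div_ad :: "'l \<Rightarrow> nat \<Rightarrow> 'l \<Rightarrow> 'l" where
  "div_ad a k b = sc (1 / fact k) ((br a ^^ k) b)"

definition div_pow :: "'l \<Rightarrow> nat \<Rightarrow> 'v \<Rightarrow> 'v" where
  "div_pow a k u = vsc (1 / fact k) ((act a ^^ k) u)"

lemma div_ad_L: "a \<in> L \<Longrightarrow> b \<in> L \<Longrightarrow> div_ad a k b \<in> L"
  unfolding div_ad_def by (intro subspace_scale[OF L_subspace] L_funpow_br)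

lemma br_div_ad: "br a (div_ad a k b) = sc (of_nat (Suc k)) (div_ad a (Suc k) b)"
  by (simp add: div_ad_def br_scale_right del: of_nat_Suc)

lemma act_div_pow: "a \<in> L \<Longrightarrow> act a (div_pow a k u) = vsc (of_nat (Suc k)) (div_pow a (Suc k) u)"
  by (simp add: div_pow_def act_right del: of_nat_Suc)

text \<open>The degree k part of exp(a) b = exp(ad a)(b) exp(a).\<close>

lemma div_pow_act:
  assumes "a \<in> L" "b \<in> L"
  shows "div_pow a k (act b u) = (\<Sum>j\<le>k. act (div_ad a j b) (div_pow a (k - j) u))"
proof (induction k)
  case 0
  show ?case by (simp add: div_pow_def div_ad_def)
next
  case (Suc k)
  let ?D = "\<lambda>j. div_ad a j b" and ?T = "\<lambda>j. div_pow a j u"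
  \<comment> \<open>Everything is multiplied by k + 1, the factor that \<open>act a\<close> produces
    when it raises a divided power; it is cancelled at the end.\<close>
  have "vsc (of_nat (Suc k)) (div_pow a (Suc k) (act b u)) = act a (div_pow a k (act b u))"
    by (simp add: act_div_pow assms)
  also have "\<dots> = (\<Sum>j\<le>k. act a (act (?D j) (?T (k - j))))"
    by (simp add: Suc.IH act_right assms)
  also have "\<dots> = (\<Sum>j\<le>k. vsc (of_nat (Suc j)) (act (?D (Suc j)) (?T (k - j)))
      + vsc (of_nat (Suc k - j)) (act (?D j) (?T (Suc k - j))))"
  proof (rule sum.cong[OF refl])
    fix j assume j: "j \<in> {..k}"
    have "act a (act (?D j) (?T (k - j))) = act (br a (?D j)) (?T (k - j)) + act (?D j) (act a (?T (k - j)))"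
      by (simp add: act_br assms div_ad_L)
    also have "\<dots> = vsc (of_nat (Suc j)) (act (?D (Suc j)) (?T (k - j)))
      + vsc (of_nat (Suc k - j)) (act (?D j) (?T (Suc k - j)))"
      using j by (simp add: br_div_ad act_div_pow act_right act_scale_left assms div_ad_L Suc_diff_le
          del: of_nat_Suc)
    finally show "act a (act (?D j) (?T (k - j))) = \<dots>" .
  qed
  also have "\<dots> = (\<Sum>j\<le>k. vsc (of_nat (Suc j)) (act (?D (Suc j)) (?T (Suc k - Suc j))))
      + (\<Sum>j\<le>k. vsc (of_nat (Suc k - j)) (act (?D j) (?T (Suc k - j))))"
    by (simp add: sum.distrib del: of_nat_Suc)
  \<comment> \<open>Both sums are extended to j <= k + 1 by a term of weight 0; then the weights j
    and k + 1 - j add up to k + 1.\<close>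
  also have "(\<Sum>j\<le>k. vsc (of_nat (Suc j)) (act (?D (Suc j)) (?T (Suc k - Suc j))))
      = (\<Sum>j\<le>Suc k. vsc (of_nat j) (act (?D j) (?T (Suc k - j))))"
    by (simp add: sum.atMost_Suc_shift del: of_nat_Suc sum.atMost_Suc)
  also have "(\<Sum>j\<le>k. vsc (of_nat (Suc k - j)) (act (?D j) (?T (Suc k - j))))
      = (\<Sum>j\<le>Suc k. vsc (of_nat (Suc k - j)) (act (?D j) (?T (Suc k - j))))"
    by simp
  also have "(\<Sum>j\<le>Suc k. vsc (of_nat j) (act (?D j) (?T (Suc k - j)))) + \<dots>
      = vsc (of_nat (Suc k)) (\<Sum>j\<le>Suc k. act (?D j) (?T (Suc k - j)))"
    unfolding V.scale_sum_right sum.distrib[symmetric]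
    by (intro sum.cong refl) (simp add: V.scale_left_distrib[symmetric] of_nat_diff del: of_nat_Suc)
  finally show ?case
    by (metis V.scale_cancel_left of_nat_eq_0_iff nat.distinct(1))
qed

section \<open>Exponentials of locally nilpotent operators\<close>

context
  fixes a assumes a: "a \<in> L" "locally_nilpotent (act a)"
begin

text \<open>The cut-off depends on \<open>u\<close>; \<open>exp_act_eq\<close> replaces it by any
  exponent that kills \<open>u\<close>.\<close>

definition exp_act :: "'v \<Rightarrow> 'v" where
  "exp_act u = (\<Sum>k<(LEAST k. (act a ^^ k) u = 0). div_pow a k u)"

lemma div_pow_eq_0: "(act a ^^ m) u = 0 \<Longrightarrow> m \<le> k \<Longrightarrow> div_pow a k u = 0"
  using linear_funpow_mono[OF act_linear[OF a(1)]] by (simp add: div_pow_def)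

lemma exp_act_eq: "(act a ^^ m) u = 0 \<Longrightarrow> exp_act u = (\<Sum>k<m. div_pow a k u)"
proof -
  assume m: "(act a ^^ m) u = 0"
  let ?l = "LEAST k. (act a ^^ k) u = 0"
  have "(act a ^^ ?l) u = 0" "?l \<le> m" using m by (auto intro: LeastI Least_le)
  then show ?thesis unfolding exp_act_def
    by (intro sum.mono_neutral_left) (auto simp: div_pow_eq_0)
qed

lemma exp_act_0: "exp_act 0 = 0"
  using exp_act_eq[of 0 0] by simp

text \<open>Stands in for the inverse exp(-a). The remainder \<open>w - exp_act w\<close> is killed
  by one power of \<open>a\<close> less than \<open>w\<close> is, so it has a preimage by induction,
  and adding this preimage to \<open>w\<close> gives a preimage of \<open>w\<close>.\<close>

lemma exp_act_surj: "\<exists>u. exp_act u = w"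
proof -
  have act_pow: "Vector_Spaces.linear vsc vsc (act a ^^ k)" for k
    by (rule linear_funpow[OF act_linear[OF a(1)]])
  obtain B where "(act a ^^ B) w = 0" using a(2) by (auto simp: locally_nilpotent_def)
  moreover have "(act a ^^ m) w = 0 \<Longrightarrow> \<exists>u. (act a ^^ m) u = 0 \<and> exp_act u = w" for m w
  proof (induction m arbitrary: w)
    case 0
    then show ?case using exp_act_0 by auto
  next
    case (Suc m)
    interpret A: Vector_Spaces.linear vsc vsc "act a ^^ m" by (rule act_pow)
    let ?r = "w - exp_act w"
    have e: "exp_act w = w + (\<Sum>k<m. div_pow a (Suc k) w)"
      using exp_act_eq[OF Suc.prems] by (simp add: sum.lessThan_Suc_shift div_pow_def[of _ 0] del: sum.lessThan_Suc)
    have "(act a ^^ m) (div_pow a (Suc k) w) = 0" for k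
    proof -
      have "(act a ^^ m) ((act a ^^ Suc k) w) = (act a ^^ (m + Suc k)) w"
        by (subst funpow_add) simp
      also have "\<dots> = 0"
        by (rule linear_funpow_mono[OF act_linear[OF a(1)] Suc.prems]) simp
      finally show ?thesis unfolding div_pow_def by (simp only: A.scale) simp
    qed
    then have "(act a ^^ m) ?r = 0" by (simp add: e A.diff A.add A.sum A.neg)
    from Suc.IH[OF this] obtain u where u: "(act a ^^ m) u = 0" "exp_act u = ?r" by blast
    have u': "(act a ^^ Suc m) u = 0" by (simp add: u(1) act_right(3) a)
    interpret A': Vector_Spaces.linear vsc vsc "act a ^^ Suc m" by (rule act_pow)
    have 1: "(act a ^^ Suc m) (w + u) = 0"
      using Suc.prems u' A'.add[of w u] by (metis add.right_neutral)
    have "exp_act (w + u) = exp_act w + exp_act u"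
    proof -
      have "div_pow a k (w + u) = div_pow a k w + div_pow a k u" for k
      proof -
        interpret Ak: Vector_Spaces.linear vsc vsc "act a ^^ k" by (rule act_pow)
        show ?thesis by (simp add: div_pow_def Ak.add V.scale_right_distrib)
      qed
      then show ?thesis
        unfolding exp_act_eq[OF 1] exp_act_eq[OF Suc.prems] exp_act_eq[OF u'] by (simp only: sum.distrib)
    qed
    then show ?case using 1 u(2) by (intro exI[of _ "w + u"]) simp
  qed
  ultimately show ?thesis by blast
qed

text \<open>Summing \<open>div_pow_act\<close> over all degrees gives exp(a) b exp(-a) = exp(ad
  a)(b), written without the inverse; nilpotency of ad a at \<open>b\<close> makes the sum
  finite.\<close>

lemma exp_act_conj:
  assumes b: "b \<in> L" "(br a ^^ d) b = 0"
  shows "act (\<Sum>k<d. div_ad a k b) (exp_act u) = exp_act (act b u)"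
proof -
  obtain m where m: "(act a ^^ m) u = 0" using a(2) by (auto simp: locally_nilpotent_def)
  obtain m' where m': "(act a ^^ m') (act b u) = 0" using a(2) by (auto simp: locally_nilpotent_def)
  \<comment> \<open>Large enough for the rectangle of non-zero terms to fit into the triangle i + j
    < B, and for the exponential at \<open>act b u\<close> to be cut at B.\<close>
  define B where "B = d + m + m'"
  have D0: "div_ad a k b = 0" if "d \<le> k" for k
    using funpow_br_le[OF b(2) that] by (simp add: div_ad_def)
  let ?g = "\<lambda>k j. act (div_ad a k b) (div_pow a j u)"
  have "exp_act (act b u) = (\<Sum>k<B. div_pow a k (act b u))"
    by (intro exp_act_eq linear_funpow_mono[OF act_linear[OF a(1)] m']) (simp add: B_def)
  also have "\<dots> = (\<Sum>k<B. \<Sum>j\<le>k. ?g j (k - j))" by (simp add: div_pow_act a b)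
  also have "\<dots> = (\<Sum>(k, j)\<in>{(i, j). i + j < B}. ?g k j)"
    by (rule sum.triangle_reindex[symmetric])
  also have "\<dots> = (\<Sum>(k, j)\<in>{..<d} \<times> {..<m}. ?g k j)"
  proof (rule sum.mono_neutral_right)
    show "finite {(i, j). i + j < B}"
      by (rule finite_subset[of _ "{..<B} \<times> {..<B}"]) auto
    show "{..<d} \<times> {..<m} \<subseteq> {(i, j). i + j < B}" by (auto simp: B_def)
    show "\<forall>p\<in>{(i, j). i + j < B} - {..<d} \<times> {..<m}. (case p of (k, j) \<Rightarrow> ?g k j) = 0"
    proof
      fix p assume "p \<in> {(i, j). i + j < B} - {..<d} \<times> {..<m}"
      then consider k j where "p = (k, j)" "d \<le> k" | k j where "p = (k, j)" "m \<le> j"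
        by (cases p) fastforce
      then show "(case p of (k, j) \<Rightarrow> ?g k j) = 0"
        by cases (simp_all add: D0 act_0_left div_pow_eq_0[OF m] act_right(3) div_ad_L a b)
    qed
  qed
  also have "\<dots> = (\<Sum>k<d. act (div_ad a k b) (\<Sum>j<m. div_pow a j u))"
    by (simp add: sum.cartesian_product[symmetric] act_right(5) div_ad_L a b)
  also have "\<dots> = act (\<Sum>k<d. div_ad a k b) (exp_act u)"
    by (simp add: act_sum_left div_ad_L a b exp_act_eq[OF m])
  finally show ?thesis by simp
qed

text \<open>A conjugate of a locally nilpotent operator is locally nilpotent; surjectivity of the
  exponential carries the vanishing powers of \<open>b\<close> to an arbitrary vector.\<close>

lemma locally_nilpotent_exp_ad:
  assumes b: "b \<in> L" "(br a ^^ d) b = 0" "locally_nilpotent (act b)"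
  shows "locally_nilpotent (act (\<Sum>k<d. div_ad a k b))"
  unfolding locally_nilpotent_def
proof
  fix w
  obtain u where u: "exp_act u = w" using exp_act_surj by blast
  obtain k where k: "(act b ^^ k) u = 0" using b(3) by (auto simp: locally_nilpotent_def)
  have "(act (\<Sum>k<d. div_ad a k b) ^^ k) (exp_act u) = exp_act ((act b ^^ k) u)" for k
    by (induction k) (simp_all add: exp_act_conj[OF b(1,2)])
  with u k exp_act_0 show "\<exists>k. (act (\<Sum>k<d. div_ad a k b) ^^ k) w = 0" by metis
qed

end

lemma funpow_scale_act:
  assumes "a \<in> L"
  shows "(act (sc c a) ^^ k) u = vsc (c ^ k) ((act a ^^ k) u)"
  by (induction k) (simp_all add: act_scale_left act_right assms)

lemma locally_nilpotent_scale_act: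
  "a \<in> L \<Longrightarrow> locally_nilpotent (act a) \<Longrightarrow> locally_nilpotent (act (sc c a))"
  unfolding locally_nilpotent_def by (metis funpow_scale_act V.scale_zero_right)

end

text \<open>The adjoint representation: conjugation then also preserves local nilpotency of
  ad.\<close>

sublocale lie_algebra \<subseteq> ad: lie_representation sc br sc UNIV br
  by unfold_locales
    (auto simp: br_add_left br_add_right br_scale_left br_scale_right br_br br_linear)

section \<open>The span of the nilpotent elements as a Lie subalgebra\<close>

context lie_representation
begin

definition nil_elements :: "'l set" where
  "nil_elements = {a \<in> L. locally_nilpotent (br a) \<and> locally_nilpotent (act a)}"

lemma nil_elements_exp_ad:
  assumes "a \<in> nil_elements" "b \<in> nil_elements" "(br a ^^ d) b = 0"
  shows "(\<Sum>k<d. div_ad a k b) \<in> nil_elements"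
proof -
  have ab: "a \<in> L" "b \<in> L" using assms by (auto simp: nil_elements_def)
  have "ad.div_ad a k b = div_ad a k b" for k
    by (simp add: ad.div_ad_def div_ad_def)
  then have "locally_nilpotent (br (\<Sum>k<d. div_ad a k b))"
    using ad.locally_nilpotent_exp_ad[of a b d] assms by (simp add: nil_elements_def)
  moreover have "locally_nilpotent (act (\<Sum>k<d. div_ad a k b))"
    using locally_nilpotent_exp_ad[of a b d] assms by (simp add: nil_elements_def)
  ultimately show ?thesis
    using ab by (simp add: nil_elements_def subspace_sum[OF L_subspace] div_ad_L)
qed

text \<open>Since \<open>sc s a\<close> is nilpotent for every \<open>s\<close>, the polynomial
  exp(s ad a)(b) has all its values in \<open>nil_elements\<close>; its linear coefficient is
  [a, b].\<close>

lemma br_nil_elements: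
  assumes "a \<in> nil_elements" "b \<in> nil_elements"
  shows "br a b \<in> span nil_elements"
proof -
  have ab: "a \<in> L" using assms by (auto simp: nil_elements_def)
  obtain d0 where "(br a ^^ d0) b = 0"
    using assms(1) by (auto simp: nil_elements_def locally_nilpotent_def)
  \<comment> \<open>Raised by two so that the index 1 of the linear coefficient lies below the
    truncation bound.\<close>
  then have d: "(br a ^^ Suc (Suc d0)) b = 0" by (rule funpow_br_le) simp
  have "(\<Sum>k<Suc (Suc d0). sc (s ^ k) (div_ad a k b)) \<in> span nil_elements" for s
  proof (rule span_base)
    have "sc s a \<in> nil_elements"
      using assms(1) ad.locally_nilpotent_scale_act[of a s] locally_nilpotent_scale_act[of a s]
      by (auto simp: nil_elements_def subspace_scale[OF L_subspace])
    moreover have "(br (sc s a) ^^ Suc (Suc d0)) b = 0"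
      by (simp only: funpow_scale_br d scale_zero_right)
    ultimately have "(\<Sum>k<Suc (Suc d0). div_ad (sc s a) k b) \<in> nil_elements"
      by (intro nil_elements_exp_ad assms)
    moreover have "div_ad (sc s a) k b = sc (s ^ k) (div_ad a k b)" for k
      by (simp add: div_ad_def funpow_scale_br mult.commute)
    ultimately show "(\<Sum>k<Suc (Suc d0). sc (s ^ k) (div_ad a k b)) \<in> nil_elements" by simp
  qed
  then have "div_ad a 1 b \<in> span nil_elements"
  proof (rule subspace_polynomial_coeffs[OF subspace_span])
    fix i j :: nat assume "i < j"
    then have "(2::nat) ^ i \<noteq> 2 ^ j" by simp
    then have "(of_nat (2 ^ i) :: complex) \<noteq> of_nat (2 ^ j)" by (simp only: of_nat_eq_iff not_False_eq_True)
    then show "(2::complex) ^ i - 2 ^ j \<noteq> 0" by simp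
  qed simp
  then show ?thesis by (simp add: div_ad_def)
qed

lemma span_nil_elements_br:
  assumes "a \<in> span nil_elements" "b \<in> span nil_elements"
  shows "br a b \<in> span nil_elements"
  using assms(1)
proof (induction rule: span_induct_alt)
  case (step c x y)
  have "br x b \<in> span nil_elements"
    using assms(2)
    by (induction rule: span_induct_alt)
      (auto simp: br_add_right br_scale_right span_zero intro!: span_add span_scale br_nil_elements step.hyps)
  then show ?case using step.IH by (auto simp: br_add_left br_scale_left intro!: span_add span_scale)
qed (simp add: span_zero)

end

context vector_space
begin

text \<open>
  Spanning half of Poincare-Birkhoff-Witt: up to shorter words, a word may be sorted; and local
  nilpotency leaves only finitely many non-zero sorted words.
\<close>

lemma finite_sorted_words:
  fixes A :: "nat \<Rightarrow> 'b \<Rightarrow> 'b"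
  assumes "\<And>i. i < d \<Longrightarrow> Vector_Spaces.linear scale scale (A i)"
    and "\<And>i. i < d \<Longrightarrow> locally_nilpotent (A i)" and "j \<le> d"
  shows "finite {foldr A w v | w. sorted w \<and> set w \<subseteq> {j..<d}}"
  using assms(3)
proof (induction j rule: inc_induct)
  case base
  have "{foldr A w v | w. sorted w \<and> set w \<subseteq> {d..<d}} = {v}" by force
  then show ?case by simp
next
  case (step j)
  \<comment> \<open>The last letters of a word act first, so the letters \<open>j\<close> of a
    sorted word act after all larger ones, on one of the finitely many vectors in
    \<open>?O\<close>.\<close>
  let ?O = "{foldr A w v | w. sorted w \<and> set w \<subseteq> {Suc j..<d}}"
  obtain K where K: "(A j ^^ K b) b = 0" for b
    using assms(2)[OF step.hyps(2)] unfolding locally_nilpotent_def by metis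
  have "{foldr A w v | w. sorted w \<and> set w \<subseteq> {j..<d}}
      \<subseteq> insert 0 (\<Union>b\<in>?O. (\<lambda>k. (A j ^^ k) b) ` {..<K b})"
  proof clarify
    fix w assume w: "sorted w" "set w \<subseteq> {j..<d}"
      "foldr A w v \<notin> (\<Union>b\<in>?O. (\<lambda>k. (A j ^^ k) b) ` {..<K b})"
    obtain k w' where kw: "w = replicate k j @ w'" "sorted w'" "set w' \<subseteq> {Suc j..<d}"
      using w(1,2)
    proof (induction w arbitrary: thesis)
      case Nil
      show ?case by (rule Nil(1)[of 0 "[]"]) simp_all
    next
      case (Cons x w)
      show ?case
      proof (cases "x = j")
        case True
        obtain k w' where "w = replicate k j @ w'" "sorted w'" "set w' \<subseteq> {Suc j..<d}"
          using Cons.IH Cons.prems(2,3) by auto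
        then show ?thesis using True by (intro Cons.prems(1)[of "Suc k" w']) simp_all
      next
        case False
        with Cons.prems(2,3) have "set (x # w) \<subseteq> {Suc j..<d}" by fastforce
        with Cons.prems(2) show ?thesis by (intro Cons.prems(1)[of 0 "x # w"]) simp_all
      qed
    qed
    have rep: "foldr A (replicate k j) b = (A j ^^ k) b" for b
      by (induction k) auto
    let ?b = "foldr A w' v"
    have wb: "foldr A w v = (A j ^^ k) ?b" by (simp add: kw(1) rep)
    have "?b \<in> ?O" using kw by blast
    with w(3) wb have "\<not> k < K ?b" by blast
    then show "foldr A w v = 0"
      unfolding wb by (intro linear_funpow_mono[OF assms(1)[OF step.hyps(2)] K]) simp
  qed
  moreover have "finite (insert 0 (\<Union>b\<in>?O. (\<lambda>k. (A j ^^ k) b) ` {..<K b}))"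
    using step.IH by simp
  ultimately show ?case by (rule finite_subset)
qed

text \<open>The commutator condition is stated vector by vector, so no structure constants enter:
  the commutator of \<open>A i\<close> and \<open>A j\<close> at \<open>u\<close> is a combination
  of the \<open>A k u\<close>, that is, of words with one letter less.\<close>

lemma words_in_finite_span:
  fixes A :: "nat \<Rightarrow> 'b \<Rightarrow> 'b"
  assumes lin: "\<And>i. i < d \<Longrightarrow> Vector_Spaces.linear scale scale (A i)"
    and nil: "\<And>i. i < d \<Longrightarrow> locally_nilpotent (A i)"
    and comm: "\<And>i j u. i < d \<Longrightarrow> j < d \<Longrightarrow> A i (A j u) - A j (A i u) \<in> span ((\<lambda>k. A k u) ` {..<d})"
  shows "\<exists>B. finite B \<and> (\<forall>w. set w \<subseteq> {..<d} \<longrightarrow> foldr A w v \<in> span B)"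
proof -
  \<comment> \<open>The length filtration, with strict inequality: \<open>S (length w)\<close> comes
    from the words shorter than \<open>w\<close>.\<close>
  define S where "S l = span {foldr A w v | w. length w < l \<and> set w \<subseteq> {..<d}}" for l
  have A_S: "A i u \<in> S (Suc l)" if "i < d" "u \<in> S l" for i l u
    using that(2) unfolding S_def
  proof (induction rule: span_induct_alt)
    case base
    interpret Vector_Spaces.linear scale scale "A i" by (rule lin[OF that(1)])
    show ?case by (simp add: zero span_zero)
  next
    case (step c x y)
    interpret Vector_Spaces.linear scale scale "A i" by (rule lin[OF that(1)])
    obtain w where w: "x = foldr A w v" "length w < l" "set w \<subseteq> {..<d}" using step.hyps by blast
    then have "A i x = foldr A (i # w) v" "length (i # w) < Suc l" "set (i # w) \<subseteq> {..<d}"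
      using that(1) by auto
    then have "A i x \<in> span {foldr A w v | w. length w < Suc l \<and> set w \<subseteq> {..<d}}"
      by (intro span_base) blast
    with step.IH show ?case by (simp add: add scale span_add span_scale)
  qed
  have insort: "foldr A (x # ys) v - foldr A (insort x ys) v \<in> S (Suc (length ys))"
    if "set ys \<subseteq> {..<d}" "x < d" for x ys
    using that(1)
  proof (induction ys)
    case (Cons y ys)
    show ?case
    proof (cases "x \<le> y")
      case True
      then show ?thesis by (simp add: S_def span_zero)
    next
      case False
      let ?u = "foldr A ys v"
      have y: "y < d" using Cons.prems by simp
      interpret Vector_Spaces.linear scale scale "A y" by (rule lin[OF y])
      \<comment> \<open>For x > y the letter x moves past y: the difference is the commutator of
        \<open>A x\<close> and \<open>A y\<close> plus \<open>A y\<close> applied to the difference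
        for \<open>ys\<close>.\<close>
      have "A x (A y ?u) - A y (A x ?u) \<in> span ((\<lambda>k. A k ?u) ` {..<d})"
        by (rule comm[OF that(2) y])
      also have "\<dots> \<subseteq> S (Suc (Suc (length ys)))"
        unfolding S_def
      proof (rule span_mono, clarify)
        fix k assume "k < d"
        then show "\<exists>w. A k ?u = foldr A w v \<and> length w < Suc (Suc (length ys)) \<and> set w \<subseteq> {..<d}"
          using Cons.prems by (intro exI[of _ "k # ys"]) auto
      qed
      finally have "A x (A y ?u) - A y (A x ?u) \<in> S (Suc (Suc (length ys)))" .
      moreover have "A y (foldr A (x # ys) v - foldr A (insort x ys) v) \<in> S (Suc (Suc (length ys)))"
        using Cons by (intro A_S y) simp
      ultimately have "A x (A y ?u) - A y (A x ?u) + A y (foldr A (x # ys) v - foldr A (insort x ys) v)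
          \<in> S (Suc (Suc (length ys)))"
        unfolding S_def by (rule span_add)
      then show ?thesis using False by (simp add: diff)
    qed
  qed (simp add: S_def span_zero)
  have sort: "foldr A w v - foldr A (sort w) v \<in> S (length w)" if "set w \<subseteq> {..<d}" for w
    using that
  proof (induction w)
    case (Cons x w)
    have x: "x < d" "set w \<subseteq> {..<d}" using Cons.prems by auto
    interpret Vector_Spaces.linear scale scale "A x" by (rule lin[OF x(1)])
    have "A x (foldr A w v - foldr A (sort w) v) \<in> S (Suc (length w))"
      by (intro A_S x Cons.IH)
    moreover have "foldr A (x # sort w) v - foldr A (insort x (sort w)) v \<in> S (Suc (length w))"
      using insort[of "sort w" x] x by simp
    ultimately have "A x (foldr A w v - foldr A (sort w) v)
        + (foldr A (x # sort w) v - foldr A (insort x (sort w)) v) \<in> S (Suc (length w))"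
      unfolding S_def by (rule span_add)
    then show ?case by (simp add: diff)
  qed (simp add: S_def span_zero)
  let ?B = "{foldr A w v | w. sorted w \<and> set w \<subseteq> {0..<d}}"
  have "foldr A w v \<in> span ?B" if "set w \<subseteq> {..<d}" for w
    using that
  proof (induction w rule: length_induct)
    case (1 w)
    have "S (length w) \<subseteq> span ?B"
      unfolding S_def using 1 by (intro span_minimal subspace_span) auto
    then have "foldr A w v - foldr A (sort w) v \<in> span ?B" using sort[OF 1(2)] by blast
    moreover have "foldr A (sort w) v \<in> span ?B"
      using 1(2) by (intro span_base) (auto simp: lessThan_atLeast0 intro!: exI[of _ "sort w"])
    ultimately show ?case using span_add by fastforce
  qed
  moreover have "finite ?B" by (rule finite_sorted_words[OF lin nil]) simp_all
  ultimately show ?thesis by blast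
qed

end

section \<open>Eigenvectors and iterated brackets\<close>

context vector_space
begin

text \<open>Apply \<Delta> - d and induct. Indexing the vectors by their eigenvalues builds in that
  these are distinct.\<close>

lemma eigenvectors_sum_eq_0:
  assumes "Vector_Spaces.linear scale scale \<Delta>" "finite A"
    and "\<And>c. c \<in> A \<Longrightarrow> \<Delta> (u c) = scale c (u c)" "(\<Sum>c\<in>A. u c) = 0" "c \<in> A"
  shows "u c = 0"
  using assms(2-5)
proof (induction A arbitrary: u c rule: finite_induct)
  case (insert d A)
  interpret D: Vector_Spaces.linear scale scale \<Delta> by fact
  have s: "u d = - (\<Sum>c\<in>A. u c)" using insert.prems(2) insert.hyps by (simp add: eq_neg_iff_add_eq_0)
  have "scale d (u d) = - (\<Sum>c\<in>A. scale c (u c))"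
  proof -
    have "(\<Sum>c\<in>A. \<Delta> (u c)) = (\<Sum>c\<in>A. scale c (u c))"
      using insert.prems(1) by (intro sum.cong) auto
    then show ?thesis using insert.prems(1)[of d] unfolding s by (simp add: D.neg D.sum)
  qed
  then have "(\<Sum>c\<in>A. scale (c - d) (u c)) = 0"
    unfolding s by (simp add: scale_left_diff_distrib sum_subtractf scale_sum_right)
  then have "scale (c - d) (u c) = 0" if "c \<in> A" for c
  proof (rule insert.IH[rotated])
    fix c assume "c \<in> A"
    then show "\<Delta> (scale (c - d) (u c)) = scale c (scale (c - d) (u c))"
      using insert.prems(1)[of c] by (simp add: D.scale mult.commute)
  qed (rule that)
  then have "u c = 0" if "c \<in> A" for c
    using that insert.hyps by auto
  with s insert.prems(3) show ?case by auto
qed simp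

text \<open>When the terms of \<open>a\<close> are grouped by eigenvalue, every group but that of
  \<open>c\<close> cancels. This does the work of a weight decomposition for spanning sets that need
  not be independent.\<close>

lemma eigenvector_in_span:
  assumes \<Delta>: "Vector_Spaces.linear scale scale \<Delta>"
    and S: "\<And>s. s \<in> S \<Longrightarrow> \<exists>c. \<Delta> s = scale c s"
    and a: "a \<in> span S" "\<Delta> a = scale c a"
  shows "a \<in> span {s \<in> S. \<Delta> s = scale c s}"
proof -
  obtain ev where ev: "\<And>s. s \<in> S \<Longrightarrow> \<Delta> s = scale (ev s) s"
    using bchoice[of S "\<lambda>s c. \<Delta> s = scale c s"] S by blast
  interpret D: Vector_Spaces.linear scale scale \<Delta> by fact
  obtain T r where T: "finite T" "T \<subseteq> S" "a = (\<Sum>s\<in>T. scale (r s) s)"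
    using a(1) unfolding span_explicit by blast
  define C where "C = insert c (ev ` T)"
  define p where "p d = (\<Sum>s\<in>{s\<in>T. ev s = d}. scale (r s) s)" for d
  \<comment> \<open>Subtracting \<open>a\<close> in the group of \<open>c\<close> makes the total
    zero, so each group vanishes; \<open>c\<close> is put into \<open>C\<close> even if no term has
    this eigenvalue.\<close>
  define u where "u d = (if d = c then p c - a else p d)" for d
  have Dp: "\<Delta> (p d) = scale d (p d)" for d
  proof -
    have "\<Delta> (p d) = (\<Sum>s\<in>{s\<in>T. ev s = d}. scale (r s) (\<Delta> s))"
      by (simp add: p_def D.sum D.scale)
    also have "\<dots> = (\<Sum>s\<in>{s\<in>T. ev s = d}. scale d (scale (r s) s))"
      using T(2) ev by (intro sum.cong) (auto simp: mult.commute)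
    finally show ?thesis by (simp add: p_def scale_sum_right)
  qed
  have "finite C" using T(1) by (simp add: C_def)
  moreover have "\<Delta> (u d) = scale d (u d)" for d
    by (simp add: u_def Dp D.diff a(2) scale_right_diff_distrib)
  moreover have "(\<Sum>d\<in>C. u d) = 0"
  proof -
    have "(\<Sum>d\<in>C. p d) = a"
      unfolding p_def T(3) using T(1) by (intro sum.group) (auto simp: C_def)
    moreover have "(\<Sum>d\<in>C. u d) = (\<Sum>d\<in>C. p d - (if d = c then a else 0))"
      by (intro sum.cong) (auto simp: u_def)
    ultimately show ?thesis using T(1) by (simp add: sum_subtractf sum.delta) (simp add: C_def)
  qed
  ultimately have "u c = 0"
    by (rule eigenvectors_sum_eq_0[OF \<Delta>, where A = C]) (simp_all add: C_def)
  then have "a = p c" by (simp add: u_def)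
  also have "p c \<in> span {s \<in> S. \<Delta> s = scale c s}"
    unfolding p_def using T(2) ev by (intro span_sum span_scale span_base) auto
  finally show ?thesis .
qed

lemma finite_eigenvalues:
  assumes \<Delta>: "Vector_Spaces.linear scale scale \<Delta>" and B: "finite B" "span B = UNIV"
  shows "finite {c. \<exists>a. a \<noteq> 0 \<and> \<Delta> a = scale c a}" (is "finite ?C")
proof -
  obtain f where f: "f c \<noteq> 0" "\<Delta> (f c) = scale c (f c)" if "c \<in> ?C" for c
  proof -
    have "\<forall>c\<in>?C. \<exists>a. a \<noteq> 0 \<and> \<Delta> a = scale c a" by blast
    from bchoice[OF this] show ?thesis using that by blast
  qed
  have inj: "inj_on f ?C"
  proof (rule inj_onI)
    fix c d assume "c \<in> ?C" "d \<in> ?C" "f c = f d"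
    then have "scale c (f c) = scale d (f c)" using f(2)[of c] f(2)[of d] by metis
    then show "c = d" using f(1)[OF \<open>c \<in> ?C\<close>] scale_cancel_right by blast
  qed
  have "independent (f ` ?C)"
    unfolding independent_explicit_finite_subsets
  proof (intro allI impI ballI)
    fix T u v
    assume T: "T \<subseteq> f ` ?C" "finite T" "(\<Sum>v\<in>T. scale (u v) v) = 0" "v \<in> T"
    obtain E where E: "E \<subseteq> ?C" "T = f ` E" using T(1) unfolding subset_image_iff by blast
    have injE: "inj_on f E" using inj E(1) by (rule inj_on_subset)
    obtain c where c: "c \<in> E" "v = f c" using T(4) E(2) by blast
    interpret D: Vector_Spaces.linear scale scale \<Delta> by fact
    have "scale (u (f c)) (f c) = 0"
    proof (rule eigenvectors_sum_eq_0[OF \<Delta>, where A = E and u = "\<lambda>c. scale (u (f c)) (f c)" and c = c])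
      show "finite E" using T(2) E(2) injE finite_imageD by blast
      show "(\<Sum>c\<in>E. scale (u (f c)) (f c)) = 0"
        using T(3) by (simp add: E(2) sum.reindex[OF injE])
    next
      fix d assume "d \<in> E"
      then have "\<Delta> (f d) = scale d (f d)" using E(1) by (intro f) blast
      then show "\<Delta> (scale (u (f d)) (f d)) = scale d (scale (u (f d)) (f d))"
        by (simp add: D.scale mult.commute)
    qed (rule c)
    moreover have "f c \<noteq> 0" using c(1) E(1) by (intro f) blast
    ultimately show "u v = 0" using c(2) by simp
  qed
  then have "finite (f ` ?C)" using independent_span_bound[OF B(1)] B(2) by simp
  then show ?thesis using inj finite_imageD by blast
qed

end

section \<open>Iterated brackets of generators and a membership criterion for subalgebras\<close>

context lie_algebra
begin

text \<open>Right-normed brackets [G i, [G j, ...]]. The value at the empty word is a placeholder,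
  hence the recurring condition that words are non-empty.\<close>

fun brw :: "(nat \<Rightarrow> 'l) \<Rightarrow> nat list \<Rightarrow> 'l" where
  "brw G [] = 0"
| "brw G [i] = G i"
| "brw G (i # j # w) = br (G i) (brw G (j # w))"

lemma brw_Cons: "w \<noteq> [] \<Longrightarrow> brw G (i # w) = br (G i) (brw G w)"
  by (cases w) simp_all

lemma brw_weight:
  assumes "\<And>j. j \<in> I \<Longrightarrow> br h (G j) = sc (\<mu> j) (G j)" "w \<in> lists I"
  shows "br h (brw G w) = sc (sum_list (map \<mu> w)) (brw G w)"
  using assms(2)
proof (induction w rule: list.induct)
  case (Cons i w)
  show ?case
  proof (cases "w = []")
    case True
    then show ?thesis using Cons.prems assms(1) by simp
  next
    case False
    have "br h (br (G i) (brw G w)) = br (br h (G i)) (brw G w) + br (G i) (br h (brw G w))"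
      by (simp add: br_br)
    moreover have "i \<in> I" "w \<in> lists I" using Cons.prems by auto
    ultimately show ?thesis
      using False by (simp add: brw_Cons assms(1) Cons.IH br_scale_left br_scale_right scale_left_distrib)
  qed
qed simp

lemma brw_hom:
  assumes "\<And>a b. \<sigma> (br a b) = br (\<sigma> a) (\<sigma> b)" "\<sigma> 0 = 0" "\<And>i. i \<in> I \<Longrightarrow> \<sigma> (G i) = G (\<tau> i)"
    "w \<in> lists I"
  shows "\<sigma> (brw G w) = brw G (map \<tau> w)"
  using assms(4)
proof (induction w rule: list.induct)
  case (Cons i w)
  then show ?case by (cases w) (simp_all add: assms(1,3))
qed (simp add: assms(2))

definition word_space :: "(nat \<Rightarrow> 'l) \<Rightarrow> nat set \<Rightarrow> nat \<Rightarrow> 'l set" where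
  "word_space G I l = span {brw G w | w. w \<in> lists I \<and> length w = l}"

text \<open>In [G' i, [G k, u]] = [[G' i, G k], u] + [G k, [G' i, u]] the first term is a multiple
  of the word u, since \<open>H' i\<close> acts on words by scalars, and the second is handled by
  induction. The abstract letters allow both E against F and F against E.\<close>

lemma br_word_space_lower:
  assumes "\<And>i j. i \<in> I \<Longrightarrow> j \<in> I \<Longrightarrow> br (G' i) (G j) = (if i = j then H' i else 0)"
    and "\<And>i j. i \<in> I \<Longrightarrow> j \<in> I \<Longrightarrow> br (H' i) (G j) = sc (c i j) (G j)"
    and "i \<in> I" "w \<in> lists I" "length w = Suc l" "l > 0"
  shows "br (G' i) (brw G w) \<in> word_space G I l"
  using assms(4-6)
proof (induction w arbitrary: l rule: list.induct)
  case (Cons k w)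
  have k: "k \<in> I" "w \<in> lists I" "w \<noteq> []" using Cons.prems by auto
  have kw: "sc r (brw G w) \<in> word_space G I l" for r
    unfolding word_space_def using Cons.prems k(2)
    by (intro span_scale span_base CollectI exI[of _ w]) auto
  have "br (br (G' i) (G k)) (brw G w) \<in> word_space G I l"
  proof (cases "i = k")
    case True
    then have "br (br (G' i) (G k)) (brw G w) = br (H' i) (brw G w)"
      using assms(1)[OF assms(3) k(1)] by simp
    also have "\<dots> = sc (sum_list (map (c i) w)) (brw G w)"
      by (rule brw_weight[OF assms(2)[OF assms(3)] k(2)])
    finally show ?thesis by (simp only: kw)
  next
    case False
    then have "br (br (G' i) (G k)) (brw G w) = sc 0 (brw G w)"
      using assms(1)[OF assms(3) k(1)] by simp
    then show ?thesis by (simp only: kw)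
  qed
  moreover have "br (G k) (br (G' i) (brw G w)) \<in> word_space G I l"
  \<comment> \<open>A one-letter tail is separate: [G' i, G j] is \<open>H' i\<close> or 0 rather
    than a word, and only the outer bracket with \<open>G k\<close> leads back to words.\<close>
  proof (cases "l = 1")
    case True
    with Cons.prems obtain j where j: "w = [j]" "j \<in> I" by (cases w) auto
    have "brw G [k] \<in> {brw G w | w. w \<in> lists I \<and> length w = l}" using k True by (intro CollectI exI[of _ "[k]"]) simp
    then have Gk: "sc r (G k) \<in> word_space G I l" for r
      unfolding word_space_def brw.simps by (intro span_scale span_base)
    have "br (G k) (H' i) = sc (- c i k) (G k)"
      using br_anti[of "G k" "H' i"] assms(2)[OF assms(3) k(1)] by simp
    then have "br (G k) (br (G' i) (brw G w)) = sc (if i = j then - c i k else 0) (G k)"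
      using assms(1)[OF assms(3) j(2)] by (cases "i = j") (simp_all add: j(1))
    then show ?thesis by (simp only: Gk)
  next
    case False
    then obtain l' where l: "l = Suc l'" "l' > 0" using Cons.prems by (cases l) auto
    have "br (G' i) (brw G w) \<in> word_space G I l'"
      using k Cons.prems(2) l by (intro Cons.IH) simp_all
    then show ?thesis unfolding word_space_def
    proof (induction rule: span_induct_alt)
      case (step r x y)
      obtain u where "x = brw G u" "u \<in> lists I" "length u = l'" using step.hyps by blast
      then have "br (G k) x = brw G (k # u)" "k # u \<in> lists I" "length (k # u) = l"
        using k l by (auto simp: brw_Cons)
      then have "br (G k) x \<in> span {brw G w | w. w \<in> lists I \<and> length w = l}"
        by (intro span_base) blast
      with step.IH show ?case by (simp add: br_add_right br_scale_right span_add span_scale)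
    qed (simp add: span_zero)
  qed
  moreover have "br (G' i) (brw G (k # w)) = br (br (G' i) (G k)) (brw G w) + br (G k) (br (G' i) (brw G w))"
    using k by (simp add: brw_Cons br_br)
  ultimately show ?case unfolding word_space_def by (simp add: span_add)
qed simp

text \<open>
  If \<open>z\<close> were not in \<open>\<mm>\<close>, it would be a highest weight vector of negative weight in the quotient
  by \<open>\<mm>\<close>, on which \<open>f\<close> is locally nilpotent.
\<close>

lemma negative_weight_in_subalgebra:
  assumes m: "subspace \<mm>" "\<And>a b. a \<in> \<mm> \<Longrightarrow> b \<in> \<mm> \<Longrightarrow> br a b \<in> \<mm>"
    and ef: "e \<in> \<mm>" "f \<in> \<mm>" "br e z \<in> \<mm>"
    and hf: "br (br e f) f = sc (- complex_of_real t) f" "t > 0"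
    and hz: "br (br e f) z = sc (complex_of_real l) z" "l < 0"
    and nil: "(br f ^^ K) z = 0"
  shows "z \<in> \<mm>"
proof -
  define zk where "zk k = (br f ^^ k) z" for k
  have zk_Suc: "zk (Suc k) = br f (zk k)" for k by (simp add: zk_def)
  have h: "br (br e f) (zk k) = sc (complex_of_real (l - k * t)) (zk k)" for k
  proof (induction k)
    case 0
    show ?case using hz by (simp add: zk_def)
  next
    case (Suc k)
    have "br (br e f) (br f (zk k)) = br (br (br e f) f) (zk k) + br f (br (br e f) (zk k))"
      using br_br[of "br e f" f "zk k"] by simp
    also have "\<dots> = sc (- complex_of_real t + complex_of_real (l - k * t)) (br f (zk k))"
      by (simp add: Suc.IH hf br_scale_left br_scale_right br_minus_left
          scale_left_distrib scale_left_diff_distrib br_diff_right)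
    finally show ?case by (simp add: zk_Suc algebra_simps)
  qed
  \<comment> \<open>As in sl2, e f^(k+1) z equals \<mu> k times f^k z modulo \<mm>, where \<mu> k
    adds up the eigenvalues of [e, f] on z, ..., f^k z. All of these are negative, so \<mu> k never
    vanishes.\<close>
  define \<mu> where "\<mu> k = (\<Sum>j\<le>k. l - j * t)" for k :: nat
  have \<mu>: "\<mu> k < 0" for k
  proof (induction k)
    case (Suc k)
    have "real (Suc k) * t \<ge> 0" using hf(2) by simp
    moreover have "\<mu> (Suc k) = \<mu> k + (l - real (Suc k) * t)" by (simp add: \<mu>_def)
    ultimately show ?case using Suc.IH hz(2) by linarith
  qed (simp add: \<mu>_def hz(2))
  have e: "br e (zk (Suc k)) - sc (complex_of_real (\<mu> k)) (zk k) \<in> \<mm>" for k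
  proof (induction k)
    case 0
    have "br e (zk 1) = br (br e f) (zk 0) + br f (br e z)"
      by (simp add: zk_def br_br)
    then show ?case using m(2)[OF ef(2,3)] by (simp only: h) (simp add: \<mu>_def)
  next
    case (Suc k)
    let ?x = "br f (br e (zk (Suc k)))" and ?l = "complex_of_real (l - real (Suc k) * t)"
    have "br e (br f (zk (Suc k))) = br (br e f) (zk (Suc k)) + ?x"
      using br_br[of e f "zk (Suc k)"] by simp
    then have 1: "br e (zk (Suc (Suc k))) = sc ?l (zk (Suc k)) + ?x"
      by (simp only: h zk_Suc[of "Suc k"])
    have 2: "sc (complex_of_real (\<mu> (Suc k))) (zk (Suc k))
        = sc (complex_of_real (\<mu> k)) (zk (Suc k)) + sc ?l (zk (Suc k))"
      by (simp add: \<mu>_def flip: scale_left_distrib)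
    have "br f (br e (zk (Suc k)) - sc (complex_of_real (\<mu> k)) (zk k))
        = ?x - sc (complex_of_real (\<mu> k)) (zk (Suc k))"
      by (simp only: br_diff_right br_scale_right zk_Suc[of k])
    then have "br e (zk (Suc (Suc k))) - sc (complex_of_real (\<mu> (Suc k))) (zk (Suc k))
       = br f (br e (zk (Suc k)) - sc (complex_of_real (\<mu> k)) (zk k))"
      unfolding 1 2 by simp
    then show ?case using m(2)[OF ef(2) Suc.IH] by simp
  qed
  \<comment> \<open>Dividing by \<mu> k lets membership descend from f^(k+1) z to f^k z; the descent
    starts at f^K z = 0.\<close>
  have down: "zk k \<in> \<mm>" if "zk (Suc k) \<in> \<mm>" for k
  proof -
    have "br e (zk (Suc k)) - (br e (zk (Suc k)) - sc (complex_of_real (\<mu> k)) (zk k)) \<in> \<mm>"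
      by (intro subspace_diff m(1) e m(2) ef(1) that)
    then have "sc (complex_of_real (\<mu> k)) (zk k) \<in> \<mm>" by simp
    from subspace_scale[OF m(1) this, of "inverse (complex_of_real (\<mu> k))"]
    show ?thesis using \<mu>[of k] by (simp add: scale_scale del: scale_right_imp_eq)
  qed
  have "zk K \<in> \<mm>" using nil subspace_0[OF m(1)] by (simp add: zk_def)
  then have "zk 0 \<in> \<mm>"
  proof (induction K)
    case (Suc K)
    then show ?case using down by blast
  qed
  then show ?thesis by (simp add: zk_def)
qed

end

section \<open>Cartan matrices\<close>

text \<open>
  \<open>rho_coeff X n i / 2\<close> is the coefficient of the \<open>i\<close>-th simple coroot in half the sum of the positive
  coroots.
\<close>

fun rho_coeff :: "twisted_type \<Rightarrow> nat \<Rightarrow> nat \<Rightarrow> real" where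
  "rho_coeff A_even n i = real i * (2 * real n + 1 - real i)"
| "rho_coeff A_odd n i = real i * (2 * real n - real i)"
| "rho_coeff D n i = (if i < n then real i * (2 * real n + 1 - real i) else real n * (real n + 1) / 2)"

lemma rho_coeff_nonneg: "i \<in> {1..lie_rank X n} \<Longrightarrow> rho_coeff X n i \<ge> 0"
  by (cases X) (auto intro!: mult_nonneg_nonneg)

lemma diagram_aut_rank:
  "admissible X n \<Longrightarrow> i \<in> {1..lie_rank X n} \<Longrightarrow> diagram_aut X n i \<in> {1..lie_rank X n}"
  by (cases X) auto

lemma diagram_aut_involution:
  "admissible X n \<Longrightarrow> i \<in> {1..lie_rank X n} \<Longrightarrow> diagram_aut X n (diagram_aut X n i) = i"
  by (cases X) auto

lemma rho_coeff_diagram_aut: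
  "admissible X n \<Longrightarrow> i \<in> {1..lie_rank X n} \<Longrightarrow> rho_coeff X n (diagram_aut X n i) = rho_coeff X n i"
  by (cases X) (auto simp: of_nat_diff)

lemma cartan_A_flip:
  assumes "i \<in> {1..N}" "j \<in> {1..N}"
  shows "cartan_A (N + 1 - i) (N + 1 - j) = cartan_A i j"
proof -
  have "N + 1 - i = N + 1 - j \<longleftrightarrow> i = j" "N + 1 - i = N + 1 - j + 1 \<longleftrightarrow> j = i + 1"
    "N + 1 - j = N + 1 - i + 1 \<longleftrightarrow> i = j + 1"
    using assms by auto
  then show ?thesis unfolding cartan_A_def by simp
qed

lemma cartan_diagram_aut:
  assumes "admissible X n" "i \<in> {1..lie_rank X n}" "j \<in> {1..lie_rank X n}"
  shows "cartan X n (diagram_aut X n i) (diagram_aut X n j) = cartan X n i j"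
proof (cases X)
  case A_even
  then show ?thesis using cartan_A_flip[of i "2 * n" j] assms by simp
next
  case A_odd
  then show ?thesis using cartan_A_flip[of i "2 * n - 1" j] assms by simp
next
  case D
  with assms(1) have "n \<ge> 3" by simp
  with D show ?thesis
    by (cases "i = n"; cases "i = n + 1"; cases "j = n"; cases "j = n + 1") (simp_all add: cartan_D_def, linarith+)
qed

lemma cartan_diag: "cartan X n i i = 2"
  by (cases X) (simp_all add: cartan_A_def cartan_D_def)

lemma cartan_offdiag: "i \<noteq> j \<Longrightarrow> cartan X n i j \<le> 0"
  by (cases X) (simp_all add: cartan_A_def cartan_D_def)

lemma cartan_ge: "cartan X n i j \<ge> -1"
  by (cases X) (simp_all add: cartan_A_def cartan_D_def)

text \<open>The hypothesis admits an index off the end of the diagram, such as a formal neighbour of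
  an end node, where the coefficient vanishes.\<close>

lemma sum_times_indicator:
  fixes f :: "nat \<Rightarrow> real"
  assumes "j \<notin> {1..N} \<Longrightarrow> f j = 0"
  shows "(\<Sum>i\<in>{1..N}. f i * (if i = j then r else 0)) = f j * r"
proof -
  have "(\<Sum>i\<in>{1..N}. f i * (if i = j then r else 0)) = (\<Sum>i\<in>{1..N}. if i = j then f i * r else 0)"
    by (intro sum.cong) auto
  then show ?thesis using assms by (auto simp: sum.delta)
qed

text \<open>The second difference of i (N + 1 - i) is the constant -2, and the function vanishes at
  0 and N + 1, so end nodes behave like inner ones.\<close>

lemma rho_coeff_cartan_A:
  assumes "j \<in> {1..N}"
  shows "(\<Sum>i\<in>{1..N}. (real i * (real N + 1 - real i)) * of_int (cartan_A i j)) = 2"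
proof -
  let ?f = "\<lambda>i. real i * (real N + 1 - real i)" and ?\<delta> = "\<lambda>r k i. if i = k then r else 0 :: real"
  have "(\<Sum>i\<in>{1..N}. ?f i * of_int (cartan_A i j)) = (\<Sum>i\<in>{1..N}. ?f i * ?\<delta> 2 (j) i - ?f i * ?\<delta> 1 (j - 1) i - ?f i * ?\<delta> 1 (j + 1) i)"
  proof (intro sum.cong refl)
    fix i assume "i \<in> {1..N}"
    then have "cartan_A i j = (if i = j then 2 else 0) - (if i = j - 1 then 1 else 0) - (if i = j + 1 then 1 else 0)"
      using assms by (auto simp: cartan_A_def)
    then have "(of_int (cartan_A i j) :: real) = ?\<delta> 2 (j) i - ?\<delta> 1 (j - 1) i - ?\<delta> 1 (j + 1) i" by simp
    then show "?f i * of_int (cartan_A i j) = ?f i * ?\<delta> 2 (j) i - ?f i * ?\<delta> 1 (j - 1) i - ?f i * ?\<delta> 1 (j + 1) i" by (simp only: right_diff_distrib)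
  qed
  also have "\<dots> = ?f (j) * 2 - ?f (j - 1) * 1 - ?f (j + 1) * 1"
    unfolding sum_subtractf
    by (intro arg_cong2[where f = minus] sum_times_indicator) (use assms in auto)
  also have "\<dots> = 2" using assms by (simp add: of_nat_diff algebra_simps)
  finally show ?thesis .
qed

text \<open>The branch node is n - 1, joined to n - 2, n and n + 1; the cases are the four shapes of
  a column.\<close>

lemma rho_coeff_cartan_D:
  assumes "n \<ge> 3" "j \<in> {1..n + 1}"
  shows "(\<Sum>i\<in>{1..n + 1}. rho_coeff D n i * of_int (cartan_D (n + 1) i j)) = 2"
proof -
  let ?f = "rho_coeff D n" and ?\<delta> = "\<lambda>r k i. if i = k then r else 0 :: real"
  consider "j < n - 1" | "j = n - 1" | "j = n" | "j = n + 1"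
    using assms by atomize_elim auto
  then show ?thesis
  proof cases
    case 1
    have "(\<Sum>i\<in>{1..n + 1}. ?f i * of_int (cartan_D (n + 1) i j)) = (\<Sum>i\<in>{1..n + 1}. ?f i * ?\<delta> 2 (j) i - ?f i * ?\<delta> 1 (j - 1) i - ?f i * ?\<delta> 1 (j + 1) i)"
    proof (intro sum.cong refl)
      fix i assume "i \<in> {1..n + 1}"
      then have "cartan_D (n + 1) i j = (if i = j then 2 else 0) - (if i = j - 1 then 1 else 0) - (if i = j + 1 then 1 else 0)"
        using assms 1 by (auto simp: cartan_D_def)
      then have "(of_int (cartan_D (n + 1) i j) :: real) = ?\<delta> 2 (j) i - ?\<delta> 1 (j - 1) i - ?\<delta> 1 (j + 1) i" by simp
      then show "?f i * of_int (cartan_D (n + 1) i j) = ?f i * ?\<delta> 2 (j) i - ?f i * ?\<delta> 1 (j - 1) i - ?f i * ?\<delta> 1 (j + 1) i" by (simp only: right_diff_distrib)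
    qed
    also have "\<dots> = ?f (j) * 2 - ?f (j - 1) * 1 - ?f (j + 1) * 1"
      unfolding sum_subtractf
      by (intro arg_cong2[where f = minus] sum_times_indicator) (use assms 1 in auto)
    also have "\<dots> = 2" using assms 1 by (auto simp: of_nat_diff field_simps)
    finally show ?thesis .
  next
    case 2
    have "(\<Sum>i\<in>{1..n + 1}. ?f i * of_int (cartan_D (n + 1) i j)) = (\<Sum>i\<in>{1..n + 1}. ?f i * ?\<delta> 2 (n - 1) i - ?f i * ?\<delta> 1 (n - 2) i - ?f i * ?\<delta> 1 (n) i - ?f i * ?\<delta> 1 (n + 1) i)"
    proof (intro sum.cong refl)
      fix i assume "i \<in> {1..n + 1}"
      then have "cartan_D (n + 1) i j = (if i = n - 1 then 2 else 0) - (if i = n - 2 then 1 else 0) - (if i = n then 1 else 0) - (if i = n + 1 then 1 else 0)"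
        using assms 2 by (auto simp: cartan_D_def, linarith+)
      then have "(of_int (cartan_D (n + 1) i j) :: real) = ?\<delta> 2 (n - 1) i - ?\<delta> 1 (n - 2) i - ?\<delta> 1 (n) i - ?\<delta> 1 (n + 1) i" by simp
      then show "?f i * of_int (cartan_D (n + 1) i j) = ?f i * ?\<delta> 2 (n - 1) i - ?f i * ?\<delta> 1 (n - 2) i - ?f i * ?\<delta> 1 (n) i - ?f i * ?\<delta> 1 (n + 1) i" by (simp only: right_diff_distrib)
    qed
    also have "\<dots> = ?f (n - 1) * 2 - ?f (n - 2) * 1 - ?f (n) * 1 - ?f (n + 1) * 1"
      unfolding sum_subtractf
      by (intro arg_cong2[where f = minus] sum_times_indicator) (use assms 2 in auto)
    also have "\<dots> = 2" using assms 2 by (auto simp: of_nat_diff field_simps)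
    finally show ?thesis .
  next
    case 3
    have "(\<Sum>i\<in>{1..n + 1}. ?f i * of_int (cartan_D (n + 1) i j)) = (\<Sum>i\<in>{1..n + 1}. ?f i * ?\<delta> 2 (n) i - ?f i * ?\<delta> 1 (n - 1) i)"
    proof (intro sum.cong refl)
      fix i assume "i \<in> {1..n + 1}"
      then have "cartan_D (n + 1) i j = (if i = n then 2 else 0) - (if i = n - 1 then 1 else 0)"
        using assms 3 by (auto simp: cartan_D_def)
      then have "(of_int (cartan_D (n + 1) i j) :: real) = ?\<delta> 2 (n) i - ?\<delta> 1 (n - 1) i" by simp
      then show "?f i * of_int (cartan_D (n + 1) i j) = ?f i * ?\<delta> 2 (n) i - ?f i * ?\<delta> 1 (n - 1) i" by (simp only: right_diff_distrib)
    qed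
    also have "\<dots> = ?f (n) * 2 - ?f (n - 1) * 1"
      unfolding sum_subtractf
      by (intro arg_cong2[where f = minus] sum_times_indicator) (use assms 3 in auto)
    also have "\<dots> = 2" using assms 3 by (auto simp: of_nat_diff field_simps)
    finally show ?thesis .
  next
    case 4
    have "(\<Sum>i\<in>{1..n + 1}. ?f i * of_int (cartan_D (n + 1) i j)) = (\<Sum>i\<in>{1..n + 1}. ?f i * ?\<delta> 2 (n + 1) i - ?f i * ?\<delta> 1 (n - 1) i)"
    proof (intro sum.cong refl)
      fix i assume "i \<in> {1..n + 1}"
      then have "cartan_D (n + 1) i j = (if i = n + 1 then 2 else 0) - (if i = n - 1 then 1 else 0)"
        using assms 4 by (auto simp: cartan_D_def)
      then have "(of_int (cartan_D (n + 1) i j) :: real) = ?\<delta> 2 (n + 1) i - ?\<delta> 1 (n - 1) i" by simp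
      then show "?f i * of_int (cartan_D (n + 1) i j) = ?f i * ?\<delta> 2 (n + 1) i - ?f i * ?\<delta> 1 (n - 1) i" by (simp only: right_diff_distrib)
    qed
    also have "\<dots> = ?f (n + 1) * 2 - ?f (n - 1) * 1"
      unfolding sum_subtractf
      by (intro arg_cong2[where f = minus] sum_times_indicator) (use assms 4 in auto)
    also have "\<dots> = 2" using assms 4 by (auto simp: of_nat_diff field_simps)
    finally show ?thesis .
  qed
qed

lemma rho_coeff_cartan:
  assumes "admissible X n" "j \<in> {1..lie_rank X n}"
  shows "(\<Sum>i\<in>{1..lie_rank X n}. rho_coeff X n i * of_int (cartan X n i j)) = 2"
proof (cases X)
  case A_even
  then show ?thesis using rho_coeff_cartan_A[of j "2 * n"] assms by simp
next
  case A_odd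
  then show ?thesis using rho_coeff_cartan_A[of j "2 * n - 1"] assms by (simp add: of_nat_diff)
next
  case D
  then show ?thesis using rho_coeff_cartan_D[of n j] assms by simp
qed

text \<open>\<open>rho_coeff\<close> is invariant under the diagram automorphism, so both halves of
  a folded entry contribute 2 for each letter.\<close>

lemma rho_coeff_folded_cartan:
  assumes X: "admissible X n" and w: "w \<in> lists {1..lie_rank X n}"
  shows "(\<Sum>i\<in>{1..lie_rank X n}. rho_coeff X n i *
      sum_list (map (\<lambda>k. of_int (cartan X n i k + cartan X n (diagram_aut X n i) k)) w)) = 4 * length w"
  using w
proof (induction w rule: list.induct)
  case (Cons k w)
  let ?I = "{1..lie_rank X n}" and ?c = "rho_coeff X n" and ?a = "cartan X n" and ?\<tau> = "diagram_aut X n"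
  have k: "k \<in> ?I" "w \<in> lists ?I" using Cons.prems by auto
  have bij: "bij_betw ?\<tau> ?I ?I"
    by (rule bij_betw_byWitness[where f' = ?\<tau>])
      (use diagram_aut_involution[OF X] diagram_aut_rank[OF X] in blast)+
  have "(\<Sum>i\<in>?I. ?c i * of_int (?a (?\<tau> i) k)) = (\<Sum>i\<in>?I. ?c (?\<tau> i) * of_int (?a (?\<tau> i) k))"
    by (intro sum.cong) (simp_all add: rho_coeff_diagram_aut[OF X] del: atLeastAtMost_iff)
  also have "\<dots> = (\<Sum>i\<in>?I. ?c i * of_int (?a i k))"
    by (rule sum.reindex_bij_betw[OF bij])
  finally have "(\<Sum>i\<in>?I. ?c i * of_int (?a i k + ?a (?\<tau> i) k)) = 4"
    using rho_coeff_cartan[OF X k(1)] by (simp add: distrib_left sum.distrib)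
  then show ?case using Cons.IH[OF k(2)] by (simp add: distrib_left[of "?c _"] sum.distrib)
qed simp

sublocale simple_lie_algebra \<subseteq> lie: lie_algebra scale br
  by unfold_locales
    (fact br_add_left br_add_right br_scale_left br_scale_right br_self jacobi)+

context lie_algebra
begin

text \<open>\<open>H'\<close> may occur in \<open>A\<close> with a minus sign: exchanging E and F
  turns [E i, F i] = H i into [F i, E i] = - H i.\<close>

lemma br_words_span:
  assumes GG: "\<And>i j. i \<in> I \<Longrightarrow> j \<in> I \<Longrightarrow> br (G' i) (G j) = (if i = j then H' i else 0)"
    and HG: "\<And>i j. i \<in> I \<Longrightarrow> j \<in> I \<Longrightarrow> br (H' i) (G j) = sc (c i j) (G j)"
    and HG': "\<And>i j. i \<in> I \<Longrightarrow> j \<in> I \<Longrightarrow> br (H' i) (G' j) = sc (c' i j) (G' j)"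
    and A: "A \<subseteq> {brw G w | w. w \<in> lists I \<and> w \<noteq> []} \<union> {brw G' w | w. w \<in> lists I \<and> w \<noteq> []}
              \<union> H' ` I \<union> (\<lambda>i. - H' i) ` I"
      "{brw G w | w. w \<in> lists I \<and> w \<noteq> []} \<subseteq> A" "{brw G' w | w. w \<in> lists I \<and> w \<noteq> []} \<subseteq> A"
      "H' ` I \<subseteq> span A"
    and i: "i \<in> I" and t: "t \<in> span A"
  shows "br (G' i) t \<in> span A"
  using t
proof (induction rule: span_induct_alt)
  case base
  show ?case by (simp add: span_zero)
next
  case (step r s y)
  have Gi': "sc r (G' i) \<in> span A" for r
    using A(3) i by (intro span_scale span_base subsetD[OF A(3)] CollectI exI[of _ "[i]"]) simp
  have H': "br (G' i) (H' j) \<in> span A" if "j \<in> I" for j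
    using br_anti[of "G' i" "H' j"] HG'[OF that i] Gi'[of "- c' j i"] by simp
  consider w where "s = brw G w" "w \<in> lists I" "w \<noteq> []"
    | w where "s = brw G' w" "w \<in> lists I" "w \<noteq> []" | j where "s = H' j" "j \<in> I" | j where "s = - H' j" "j \<in> I"
    using step.hyps A(1) by blast
  then have "br (G' i) s \<in> span A"
  proof cases
    case (1 w)
    show ?thesis
    proof (cases "length w = 1")
      case True
      then obtain j where "w = [j]" by (auto simp: length_Suc_conv)
      with 1 have "br (G' i) s = (if i = j then H' i else 0)" using GG[OF i, of j] by simp
      moreover have "H' i \<in> span A" using A(4) i by blast
      ultimately show ?thesis by (cases "i = j") (simp_all add: span_zero)
    next
      case False
      then obtain l where l: "length w = Suc l" "l > 0" using 1(3) by (cases w) auto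
      have "br (G' i) s \<in> word_space G I l"
        unfolding 1(1) by (rule br_word_space_lower[OF GG HG i 1(2) l])
      also have "\<dots> \<subseteq> span A"
        unfolding word_space_def using A(2) l(2) by (intro span_mono) fastforce
      finally show ?thesis .
    qed
  next
    case (2 w)
    then have "br (G' i) s = brw G' (i # w)" "i # w \<in> lists I" using i by (simp_all add: brw_Cons)
    then show ?thesis using A(3) by (intro span_base) blast
  next
    case (3 j)
    then show ?thesis using H' by simp
  next
    case (4 j)
    then show ?thesis using H' by (simp add: br_minus_right span_neg)
  qed
  with step.IH show ?case by (simp add: br_add_right br_scale_right span_add span_scale)
qed

end

section \<open>Triangular decomposition\<close>

context twisted_lie_algebra
begin

abbreviation (input) "I \<equiv> {1..lie_rank X n}"
abbreviation (input) "a \<equiv> cartan X n"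
abbreviation (input) "\<tau> \<equiv> diagram_aut X n"

lemma generated_induct:
  assumes "subspace T" "\<And>i. i \<in> I \<Longrightarrow> E i \<in> T" "\<And>i. i \<in> I \<Longrightarrow> F i \<in> T"
    "\<And>u v. u \<in> T \<Longrightarrow> v \<in> T \<Longrightarrow> br u v \<in> T"
  shows "u \<in> T"
proof -
  have "lie_generated (E ` I \<union> F ` I) \<subseteq> T"
    unfolding lie_generated_def using assms by blast
  then show ?thesis using generated by blast
qed

lemma \<sigma>_add: "\<sigma> (u + v) = \<sigma> u + \<sigma> v" and \<sigma>_scale: "\<sigma> (scale c u) = scale c (\<sigma> u)"
  and \<sigma>_0: "\<sigma> 0 = 0" and \<sigma>_diff: "\<sigma> (u - v) = \<sigma> u - \<sigma> v" and \<sigma>_minus: "\<sigma> (- u) = - \<sigma> u"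
  and \<sigma>_sum: "\<sigma> (\<Sum>i\<in>A. f i) = (\<Sum>i\<in>A. \<sigma> (f i))"
proof -
  interpret Vector_Spaces.linear scale scale \<sigma> by (rule \<sigma>_linear)
  show "\<sigma> (u + v) = \<sigma> u + \<sigma> v" "\<sigma> (scale c u) = scale c (\<sigma> u)" "\<sigma> 0 = 0" "\<sigma> (u - v) = \<sigma> u - \<sigma> v"
    "\<sigma> (- u) = - \<sigma> u" "\<sigma> (\<Sum>i\<in>A. f i) = (\<Sum>i\<in>A. \<sigma> (f i))"
    by (simp_all add: add scale zero diff neg sum)
qed

lemmas \<tau>_I = diagram_aut_rank[OF admissible]
lemmas \<tau>_\<tau> = diagram_aut_involution[OF admissible]

lemma \<sigma>_\<sigma>: "\<sigma> (\<sigma> u) = u"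
proof -
  have "u \<in> {u. \<sigma> (\<sigma> u) = u}"
  proof (rule generated_induct)
    show "subspace {u. \<sigma> (\<sigma> u) = u}"
      by (rule subspaceI) (simp_all add: \<sigma>_0 \<sigma>_add \<sigma>_scale)
    show "E i \<in> {u. \<sigma> (\<sigma> u) = u}" "F i \<in> {u. \<sigma> (\<sigma> u) = u}" if "i \<in> I" for i
      using that \<tau>_I[OF that] \<tau>_\<tau>[OF that] by (simp_all only: \<sigma>_E \<sigma>_F mem_Collect_eq)
  qed (simp add: \<sigma>_br)
  then show ?thesis by simp
qed

lemma \<sigma>_H: "i \<in> I \<Longrightarrow> \<sigma> (H i) = H (\<tau> i)"
  using EF[of i i] EF[of "\<tau> i" "\<tau> i"] \<tau>_I[of i] \<sigma>_br[of "E i" "F i"]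
  by (simp add: \<sigma>_E[of i] \<sigma>_F[of i])

text \<open>The adjoint action of this element is the height: 1 on each E j, -1 on each F j, 0 on
  each H j.\<close>

definition \<rho> :: 'a where
  "\<rho> = (\<Sum>i\<in>I. scale (complex_of_real (rho_coeff X n i / 2)) (H i))"

lemma rho_coeff_complex:
  assumes "j \<in> I"
  shows "(\<Sum>i\<in>I. complex_of_real (rho_coeff X n i / 2) * of_int (a i j)) = 1"
proof -
  have "(\<Sum>i\<in>I. complex_of_real (rho_coeff X n i / 2) * of_int (a i j))
      = complex_of_real ((\<Sum>i\<in>I. rho_coeff X n i * of_int (a i j)) / 2)"
    by (simp add: sum_divide_distrib)
  then show ?thesis unfolding rho_coeff_cartan[OF admissible assms] by (simp del: of_real_sum)
qed

lemma \<rho>_E: "j \<in> I \<Longrightarrow> br \<rho> (E j) = scale 1 (E j)"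
proof -
  assume j: "j \<in> I"
  have "br \<rho> (E j) = (\<Sum>i\<in>I. scale (complex_of_real (rho_coeff X n i / 2) * of_int (a i j)) (E j))"
    unfolding \<rho>_def lie.br_sum_left
    by (intro sum.cong refl) (simp only: br_scale_left HE[OF _ j] scale_scale)
  also have "\<dots> = scale 1 (E j)"
    by (simp only: scale_sum_left[symmetric] rho_coeff_complex[OF j])
  finally show ?thesis .
qed

lemma \<rho>_F: "j \<in> I \<Longrightarrow> br \<rho> (F j) = scale (- 1) (F j)"
proof -
  assume j: "j \<in> I"
  have "br \<rho> (F j) = (\<Sum>i\<in>I. - scale (complex_of_real (rho_coeff X n i / 2) * of_int (a i j)) (F j))"
    unfolding \<rho>_def lie.br_sum_left
    by (intro sum.cong refl) (simp only: br_scale_left HF[OF _ j] scale_scale scale_minus_left scale_minus_right)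
  also have "\<dots> = - scale 1 (F j)"
    by (simp only: sum_negf scale_sum_left[symmetric] rho_coeff_complex[OF j])
  finally show ?thesis by simp
qed

lemma \<rho>_H: "j \<in> I \<Longrightarrow> br \<rho> (H j) = 0"
  unfolding \<rho>_def lie.br_sum_left by (intro sum.neutral ballI) (simp only: br_scale_left HH scale_zero_right)

text \<open>\<open>rho_coeff\<close> is \<tau>-invariant. Thus weights of \<open>h0\<close> can be
  evaluated at \<rho>, which links them to heights.\<close>

lemma \<rho>_h0: "\<rho> \<in> h0"
proof -
  have 1: "\<rho> \<in> \<h>"
    unfolding \<rho>_def \<h>_def by (intro span_sum span_scale span_base) auto
  have bij: "bij_betw \<tau> I I"
    by (rule bij_betw_byWitness[where f' = \<tau>]) (use \<tau>_\<tau> \<tau>_I in blast)+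
  have "\<sigma> \<rho> = (\<Sum>i\<in>I. scale (complex_of_real (rho_coeff X n (\<tau> i) / 2)) (H (\<tau> i)))"
    unfolding \<rho>_def \<sigma>_sum
    by (intro sum.cong refl) (simp only: \<sigma>_scale \<sigma>_H rho_coeff_diagram_aut[OF admissible])
  also have "\<dots> = \<rho>" unfolding \<rho>_def by (rule sum.reindex_bij_betw[OF bij])
  finally show ?thesis using 1 by (simp add: h0_def part_def)
qed

text \<open>Chosen as a spanning set of eigenvectors of ad \<rho>, the input of
  \<open>eigenvector_in_span\<close>; independence is not claimed.\<close>

definition basic_vectors :: "'a set" where
  "basic_vectors = {lie.brw F w | w. w \<in> lists I \<and> w \<noteq> []} \<union> {lie.brw E w | w. w \<in> lists I \<and> w \<noteq> []} \<union> H ` I"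

lemma F_basic: "i \<in> I \<Longrightarrow> F i \<in> basic_vectors" and E_basic: "i \<in> I \<Longrightarrow> E i \<in> basic_vectors"
  unfolding basic_vectors_def by (force intro!: exI[of _ "[i]"])+

text \<open>The span is stable under bracketing with each E i and F i. The elements that stabilise
  it form a subalgebra, hence all of \<g>; so the span is closed under brackets and contains the
  generators.\<close>

lemma span_basic_vectors: "span basic_vectors = UNIV"
proof -
  let ?T = "span basic_vectors"
  have E: "br (E i) t \<in> ?T" if "i \<in> I" "t \<in> ?T" for i t
  proof (rule lie.br_words_span[OF _ _ _ _ _ _ _ that])
    show "br (E i) (F j) = (if i = j then H i else 0)" if "i \<in> I" "j \<in> I" for i j by (rule EF[OF that])
    show "br (H i) (F j) = scale (- of_int (a i j)) (F j)" if "i \<in> I" "j \<in> I" for i j by (rule HF[OF that])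
    show "br (H i) (E j) = scale (of_int (a i j)) (E j)" if "i \<in> I" "j \<in> I" for i j by (rule HE[OF that])
    show "H ` I \<subseteq> ?T" unfolding basic_vectors_def by (auto intro: span_base)
  qed (auto simp: basic_vectors_def)
  have F: "br (F i) t \<in> ?T" if "i \<in> I" "t \<in> ?T" for i t
  proof (rule lie.br_words_span[OF _ _ _ _ _ _ _ that])
    show "br (F i) (E j) = (if i = j then - H i else 0)" if "i \<in> I" "j \<in> I" for i j
      using EF[OF that(2,1)] lie.br_anti[of "F i" "E j"] by auto
    show "br (- H i) (E j) = scale (- of_int (a i j)) (E j)" if "i \<in> I" "j \<in> I" for i j
      using HE[OF that] by (simp add: lie.br_minus_left)
    show "br (- H i) (F j) = scale (of_int (a i j)) (F j)" if "i \<in> I" "j \<in> I" for i j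
      using HF[OF that] by (simp add: lie.br_minus_left)
    show "(\<lambda>i. - H i) ` I \<subseteq> ?T" unfolding basic_vectors_def by (intro image_subsetI span_neg span_base) blast
  qed (auto simp: basic_vectors_def)
  have "u \<in> {u. \<forall>t\<in>?T. br u t \<in> ?T}" for u
  proof (rule generated_induct)
    show "subspace {u. \<forall>t\<in>?T. br u t \<in> ?T}"
      by (rule subspaceI) (auto simp: br_add_left br_scale_left span_zero span_add span_scale)
  next
    fix u v assume "u \<in> {u. \<forall>t\<in>?T. br u t \<in> ?T}" "v \<in> {u. \<forall>t\<in>?T. br u t \<in> ?T}"
    then show "br u v \<in> {u. \<forall>t\<in>?T. br u t \<in> ?T}" by (simp add: lie.br_br span_diff)
  qed (use E F in blast)+
  then have br: "br u t \<in> ?T" if "t \<in> ?T" for u t using that by blast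
  have "u \<in> ?T" for u
    by (rule generated_induct) (simp_all only: subspace_span span_base E_basic F_basic br)
  then show ?thesis by blast
qed

lemma \<rho>_wordE: "w \<in> lists I \<Longrightarrow> br \<rho> (lie.brw E w) = scale (of_nat (length w)) (lie.brw E w)"
  using lie.brw_weight[of I \<rho> E "\<lambda>_. 1" w] \<rho>_E by (simp add: map_replicate_const sum_list_replicate)

lemma \<rho>_wordF: "w \<in> lists I \<Longrightarrow> br \<rho> (lie.brw F w) = scale (- of_nat (length w)) (lie.brw F w)"
  using lie.brw_weight[of I \<rho> F "\<lambda>_. -1" w] \<rho>_F by (simp add: map_replicate_const sum_list_replicate)

lemma basic_vectors_height: "s \<in> basic_vectors \<Longrightarrow> \<exists>k. br \<rho> s = scale (of_int k) s"
proof -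
  assume "s \<in> basic_vectors"
  then consider w where "s = lie.brw F w" "w \<in> lists I" | w where "s = lie.brw E w" "w \<in> lists I"
    | i where "s = H i" "i \<in> I"
    unfolding basic_vectors_def by blast
  then show ?thesis
  proof cases
    case (1 w)
    then show ?thesis using \<rho>_wordF by (intro exI[of _ "- int (length w)"]) simp
  next
    case (2 w)
    then show ?thesis using \<rho>_wordE by (intro exI[of _ "int (length w)"]) simp
  next
    case (3 i)
    then show ?thesis using \<rho>_H by (intro exI[of _ 0]) simp
  qed
qed

text \<open>In finite dimension ad \<rho> has only finitely many eigenvalues.\<close>

lemma height_bound: "\<exists>K. \<forall>u k. br \<rho> u = scale (of_int k) u \<and> \<bar>k\<bar> \<ge> int K \<longrightarrow> u = 0"
proof -
  obtain B where B: "finite B" "span B = UNIV" using finite_dim by blast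
  let ?C = "{c. \<exists>u. u \<noteq> 0 \<and> br \<rho> u = scale c u}"
  have "finite (norm ` ?C)" using finite_eigenvalues[OF lie.br_linear B] by simp
  then obtain K where K: "\<And>c. c \<in> ?C \<Longrightarrow> norm c < real K"
  proof -
    assume a: "\<And>K. (\<And>c. c \<in> ?C \<Longrightarrow> norm c < real K) \<Longrightarrow> thesis" and fin: "finite (norm ` ?C)"
    obtain K where "Max (insert 0 (norm ` ?C)) < real K" using reals_Archimedean2 by blast
    with fin show thesis by (intro a[of K]) (simp add: Max_less_iff)
  qed
  show ?thesis
  proof (intro exI[of _ K] allI impI, rule ccontr)
    fix u k assume u: "br \<rho> u = scale (of_int k) u \<and> \<bar>k\<bar> \<ge> int K" "u \<noteq> 0"
    then have "(of_int k :: complex) \<in> ?C" by blast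
    then have "norm (of_int k :: complex) < real K" by (rule K)
    then have "real_of_int \<bar>k\<bar> < real K" by (simp add: norm_of_int)
    with u(1) show False by linarith
  qed
qed

lemma long_words_0: "\<exists>K. \<forall>w\<in>lists I. length w \<ge> K \<longrightarrow> lie.brw F w = 0"
proof -
  obtain K where K: "\<And>u k. br \<rho> u = scale (of_int k) u \<Longrightarrow> \<bar>k\<bar> \<ge> int K \<Longrightarrow> u = 0"
    using height_bound by blast
  show ?thesis
  proof (intro exI[of _ K] ballI impI)
    fix w assume "w \<in> lists I" "length w \<ge> K"
    then show "lie.brw F w = 0" using K[of "lie.brw F w" "- int (length w)"] \<rho>_wordF by simp
  qed
qed

lemma height_br:
  assumes "br \<rho> u = scale (of_int k) u" "br \<rho> v = scale (of_int l) v"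
  shows "br \<rho> (br u v) = scale (of_int (k + l)) (br u v)"
proof -
  have "br \<rho> (br u v) = br (br \<rho> u) v + br u (br \<rho> v)" by (simp add: lie.br_br)
  then show ?thesis by (simp add: assms br_scale_left br_scale_right scale_left_distrib)
qed

lemma height_funpow_br:
  assumes "br \<rho> u = scale (of_int k) u" "br \<rho> v = scale (of_int l) v"
  shows "br \<rho> ((br u ^^ m) v) = scale (of_int (int m * k + l)) ((br u ^^ m) v)"
proof (induction m)
  case (Suc m)
  then show ?case using height_br[OF assms(1) Suc] by (simp add: algebra_simps)
qed (simp add: assms)

text \<open>Each application of ad u shifts the height by the non-zero \<open>k\<close> and so
  eventually leaves the finite range of heights.\<close>

lemma ad_nilpotent:
  assumes u: "br \<rho> u = scale (of_int k) u" "k \<noteq> 0"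
  shows "locally_nilpotent (br u)"
  unfolding locally_nilpotent_def
proof
  fix t
  obtain K where K: "\<And>u k. br \<rho> u = scale (of_int k) u \<Longrightarrow> \<bar>k\<bar> \<ge> int K \<Longrightarrow> u = 0"
    using height_bound by blast
  have "t \<in> span basic_vectors" by (simp add: span_basic_vectors)
  then show "\<exists>m. (br u ^^ m) t = 0"
  proof (induction rule: span_induct_alt)
    case base
    show ?case by (intro exI[of _ 0]) simp
  next
    case (step c s y)
    obtain m where m: "(br u ^^ m) y = 0" using step.IH by blast
    obtain l where l: "br \<rho> s = scale (of_int l) s" using basic_vectors_height[OF step.hyps] by blast
    \<comment> \<open>From height \<open>l\<close>, this many shifts by \<open>k\<close> lead to a
      height of absolute value at least K, because |k| >= 1.\<close>
    let ?m = "K + nat \<bar>l\<bar>"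
    have "(br u ^^ ?m) s = 0"
    proof (rule K[OF height_funpow_br[OF u(1) l]])
      have "\<bar>int ?m * k\<bar> \<ge> int ?m"
        using u(2) mult_left_mono[of 1 "\<bar>k\<bar>" "int ?m"] by (simp add: abs_mult)
      then show "int K \<le> \<bar>int ?m * k + l\<bar>" by linarith
    qed
    then have "(br u ^^ (m + ?m)) (scale c s + y) = 0"
      using lie.funpow_br_le[OF m, of "m + ?m"] lie.funpow_br_le[of ?m u s "m + ?m"]
      by (simp add: lie.funpow_br_add lie.funpow_br_scale)
    then show ?case by blast
  qed
qed

lemma \<sigma>_wordF: "w \<in> lists I \<Longrightarrow> \<sigma> (lie.brw F w) = lie.brw F (map \<tau> w)"
  by (rule lie.brw_hom[where I = I and \<sigma> = \<sigma> and \<tau> = \<tau> and G = F, OF \<sigma>_br \<sigma>_0 \<sigma>_F])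

lemma \<sigma>_wordE: "w \<in> lists I \<Longrightarrow> \<sigma> (lie.brw E w) = lie.brw E (map \<tau> w)"
  by (rule lie.brw_hom[where I = I and \<sigma> = \<sigma> and \<tau> = \<tau> and G = E, OF \<sigma>_br \<sigma>_0 \<sigma>_E])

end

section \<open>Generation of the fixed subalgebra\<close>

lemma sum_list_of_real_neg:
  "sum_list (map (\<lambda>k. - complex_of_real (s * g k)) w) = complex_of_real (- (s * sum_list (map g w)))"
  by (induction w) (simp_all add: algebra_simps)

context twisted_lie_algebra
begin

text \<open>At a node fixed by \<tau> both sums double their generator, which gives s = 2.\<close>

lemma folded_EF:
  assumes i: "i \<in> I" and s: "s = (if \<tau> i = i then 2 else 1 :: real)"
  shows "br (E i + E (\<tau> i)) (F i + F (\<tau> i)) = scale (complex_of_real s) (H i + H (\<tau> i))"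
proof -
  have t: "\<tau> i \<in> I" using \<tau>_I[OF i] .
  have "scale 2 h = h + h" for h using scale_left_distrib[of 1 1 h] by simp
  then show ?thesis
    by (simp add: s br_add_left br_add_right EF[OF i i] EF[OF i t] EF[OF t i] EF[OF t t] scale_right_distrib)
qed

lemma folded_HF:
  assumes i: "i \<in> I" and k: "k \<in> I"
  shows "br (H i + H (\<tau> i)) (F k) = scale (- complex_of_real (of_int (a i k + a (\<tau> i) k))) (F k)"
  by (simp add: br_add_left HF[OF i k] HF[OF \<tau>_I[OF i] k] scale_left_diff_distrib)

text \<open>The folded Cartan entries are \<tau>-invariant, so a word and its image under \<sigma>
  have the same weight on folded coroots.\<close>

lemma folded_word:
  assumes i: "i \<in> I" and w: "w \<in> lists I"
  defines "q \<equiv> sum_list (map (\<lambda>k. of_int (a i k + a (\<tau> i) k) :: real) w)"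
  shows "br (H i + H (\<tau> i)) (lie.brw F w + \<sigma> (lie.brw F w))
    = scale (complex_of_real (- q)) (lie.brw F w + \<sigma> (lie.brw F w))"
proof -
  let ?g = "\<lambda>k. of_int (a i k + a (\<tau> i) k) :: real"
  have *: "br (H i + H (\<tau> i)) (lie.brw F u) = scale (complex_of_real (- sum_list (map ?g u))) (lie.brw F u)"
    if "u \<in> lists I" for u
    using lie.brw_weight[of I "H i + H (\<tau> i)" F "\<lambda>k. - complex_of_real (?g k)" u, OF folded_HF[OF i] that]
      sum_list_of_real_neg[of 1 ?g u] by simp
  have "?g (\<tau> k) = ?g k" if k: "k \<in> I" for k
    using cartan_diagram_aut[OF admissible i k] cartan_diagram_aut[OF admissible \<tau>_I[OF i] k] \<tau>_\<tau>[OF i]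
    by (simp add: add.commute)
  then have "sum_list (map ?g (map \<tau> w)) = q"
    unfolding q_def map_map using w by (intro arg_cong[of _ _ sum_list] map_cong) (simp_all add: in_lists_conv_set)
  moreover have "map \<tau> w \<in> lists I" using w \<tau>_I by (induction w) auto
  ultimately show ?thesis
    using *[OF w] *[of "map \<tau> w"] \<sigma>_wordF[OF w] by (simp add: br_add_right scale_right_distrib q_def)
qed

text \<open>
  With \<open>\<rho> = \<Sum> (c\<^sub>i / 2) H\<^sub>i\<close> and \<open>c\<^sub>i \<ge> 0\<close>, the weight of a word is strictly negative on some \<open>H\<^sub>i + H\<^bsub>\<tau> i\<^esub>\<close>.
\<close>

lemma fixed_words_in_subalgebra:
  assumes m: "subspace \<mm>" "\<And>u v. u \<in> \<mm> \<Longrightarrow> v \<in> \<mm> \<Longrightarrow> br u v \<in> \<mm>"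
    and E: "\<And>i. i \<in> I \<Longrightarrow> E i + E (\<tau> i) \<in> \<mm>" and F: "\<And>i. i \<in> I \<Longrightarrow> F i + F (\<tau> i) \<in> \<mm>"
    and w: "w \<in> lists I" "w \<noteq> []"
  shows "lie.brw F w + \<sigma> (lie.brw F w) \<in> \<mm>"
  using w
proof (induction "length w" arbitrary: w rule: less_induct)
  case (less w)
  obtain l where l: "length w = Suc l" using less.prems by (cases w) auto
  show ?case
  proof (cases "l = 0")
    case True
    then obtain i where "w = [i]" using l by (auto simp: length_Suc_conv)
    with less.prems(1) have "i \<in> I" "lie.brw F w + \<sigma> (lie.brw F w) = F i + F (\<tau> i)"
      using \<sigma>_F[of i] by simp_all
    then show ?thesis using F by metis
  next
    case False
    let ?z = "lie.brw F w + \<sigma> (lie.brw F w)"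
    define q where "q i = sum_list (map (\<lambda>k. of_int (a i k + a (\<tau> i) k) :: real) w)" for i
    have "(\<Sum>i\<in>I. rho_coeff X n i * q i) = 4 * length w"
      unfolding q_def by (rule rho_coeff_folded_cartan[OF admissible less.prems(1)])
    moreover have "(\<Sum>i\<in>I. rho_coeff X n i * q i) \<le> 0" if "\<And>i. i \<in> I \<Longrightarrow> q i \<le> 0"
      using that rho_coeff_nonneg by (intro sum_nonpos mult_nonneg_nonpos)
    ultimately obtain i where i: "i \<in> I" "q i > 0" using l by fastforce
    define s where "s = (if \<tau> i = i then 2 else 1 :: real)"
    let ?e = "E i + E (\<tau> i)" and ?f = "F i + F (\<tau> i)"
    note ef = folded_EF[OF i(1) s_def]
    define t where "t = real_of_int (a i i + a (\<tau> i) i)"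
    \<comment> \<open>The diagonal entry is 2 and the other one at least -1; the value 1 occurs at
      the two middle nodes of \<open>A_even\<close>.\<close>
    have t: "t > 0" using cartan_diag[of X n i] cartan_ge[of X n "\<tau> i" i] by (simp add: t_def)
    have spos: "s > 0" by (simp add: s_def)
    have h_word: "br (br ?e ?f) (lie.brw F u + \<sigma> (lie.brw F u))
        = scale (complex_of_real (- (s * sum_list (map (\<lambda>k. of_int (a i k + a (\<tau> i) k)) u))))
           (lie.brw F u + \<sigma> (lie.brw F u))" if "u \<in> lists I" for u
      unfolding ef br_scale_left folded_word[OF i(1) that] by simp
    show ?thesis
    proof (rule lie.negative_weight_in_subalgebra[OF m E[OF i(1)] F[OF i(1)]])
      have "?f = lie.brw F [i] + \<sigma> (lie.brw F [i])" using \<sigma>_F[OF i(1)] by simp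
      then show "br (br ?e ?f) ?f = scale (- complex_of_real (s * t)) ?f"
        using h_word[of "[i]"] i(1) by (simp add: t_def)
      show "s * t > 0" using t spos by simp
      show "br (br ?e ?f) ?z = scale (complex_of_real (- (s * q i))) ?z"
        unfolding q_def by (rule h_word[OF less.prems(1)])
      show "- (s * q i) < 0" using spos i(2) by simp
      have "br \<rho> ?f = scale (of_int (-1)) ?f"
        using \<rho>_F[OF i(1)] \<rho>_F[OF \<tau>_I[OF i(1)]] by (simp add: br_add_right)
      then have "locally_nilpotent (br ?f)" by (rule ad_nilpotent) simp
      then show "(br ?f ^^ (SOME k. (br ?f ^^ k) ?z = 0)) ?z = 0"
        unfolding locally_nilpotent_def by (intro someI_ex[of "\<lambda>k. (br ?f ^^ k) ?z = 0"]) blast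
      \<comment> \<open>\<open>?e\<close> removes one letter, so [?e, ?z] is again of the form v +
        \<sigma> v with v a combination of words of length l, where the induction hypothesis
        applies.\<close>
      have wsF: "v + \<sigma> v \<in> \<mm>" if "v \<in> lie.word_space F I l" for v
        using that unfolding lie.word_space_def
      proof (induction rule: span_induct_alt)
        case base
        show ?case by (simp add: \<sigma>_0 subspace_0[OF m(1)])
      next
        case (step c x y)
        then obtain u where u: "x = lie.brw F u" "u \<in> lists I" "length u = l" by blast
        with less.hyps[of u] l False have "x + \<sigma> x \<in> \<mm>" by fastforce
        then have "scale c (x + \<sigma> x) + (y + \<sigma> y) \<in> \<mm>"
          by (rule subspace_add[OF m(1) subspace_scale[OF m(1)] step.IH])
        then show ?case by (simp add: \<sigma>_add \<sigma>_scale scale_right_distrib algebra_simps)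
      qed
      have low: "br (E k) (lie.brw F w) \<in> lie.word_space F I l" if "k \<in> I" for k
        using lie.br_word_space_lower[of I E F H "\<lambda>i j. - of_int (a i j)" k w l, OF EF HF that less.prems(1) l] False
        by simp
      let ?u = "br (E i) (lie.brw F w) + br (E (\<tau> i)) (lie.brw F w)"
      have "?u \<in> lie.word_space F I l"
        using low[OF i(1)] low[OF \<tau>_I[OF i(1)]] unfolding lie.word_space_def by (rule span_add)
      then have "?u + \<sigma> ?u \<in> \<mm>" by (rule wsF)
      moreover have "br ?e ?z = ?u + \<sigma> ?u"
        by (simp add: \<sigma>_add \<sigma>_br \<sigma>_E[OF i(1)] \<sigma>_E[OF \<tau>_I[OF i(1)]] \<tau>_\<tau>[OF i(1)] br_add_left br_add_right
            algebra_simps)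
      ultimately show "br ?e ?z \<in> \<mm>" by simp
    qed
  qed
qed

section \<open>Restriction of the simple roots to the fixed part of the Cartan subalgebra\<close>

lemma subspace_part: "subspace A \<Longrightarrow> subspace (part A \<epsilon>)"
  by (rule subspaceI)
    (auto simp: part_def \<sigma>_0 \<sigma>_add \<sigma>_scale scale_right_distrib mult.commute subspace_0 subspace_add subspace_scale)

lemma subspace_h0: "subspace h0"
  unfolding h0_def \<h>_def by (intro subspace_part subspace_span)

text \<open>From [H k, F k] = -2 F k and [E k, F k] = H k; bracketing E k + E (\<tau> k) with F k
  gives H k or 2 H k. The degenerate case F k = 0 is treated apart in
  \<open>simple_root_vectors\<close>.\<close>

lemma F_nonzero:
  assumes k: "k \<in> I" and F: "F k \<noteq> 0"
  shows H_nonzero: "H k \<noteq> 0" and E_nonzero: "E k \<noteq> 0"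
    and E_plus_nonzero: "E k + E (\<tau> k) \<noteq> 0"
proof -
  show H: "H k \<noteq> 0"
    using HF[OF k k] F by (auto simp: cartan_diag)
  then show "E k \<noteq> 0" using EF[OF k k] by auto
  show "E k + E (\<tau> k) \<noteq> 0"
  proof
    assume "E k + E (\<tau> k) = 0"
    then have "br (E k + E (\<tau> k)) (F k) = 0" by simp
    then have "H k + (if \<tau> k = k then H k else 0) = 0"
      by (cases "\<tau> k = k") (simp_all add: br_add_left EF[OF k k] EF[OF \<tau>_I[OF k] k])
    moreover have "H k + H k = scale 2 (H k)" using scale_left_distrib[of 1 1 "H k"] by simp
    ultimately show False using H by (cases "\<tau> k = k") simp_all
  qed
qed

text \<open>As F k and F (\<tau> k) differ, k is not fixed by \<tau>, and [E k - E (\<tau> k), F k]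
  = H k.\<close>

lemma E_minus_nonzero:
  assumes k: "k \<in> I" and F: "F k - F (\<tau> k) \<noteq> 0"
  shows "E k - E (\<tau> k) \<noteq> 0"
proof
  assume "E k - E (\<tau> k) = 0"
  moreover have "\<tau> k \<noteq> k" using F by auto
  ultimately have "H k = 0"
    using br_add_left[of "E k - E (\<tau> k)" "E (\<tau> k)" "F k"] EF[OF k k] EF[OF \<tau>_I[OF k] k] by simp
  then have "F k = 0" using H_nonzero[OF k] by blast
  then show False using F \<sigma>_F[OF k] \<sigma>_0 by simp
qed

text \<open>The restriction to \<open>h0\<close> of the k-th simple root of \<g>, set to 0 elsewhere
  as \<open>h0_dual\<close> prescribes; the description is unique once E k is non-zero.\<close>

definition restricted_root :: "nat \<Rightarrow> 'a \<Rightarrow> complex" where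
  "restricted_root k b = (if b \<in> h0 then THE c. br b (E k) = scale c (E k) else 0)"

lemma h0_weight:
  assumes k: "k \<in> I" and b: "b \<in> h0"
  shows "\<exists>c. br b (E k) = scale c (E k) \<and> br b (F k) = scale (- c) (F k)"
proof -
  have "b \<in> span (H ` I)" using b by (simp add: h0_def part_def \<h>_def)
  then show ?thesis
  proof (induction rule: span_induct_alt)
    case base
    show ?case by (intro exI[of _ 0]) simp
  next
    case (step r h y)
    obtain c where c: "br y (E k) = scale c (E k)" "br y (F k) = scale (- c) (F k)" using step.IH by blast
    obtain i where i: "i \<in> I" "h = H i" using step.hyps by blast
    show ?case
      by (intro exI[of _ "r * of_int (a i k) + c"])
        (simp add: i(2) br_add_left br_scale_left HE[OF i(1) k] HF[OF i(1) k] c scale_left_distrib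
          scale_left_diff_distrib)
  qed
qed

context
  fixes k assumes k: "k \<in> I" and Fk: "F k \<noteq> 0"
begin

lemma restricted_root_eq: "b \<in> h0 \<Longrightarrow> br b (E k) = scale c (E k) \<Longrightarrow> restricted_root k b = c"
  using E_nonzero[OF k Fk] by (auto simp: restricted_root_def intro!: the_equality)

lemma restricted_root:
  assumes b: "b \<in> h0"
  shows "br b (E k) = scale (restricted_root k b) (E k)"
    "br b (F k) = scale (- restricted_root k b) (F k)"
    "br b (E (\<tau> k)) = scale (restricted_root k b) (E (\<tau> k))"
    "br b (F (\<tau> k)) = scale (- restricted_root k b) (F (\<tau> k))"
proof -
  obtain c where c: "br b (E k) = scale c (E k)" "br b (F k) = scale (- c) (F k)"
    using h0_weight[OF k b] by blast
  have r: "restricted_root k b = c" by (rule restricted_root_eq[OF b c(1)])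
  show "br b (E k) = scale (restricted_root k b) (E k)"
    "br b (F k) = scale (- restricted_root k b) (F k)" using c r by simp_all
  have "\<sigma> b = b" using b by (simp add: h0_def part_def)
  then have "\<sigma> (br b (E k)) = br b (E (\<tau> k))" "\<sigma> (br b (F k)) = br b (F (\<tau> k))"
    by (simp_all add: \<sigma>_br \<sigma>_E[OF k] \<sigma>_F[OF k])
  then show "br b (E (\<tau> k)) = scale (restricted_root k b) (E (\<tau> k))"
    "br b (F (\<tau> k)) = scale (- restricted_root k b) (F (\<tau> k))"
    using c r by (simp_all add: \<sigma>_scale \<sigma>_minus \<sigma>_E[OF k] \<sigma>_F[OF k])
qed

lemma restricted_root_dual: "restricted_root k \<in> h0_dual"
  unfolding h0_dual_def
proof (intro CollectI conjI ballI allI impI)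
  fix b assume b: "b \<in> h0"
  fix c show "restricted_root k (scale c b) = c * restricted_root k b"
    using b by (intro restricted_root_eq subspace_scale[OF subspace_h0]) (simp_all add: br_scale_left restricted_root(1))
next
  fix b b' assume "b \<in> h0" "b' \<in> h0"
  then show "restricted_root k (b + b') = restricted_root k b + restricted_root k b'"
    by (intro restricted_root_eq subspace_add[OF subspace_h0])
      (simp_all add: br_add_left restricted_root(1) scale_left_distrib)
qed (simp add: restricted_root_def)

lemma restricted_root_\<rho>: "restricted_root k \<rho> = 1"
  by (rule restricted_root_eq[OF \<rho>_h0 \<rho>_E[OF k]])

lemma weight_space_plus: "E k + E (\<tau> k) \<in> weight_space 0 (restricted_root k)"
  unfolding weight_space_def part_def
  by (simp add: \<sigma>_add \<sigma>_E[OF k] \<sigma>_E[OF \<tau>_I[OF k]] \<tau>_\<tau>[OF k] br_add_right restricted_root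
      scale_right_distrib add.commute)

lemma weight_space_minus: "E k - E (\<tau> k) \<in> weight_space 1 (restricted_root k)"
  unfolding weight_space_def part_def
  by (simp add: \<sigma>_diff \<sigma>_E[OF k] \<sigma>_E[OF \<tau>_I[OF k]] \<tau>_\<tau>[OF k] lie.br_diff_right restricted_root
      scale_right_diff_distrib)

end

end

section \<open>Simple root vectors\<close>

context twisted_lie_algebra
begin

lemma npos_E: "i \<in> I \<Longrightarrow> E i \<in> npos"
  unfolding npos_def lie_generated_def by blast

lemma npos_br: "u \<in> npos \<Longrightarrow> v \<in> npos \<Longrightarrow> br u v \<in> npos"
  unfolding npos_def lie_generated_def by blast

lemma npos_brw:
  assumes "w \<in> lists I" "w \<noteq> []"
  shows "lie.brw E w \<in> npos"
  using assms
proof (induction w rule: list.induct)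
  case (Cons i w)
  then have i: "i \<in> I" "w \<in> lists I" by auto
  show ?case
  proof (cases "w = []")
    case False
    then show ?thesis using npos_br[OF npos_E[OF i(1)] Cons.IH[OF i(2)]] by (simp add: lie.brw_Cons)
  qed (simp add: npos_E[OF i(1), simplified])
qed simp

lemma subspace_npos: "subspace npos"
  unfolding npos_def lie_generated_def by (intro subspace_Inter) blast

lemma npos_positive_height:
  "npos \<subseteq> span {u. \<exists>l\<ge>1. br \<rho> u = scale (of_nat l) u}" (is "_ \<subseteq> span ?S")
proof -
  have E: "E ` I \<subseteq> span ?S"
    using \<rho>_E by (auto intro!: span_base exI[of _ 1])
  have br_S: "br u v \<in> ?S" if uv: "u \<in> ?S" "v \<in> ?S" for u v
  proof -
    obtain l m where "l \<ge> 1" "m \<ge> 1" "br \<rho> u = scale (of_nat l) u" "br \<rho> v = scale (of_nat m) v"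
      using uv by blast
    then show ?thesis using height_br[of u "int l" v "int m"] by (auto intro!: exI[of _ "l + m"])
  qed
  have "br u v \<in> span ?S" if "u \<in> span ?S" "v \<in> span ?S" for u v
    using that(1)
  proof (induction rule: span_induct_alt)
    case (step c s y)
    have "br s v \<in> span ?S"
      using that(2)
    proof (induction rule: span_induct_alt)
      case (step d s' y')
      show ?case
        using span_base[OF br_S[OF \<open>s \<in> ?S\<close> step.hyps]]
        by (simp only: br_add_right br_scale_right) (intro step.IH span_add span_scale)
    qed (simp add: span_zero)
    with step.IH show ?case by (simp add: br_add_left br_scale_left span_add span_scale)
  qed (simp add: span_zero)
  with E show ?thesis
    unfolding npos_def lie_generated_def by (intro Inter_lower) (simp add: subspace_span)
qed

text \<open>A vector of a root space inside \<open>npos\<close> is a sum of vectors of positive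
  height and an eigenvector of ad \<rho> for \<phi> \<rho>, so this value is one of those
  heights.\<close>

lemma R0_pos_\<rho>:
  assumes "\<phi> \<in> R0_pos"
  shows "\<exists>l::nat. l \<ge> 1 \<and> \<phi> \<rho> = of_nat l"
proof -
  let ?S = "{u. \<exists>l\<ge>1. br \<rho> u = scale (of_nat l) u}"
  have "weight_space 0 \<phi> \<noteq> {0}" "weight_space 0 \<phi> \<subseteq> npos" using assms by (auto simp: R0_pos_def roots_def)
  moreover have "0 \<in> weight_space 0 \<phi>" by (simp add: weight_space_def part_def \<sigma>_0)
  ultimately obtain u where u: "u \<noteq> 0" "u \<in> weight_space 0 \<phi>" "u \<in> npos" by blast
  have "u \<in> span {s \<in> ?S. br \<rho> s = scale (\<phi> \<rho>) s}"
  proof (rule eigenvector_in_span[OF lie.br_linear])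
    show "u \<in> span ?S" using u(3) npos_positive_height by blast
    show "br \<rho> u = scale (\<phi> \<rho>) u" using u(2) \<rho>_h0 by (simp add: weight_space_def)
  qed blast
  then have "\<exists>s. s \<noteq> 0 \<and> s \<in> ?S \<and> br \<rho> s = scale (\<phi> \<rho>) s"
    using u(1) span_mono[of "{s \<in> ?S. br \<rho> s = scale (\<phi> \<rho>) s}" "{0}"] by auto
  then obtain s l where "s \<noteq> 0" "l \<ge> 1" "br \<rho> s = scale (of_nat l) s" "br \<rho> s = scale (\<phi> \<rho>) s" by blast
  then show ?thesis by (intro exI[of _ l]) simp
qed

context
  fixes k assumes k: "k \<in> I" and Fk: "F k \<noteq> 0"
begin

text \<open>The value at \<rho> is 1, so vectors of this weight are combinations of basic vectors of
  height 1, and the non-zero ones among these are words in E.\<close>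

lemma restricted_root_R0_pos: "restricted_root k \<in> R0_pos"
proof -
  have "u \<in> npos" if u: "u \<in> weight_space 0 (restricted_root k)" for u
  proof -
    have "u \<in> span {s \<in> basic_vectors. br \<rho> s = scale 1 s}"
    proof (rule eigenvector_in_span[OF lie.br_linear])
      show "u \<in> span basic_vectors" by (simp add: span_basic_vectors)
      show "br \<rho> u = scale 1 u"
        using u \<rho>_h0 restricted_root_\<rho>[OF k Fk] by (simp add: weight_space_def)
    qed (use basic_vectors_height in blast)
    also have "\<dots> \<subseteq> npos"
    proof (rule span_minimal[OF _ subspace_npos], clarify)
      fix s assume s: "s \<in> basic_vectors" "br \<rho> s = scale 1 s"
      have 0: "s \<in> npos" if "s = 0" using that subspace_0[OF subspace_npos] by simp
      from s(1) consider w where "s = lie.brw F w" "w \<in> lists I" | w where "s = lie.brw E w" "w \<in> lists I" "w \<noteq> []"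
        | i where "s = H i" "i \<in> I"
        unfolding basic_vectors_def by blast
      then show "s \<in> npos"
      proof cases
        case (1 w)
        have "of_nat (Suc (length w)) \<noteq> (0::complex)" by (simp only: of_nat_eq_0_iff)
        moreover have "- scale (of_nat (length w)) s = s" using s(2) \<rho>_wordF[OF 1(2)] 1(1) by simp
        then have "s + scale (of_nat (length w)) s = 0" by (metis add.left_inverse add.commute minus_minus)
        then have "scale (of_nat (Suc (length w))) s = 0" by (simp add: scale_left_distrib)
        ultimately show ?thesis using 0 by simp
      next
        case (2 w)
        then show ?thesis using npos_brw by blast
      next
        case (3 i)
        then show ?thesis using s(2) \<rho>_H 0 by simp
      qed
    qed
    finally show ?thesis .
  qed
  moreover have "weight_space 0 (restricted_root k) \<noteq> {0}"
    using weight_space_plus[OF k Fk] E_plus_nonzero[OF k Fk] by blast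
  moreover have "restricted_root k \<rho> \<noteq> 0" by (simp add: restricted_root_\<rho>[OF k Fk])
  ultimately show ?thesis
    unfolding R0_pos_def roots_def using restricted_root_dual[OF k Fk] by blast
qed

text \<open>Height -1 leaves only the F i. The folded coroot H k + H (\<tau> k) separates F k and F
  (\<tau> k) from the other F i, and the eigenvalue of \<sigma> fixes their ratio.\<close>

lemma weight_space_neg_restricted_root:
  assumes u: "u \<in> weight_space \<epsilon> (\<lambda>b. - restricted_root k b)"
  shows "\<exists>c. u = scale c (F k + scale ((-1) ^ \<epsilon>) (F (\<tau> k)))"
proof -
  have "u \<in> span {s \<in> basic_vectors. br \<rho> s = scale (-1) s}"
  proof (rule eigenvector_in_span[OF lie.br_linear])
    show "u \<in> span basic_vectors" by (simp add: span_basic_vectors)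
    show "br \<rho> u = scale (-1) u"
      using u \<rho>_h0 restricted_root_\<rho>[OF k Fk] by (simp add: weight_space_def)
  qed (use basic_vectors_height in blast)
  also have "\<dots> \<subseteq> span (F ` I)"
  proof (rule span_minimal[OF _ subspace_span], clarify)
    fix s assume s: "s \<in> basic_vectors" "br \<rho> s = scale (-1) s"
    have 0: "s \<in> span (F ` I)" if "s = 0" using that span_zero by simp
    from s(1) consider w where "s = lie.brw F w" "w \<in> lists I" "w \<noteq> []" | w where "s = lie.brw E w" "w \<in> lists I"
      | i where "s = H i" "i \<in> I"
      unfolding basic_vectors_def by blast
    then show "s \<in> span (F ` I)"
    proof cases
      case (1 w)
      show ?thesis
      proof (cases "s = 0")
        case False
        have "scale (- of_nat (length w)) s = scale (-1) s" using s(2) \<rho>_wordF[OF 1(2)] 1(1) by simp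
        then have "- of_nat (length w) = (- 1 :: complex)" using False unfolding scale_cancel_right by blast
        then have "length w = 1" by simp
        then obtain i where "w = [i]" by (auto simp: length_Suc_conv)
        with 1 show ?thesis by (auto intro: span_base)
      qed (rule 0)
    next
      case (2 w)
      have "of_nat (Suc (length w)) \<noteq> (0::complex)" by (simp only: of_nat_eq_0_iff)
      moreover have "scale (of_nat (Suc (length w))) s = 0"
        using s(2) \<rho>_wordE[OF 2(2)] 2(1) by (simp add: scale_left_distrib)
      ultimately show ?thesis using 0 by simp
    next
      case (3 i)
      then show ?thesis using s(2) \<rho>_H 0 by simp
    qed
  qed
  finally have uF: "u \<in> span (F ` I)" .
  let ?h = "H k + H (\<tau> k)" and ?q = "\<lambda>i. complex_of_real (of_int (a k i + a (\<tau> k) i))"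
  have "?h \<in> \<h>"
    unfolding \<h>_def using k \<tau>_I[OF k] by (intro span_add span_base imageI)
  then have h: "?h \<in> h0"
    by (simp add: h0_def part_def \<sigma>_add \<sigma>_H[OF k] \<sigma>_H[OF \<tau>_I[OF k]] \<tau>_\<tau>[OF k] add.commute)
  have rh: "restricted_root k ?h = ?q k"
    by (rule restricted_root_eq[OF k Fk h])
      (simp add: br_add_left HE[OF k k] HE[OF \<tau>_I[OF k] k] scale_left_distrib)
  have "br ?h u = scale (- restricted_root k ?h) u" using u h by (simp add: weight_space_def)
  then have hu: "br ?h u = scale (- ?q k) u" unfolding rh .
  have "u \<in> span {s \<in> F ` I. br ?h s = scale (- ?q k) s}"
    by (rule eigenvector_in_span[OF lie.br_linear _ uF hu]) (use folded_HF[OF k] in blast)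
  also have "\<dots> \<subseteq> span {F k, F (\<tau> k)}"
  proof (rule span_minimal[OF _ subspace_span], clarify)
    fix i assume i: "i \<in> I" "br ?h (F i) = scale (- ?q k) (F i)"
    \<comment> \<open>For any other node i both Cartan entries are at most 0, whereas
      \<open>?q k\<close> is at least 1.\<close>
    show "F i \<in> span {F k, F (\<tau> k)}"
    proof (cases "F i = 0 \<or> i = k \<or> i = \<tau> k")
      case False
      have "scale (- ?q i) (F i) = scale (- ?q k) (F i)" using folded_HF[OF k i(1)] i(2) by metis
      then have "- ?q i = - ?q k" using False unfolding scale_cancel_right by blast
      then have "?q i = ?q k" unfolding neg_equal_iff_equal .
      then have "a k i + a (\<tau> k) i = a k k + a (\<tau> k) k" by (simp only: of_real_eq_iff of_int_eq_iff)
      moreover have "a k i \<le> 0" "a (\<tau> k) i \<le> 0" using False by (auto intro!: cartan_offdiag)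
      ultimately show ?thesis using cartan_diag[of X n k] cartan_ge[of X n "\<tau> k" k] by linarith
    qed (auto intro: span_base span_zero)
  qed
  finally obtain c d where cd: "u = scale c (F k) + scale d (F (\<tau> k))"
    by (auto simp: span_insert span_singleton algebra_simps)
  have "\<sigma> u = scale ((-1) ^ \<epsilon>) u" using u by (simp add: weight_space_def part_def)
  then have "scale ((-1) ^ \<epsilon>) (\<sigma> u) = u" by (simp flip: power_add mult_2)
  \<comment> \<open>Averaging over \<sigma> makes the coefficients of F k and F (\<tau> k) agree up
    to the sign.\<close>
  then have "scale 2 u = u + scale ((-1) ^ \<epsilon>) (\<sigma> u)" using scale_left_distrib[of 1 1 u] by simp
  also have "\<dots> = scale (c + (-1) ^ \<epsilon> * d) (F k + scale ((-1) ^ \<epsilon>) (F (\<tau> k)))"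
    by (simp add: cd \<sigma>_add \<sigma>_scale \<sigma>_F[OF k] \<sigma>_F[OF \<tau>_I[OF k]] \<tau>_\<tau>[OF k] scale_left_distrib
        scale_right_distrib algebra_simps flip: power_add mult_2)
  finally have "scale (1 / 2) (scale 2 u)
      = scale (1 / 2) (scale (c + (-1) ^ \<epsilon> * d) (F k + scale ((-1) ^ \<epsilon>) (F (\<tau> k))))"
    by simp
  then have "u = scale (1 / 2 * (c + (-1) ^ \<epsilon> * d)) (F k + scale ((-1) ^ \<epsilon>) (F (\<tau> k)))"
    by simp
  then show ?thesis by (rule exI)
qed

end

end

context twisted_KR
begin

text \<open>Both bases pair with \<open>\<rho>\<close> to positive integers, and the restricted roots pair to \<open>1\<close>.\<close>

lemma restricted_root_eq_\<alpha>:
  assumes k: "k \<in> I" "F k \<noteq> 0"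
  shows "\<exists>j\<in>{1..n}. restricted_root k = \<alpha> j"
proof -
  obtain l where l: "\<And>j. j \<in> {1..n} \<Longrightarrow> l j \<ge> 1" "\<And>j. j \<in> {1..n} \<Longrightarrow> \<alpha> j \<rho> = of_nat (l j)"
    using bchoice[of "{1..n}" "\<lambda>j l. l \<ge> 1 \<and> \<alpha> j \<rho> = of_nat l"] R0_pos_\<rho>[OF \<alpha>_pos] by blast
  have "restricted_root k \<in> nonneg_span \<alpha>" using restricted_root_R0_pos[OF k] \<alpha>_base by blast
  then obtain c where c: "restricted_root k = (\<lambda>b. \<Sum>j=1..n. of_nat (c j) * \<alpha> j b)"
    by (auto simp: nonneg_span_def)
  \<comment> \<open>A sum of natural numbers c j * l j equal to 1 with all l j >= 1 has a single
    non-zero coefficient, namely 1.\<close>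
  have "of_nat (\<Sum>j=1..n. c j * l j) = (\<Sum>j=1..n. of_nat (c j) * \<alpha> j \<rho>)"
    unfolding of_nat_sum of_nat_mult by (intro sum.cong refl) (simp only: l(2))
  also have "\<dots> = of_nat 1" using restricted_root_\<rho>[OF k] c by simp
  finally have "(\<Sum>j=1..n. c j * l j) = 1" unfolding of_nat_eq_iff .
  then obtain j where j: "j \<in> {1..n}" "c j * l j = 1" "\<And>i. i \<in> {1..n} \<Longrightarrow> i \<noteq> j \<Longrightarrow> c i * l i = 0"
    using sum_eq_1_iff[of "{1..n}" "\<lambda>j. c j * l j"] by auto
  have ci: "c i = 0" if "i \<in> {1..n}" "i \<noteq> j" for i using j(3)[OF that] l(1)[OF that(1)] by simp
  have "(\<Sum>i=1..n. of_nat (c i) * \<alpha> i b) = \<alpha> j b" for b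
  proof -
    have "(\<Sum>i=1..n. of_nat (c i) * \<alpha> i b) = (\<Sum>i=1..n. if i = j then \<alpha> j b else 0)"
      using ci j(2) by (intro sum.cong refl) (auto simp del: atLeastAtMost_iff)
    then show ?thesis using j(1) by simp
  qed
  then show ?thesis using c j(1) by auto
qed

text \<open>Links the vectors of the presentation to the Chevalley generators of \<g>, with the same
  \<open>j\<close> for both signs; if F k = 0 the scalars are zero.\<close>

lemma simple_root_vectors:
  assumes k: "k \<in> I" and n: "n \<ge> 1"
  shows "\<exists>j\<in>{1..n}. \<exists>c d. F k + F (\<tau> k) = scale c (x j) \<and> F k - F (\<tau> k) = scale d (y j)"
proof (cases "F k = 0")
  case True
  then have "F (\<tau> k) = 0" using \<sigma>_F[OF k] \<sigma>_0 by simp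
  then show ?thesis using True n by (intro bexI[of _ 1] exI[of _ 0]) simp_all
next
  case False
  obtain j where j: "j \<in> {1..n}" "restricted_root k = \<alpha> j" using restricted_root_eq_\<alpha>[OF k False] by blast
  note ws = weight_space_neg_restricted_root[OF k False, unfolded j(2)]
  have inv: "\<exists>c. v = scale c u" if "u = scale c v" "u \<noteq> 0" for u v c
    using that by (intro exI[of _ "inverse c"]) auto
  have "\<exists>c. F k + F (\<tau> k) = scale c (x j)"
    using ws[of "x j" 0] x[OF j(1)] inv by auto
  moreover have "\<exists>d. F k - F (\<tau> k) = scale d (y j)"
  proof (cases "F k - F (\<tau> k) = 0")
    case True
    then show ?thesis by (intro exI[of _ 0]) simp
  next
    case nz: False
    have "\<alpha> j \<in> R0_pos" by (rule \<alpha>_pos[OF j(1)])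
    \<comment> \<open>The non-zero vector E k - E (\<tau> k) shows that \<alpha> j is a weight of
      \<g>_1, so y j is a non-zero root vector.\<close>
    moreover have "weight_space 1 (\<alpha> j) \<noteq> {0}"
      using weight_space_minus[OF k False] E_minus_nonzero[OF k nz] j(2) by auto
    ultimately have "\<alpha> j \<in> roots 1 \<inter> nonneg_span \<alpha>" using \<alpha>_base by (auto simp: R0_pos_def roots_def)
    from y[OF j(1) this] ws[of "y j" 1] inv show ?thesis by auto
  qed
  ultimately show ?thesis using j(1) by blast
qed

end

section \<open>The current algebra\<close>

context twisted_lie_algebra
begin

lemma coeff_current_scale [simp]: "coeff (current_scale c p) k = scale c (coeff p k)"
  by (simp add: current_scale_def coeff_map_poly)

sublocale current: vector_space current_scale
  by unfold_locales (auto intro!: poly_eqI simp: scale_right_distrib scale_left_distrib)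

lemma current_scale_monom: "current_scale c (monom u k) = monom (scale c u) k"
  by (rule poly_eqI) simp

text \<open>A common bound on both degrees turns bilinearity into a termwise statement.\<close>

lemma current_br_eq_sum:
  assumes "degree p \<le> K" "degree q \<le> K"
  shows "current_br p q = (\<Sum>k\<le>K. \<Sum>l\<le>K. monom (br (coeff p k) (coeff q l)) (k + l))"
proof -
  have "(\<Sum>l\<le>degree q. monom (br (coeff p k) (coeff q l)) (k + l))
      = (\<Sum>l\<le>K. monom (br (coeff p k) (coeff q l)) (k + l))" for k
    using assms(2) by (intro sum.mono_neutral_left) (auto simp: coeff_eq_0)
  then have "current_br p q = (\<Sum>k\<le>degree p. \<Sum>l\<le>K. monom (br (coeff p k) (coeff q l)) (k + l))"
    by (simp add: current_br_def)
  also have "\<dots> = (\<Sum>k\<le>K. \<Sum>l\<le>K. monom (br (coeff p k) (coeff q l)) (k + l))"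
    using assms(1) by (intro sum.mono_neutral_left) (auto simp: coeff_eq_0)
  finally show ?thesis .
qed

lemma current_br_add_left: "current_br (p + p') q = current_br p q + current_br p' q"
proof -
  define K where "K = max (degree p) (max (degree p') (degree q))"
  have "degree (p + p') \<le> K" "degree p \<le> K" "degree p' \<le> K" "degree q \<le> K"
    using degree_add_le_max[of p p'] by (auto simp: K_def)
  then show ?thesis
    by (simp add: current_br_eq_sum[of _ K] br_add_left add_monom[symmetric] sum.distrib)
qed

lemma current_br_add_right: "current_br q (p + p') = current_br q p + current_br q p'"
proof -
  define K where "K = max (degree p) (max (degree p') (degree q))"
  have "degree (p + p') \<le> K" "degree p \<le> K" "degree p' \<le> K" "degree q \<le> K"
    using degree_add_le_max[of p p'] by (auto simp: K_def)
  then show ?thesis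
    by (simp add: current_br_eq_sum[of _ K] br_add_right add_monom[symmetric] sum.distrib)
qed

lemma degree_current_scale_le: "degree (current_scale c p) \<le> degree p"
  by (rule degree_le) (simp add: coeff_eq_0)

lemma current_br_scale_left: "current_br (current_scale c p) q = current_scale c (current_br p q)"
proof -
  define K where "K = max (degree p) (degree q)"
  have "degree (current_scale c p) \<le> K" "degree p \<le> K" "degree q \<le> K"
    using degree_current_scale_le[of c p] by (auto simp: K_def)
  then show ?thesis
    by (simp add: current_br_eq_sum[of _ K] br_scale_left current_scale_monom[symmetric] current.scale_sum_right)
qed

lemma current_br_scale_right: "current_br p (current_scale c q) = current_scale c (current_br p q)"
proof -
  define K where "K = max (degree p) (degree q)"
  have "degree (current_scale c q) \<le> K" "degree p \<le> K" "degree q \<le> K"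
    using degree_current_scale_le[of c q] by (auto simp: K_def)
  then show ?thesis
    by (simp add: current_br_eq_sum[of _ K] br_scale_right current_scale_monom[symmetric] current.scale_sum_right)
qed

lemma current_br_monom: "current_br (monom u k) (monom v l) = monom (br u v) (k + l)"
proof -
  have "current_br (monom u k) (monom v l) = (\<Sum>i\<le>max k l. \<Sum>j\<le>max k l.
      monom (br (if k = i then u else 0) (if l = j then v else 0)) (i + j))"
    using degree_monom_le[of u k] degree_monom_le[of v l]
    by (subst current_br_eq_sum[of _ "max k l"]) auto
  also have "\<dots> = (\<Sum>i\<le>max k l. \<Sum>j\<le>max k l. if j = l then (if i = k then monom (br u v) (i + j) else 0) else 0)"
    by (intro sum.cong refl) auto
  also have "\<dots> = monom (br u v) (k + l)" by (simp add: sum.delta)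
  finally show ?thesis .
qed

lemma current_poly_induct [case_names 0 monom]:
  assumes "P 0" "\<And>u k p. P p \<Longrightarrow> P (monom u k + p)"
  shows "P (p :: 'a poly)"
proof -
  have "P (\<Sum>k\<in>A. monom (coeff p k) k)" if "finite A" for A
    using that by (induction A rule: finite_induct) (simp_all add: assms)
  from this[of "{..degree p}"] show ?thesis by (simp add: poly_as_sum_of_monoms)
qed

lemma current_br_0: "current_br 0 p = 0" "current_br p 0 = 0"
  using current_br_add_left[of 0 0 p] current_br_add_right[of p 0 0] by simp_all

text \<open>Antisymmetry and the Jacobi identity are additive in each argument and reduce to
  monomials; antisymmetry then removes the cross terms of [p, p].\<close>

sublocale current: lie_algebra current_scale current_br
proof unfold_locales
  have anti: "current_br p q = - current_br q p" for p q
  proof (induction p rule: current_poly_induct)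
    case (monom u k p)
    have "current_br (monom u k) q = - current_br q (monom u k)"
      by (induction q rule: current_poly_induct)
        (simp_all add: current_br_0 current_br_add_left current_br_add_right current_br_monom
          lie.br_anti[of u] minus_monom add.commute)
    with monom show ?case by (simp add: current_br_add_left current_br_add_right)
  qed (simp add: current_br_0)
  show "current_br p p = 0" for p
  proof (induction p rule: current_poly_induct)
    case (monom u k p)
    then show ?case
      using anti[of p "monom u k"]
      by (simp add: current_br_add_left current_br_add_right current_br_monom br_self)
  qed (simp add: current_br_0)
  show "current_br p (current_br q r) + current_br q (current_br r p) + current_br r (current_br p q) = 0" for p q r
  proof (induction p rule: current_poly_induct)
    case (monom u k p)
    have "current_br (monom u k) (current_br q r) + current_br q (current_br r (monom u k))
        + current_br r (current_br (monom u k) q) = 0"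
    proof (induction q rule: current_poly_induct)
      case (monom v l q)
      have "current_br (monom u k) (current_br (monom v l) r) + current_br (monom v l) (current_br r (monom u k))
        + current_br r (current_br (monom u k) (monom v l)) = 0"
      proof (induction r rule: current_poly_induct)
        case (monom w m r)
        have "current_br (monom u k) (current_br (monom v l) (monom w m))
          + current_br (monom v l) (current_br (monom w m) (monom u k))
          + current_br (monom w m) (current_br (monom u k) (monom v l))
          = monom (br u (br v w) + br v (br w u) + br w (br u v)) (k + l + m)"
          by (simp add: current_br_monom add_monom[symmetric] ac_simps)
        also have "\<dots> = 0" by (simp add: jacobi)
        finally have "current_br (monom u k) (current_br (monom v l) (monom w m))
          + current_br (monom v l) (current_br (monom w m) (monom u k))
          + current_br (monom w m) (current_br (monom u k) (monom v l)) = 0" .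
        from arg_cong2[OF this monom, of "(+)"] show ?case
          by (simp only: current_br_add_left current_br_add_right add_0_left ac_simps)
      qed (simp add: current_br_0)
      from arg_cong2[OF this monom, of "(+)"] show ?case
        by (simp only: current_br_add_left current_br_add_right add_0_left ac_simps)
    qed (simp add: current_br_0)
    from arg_cong2[OF this monom, of "(+)"] show ?case
      by (simp only: current_br_add_left current_br_add_right add_0_left ac_simps)
  qed (simp add: current_br_0)
qed (rule current_br_add_left current_br_add_right current_br_scale_left current_br_scale_right)+

lemma current_funpow_monom: "(current_br (monom u k) ^^ m) (monom v l) = monom ((br u ^^ m) v) (m * k + l)"
  by (induction m) (simp_all add: current_br_monom algebra_simps)

lemma current_ad_nilpotent:
  assumes "locally_nilpotent (br u)"
  shows "locally_nilpotent (current_br (monom u k))"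
  unfolding locally_nilpotent_def
proof
  fix p
  show "\<exists>m. (current_br (monom u k) ^^ m) p = 0"
  proof (induction p rule: current_poly_induct)
    case 0
    show ?case by (intro exI[of _ 0]) simp
  next
    case (monom v l p)
    then obtain m where m: "(current_br (monom u k) ^^ m) p = 0" by blast
    obtain m' where "(br u ^^ m') v = 0" using assms by (auto simp: locally_nilpotent_def)
    then have "(current_br (monom u k) ^^ m') (monom v l) = 0" by (simp add: current_funpow_monom)
    then have "(current_br (monom u k) ^^ (m + m')) (monom v l + p) = 0"
      using current.funpow_br_le[OF m, of "m + m'"]
        current.funpow_br_le[of m' "monom u k" "monom v l" "m + m'"]
      by (simp add: current.funpow_br_add)
    then show ?case by blast
  qed
qed

lemma part_br:
  assumes "u \<in> part UNIV \<epsilon>" "v \<in> part UNIV \<delta>" "(\<epsilon> + \<delta>) mod 2 = \<theta> mod 2"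
  shows "br u v \<in> part UNIV \<theta>"
proof -
  have "(-1 :: complex) ^ (\<epsilon> + \<delta>) = (-1) ^ \<theta>"
    using assms(3) by (metis mod_mod_trivial neg_one_even_power neg_one_odd_power even_iff_mod_2_eq_zero)
  then show ?thesis using assms(1,2)
    by (simp add: part_def \<sigma>_br br_scale_left br_scale_right power_add mult.commute)
qed

lemma monom_twisted_current:
  assumes "subspace A"
  shows "monom u k \<in> twisted_current A \<longleftrightarrow> u \<in> part A (k mod 2)"
  using subspace_0[OF subspace_part[OF assms]] by (auto simp: twisted_current_def)

lemma subspace_twisted_current:
  assumes "subspace A"
  shows "current.subspace (twisted_current A)"
proof -
  note [simp] = subspace_0[OF subspace_part[OF assms]]
  show ?thesis
    by (rule current.subspaceI)
      (auto simp: twisted_current_def intro!: subspace_add[OF subspace_part[OF assms]] subspace_scale[OF subspace_part[OF assms]])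
qed

lemma twisted_current_br:
  assumes "p \<in> twisted_current UNIV" "q \<in> twisted_current UNIV"
  shows "current_br p q \<in> twisted_current UNIV"
  unfolding current_br_def
proof (intro current.subspace_sum subspace_twisted_current subspace_UNIV)
  fix k l
  show "monom (br (coeff p k) (coeff q l)) (k + l) \<in> twisted_current UNIV"
    unfolding monom_twisted_current[OF subspace_UNIV] using assms
    by (intro part_br[of _ "k mod 2" _ "l mod 2"]) (auto simp: twisted_current_def mod_add_eq)
qed

text \<open>Twice the projection onto the eigenspace \<open>\<g>\<^sub>\<epsilon>\<close>, for \<open>\<epsilon>\<close> modulo 2.\<close>

definition eig :: "nat \<Rightarrow> 'a \<Rightarrow> 'a" where
  "eig \<epsilon> u = u + scale ((-1) ^ \<epsilon>) (\<sigma> u)"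

lemma eig_add: "eig \<epsilon> (u + v) = eig \<epsilon> u + eig \<epsilon> v"
  and eig_scale: "eig \<epsilon> (scale c u) = scale c (eig \<epsilon> u)"
  by (simp_all add: eig_def \<sigma>_add \<sigma>_scale scale_right_distrib mult.commute)

lemma eig_part: "eig \<epsilon> u \<in> part UNIV \<epsilon>"
  by (simp add: part_def eig_def \<sigma>_add \<sigma>_scale \<sigma>_\<sigma> scale_right_distrib add.commute flip: power_add mult_2)

lemma eig_of_part: "u \<in> part UNIV \<epsilon> \<Longrightarrow> eig \<epsilon> u = scale 2 u"
  using scale_left_distrib[of 1 1 u] by (simp add: part_def eig_def flip: power_add mult_2)

text \<open>Four times the splitting of a component of [u, v] by the components of u and v.\<close>

lemma eig_br: "scale 2 (eig \<epsilon> (br u v)) =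
    br (eig 0 u) (eig \<epsilon> v) + br (eig 1 u) (eig (Suc \<epsilon>) v)"
proof -
  have "scale 2 z = z + z" "scale (2 * (-1) ^ \<epsilon>) z = scale ((-1) ^ \<epsilon>) z + scale ((-1) ^ \<epsilon>) z" for z
    using scale_left_distrib[of 1 1 z] scale_left_distrib[of "(-1) ^ \<epsilon>" "(-1) ^ \<epsilon>" z] by simp_all
  then show ?thesis
    by (simp add: eig_def \<sigma>_br lie.br_diff_left lie.br_diff_right lie.br_minus_right lie.br_minus_left br_add_left br_add_right
        br_scale_right scale_right_distrib algebra_simps)
qed

end

section \<open>Cyclic modules as representations\<close>

lemma (in vector_space) finite_subset_span:
  assumes "x \<in> span S"
  shows "\<exists>T. finite T \<and> T \<subseteq> S \<and> x \<in> span T"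
proof -
  obtain T r where "finite T" "T \<subseteq> S" "x = (\<Sum>a\<in>T. scale (r a) a)"
    using assms unfolding span_explicit by blast
  then show ?thesis by (intro exI[of _ T]) (auto intro: span_sum span_scale span_base)
qed

context lie_representation
begin

text \<open>By \<open>div_pow_act\<close>, a^(d + k) b u is a combination of terms (ad a)^j(b) a^(d
  + k - j) u; either j >= d, or at least k powers of \<open>a\<close> reach u.\<close>

lemma locally_nilpotent_at_word:
  assumes a: "a \<in> L" "locally_nilpotent (br a)" "(act a ^^ m) v = 0" and w: "w \<in> lists L"
  shows "\<exists>k. (act a ^^ k) (foldr act w v) = 0"
  using w
proof (induction w rule: list.induct)
  case Nil
  show ?case using a(3) by auto
next
  case (Cons b w)
  then have b: "b \<in> L" "w \<in> lists L" by auto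
  let ?u = "foldr act w v"
  obtain k where k: "(act a ^^ k) ?u = 0" using Cons.IH[OF b(2)] by blast
  obtain d where d: "(br a ^^ d) b = 0" using a(2) by (auto simp: locally_nilpotent_def)
  have "act (div_ad a j b) (div_pow a (d + k - j) ?u) = 0" for j
  proof (cases "d \<le> j")
    case True
    then show ?thesis using funpow_br_le[OF d True] by (simp add: div_ad_def act_0_left)
  next
    case False
    then have "(act a ^^ (d + k - j)) ?u = 0"
      by (intro linear_funpow_mono[OF act_linear[OF a(1)] k]) simp
    then show ?thesis by (simp add: div_pow_def act_right(3) div_ad_L a(1) b(1))
  qed
  then have "div_pow a (d + k) (act b ?u) = 0" by (simp add: div_pow_act a(1) b(1))
  then show ?case by (auto simp: div_pow_def)
qed

text \<open>
  The space need not be generated by \<open>v\<close>: it is enough that every vector agrees with a generated one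
  modulo vectors killed by \<open>L\<close>.
\<close>

definition cyclic_vector :: "'v \<Rightarrow> bool" where
  "cyclic_vector v \<longleftrightarrow> (\<forall>u. \<exists>u'\<in>V.span {foldr act w v | w. w \<in> lists L}. \<forall>a\<in>L. act a u = act a u')"

lemma locally_nilpotent_from_generator:
  assumes v: "cyclic_vector v" and a: "a \<in> L" "locally_nilpotent (br a)" "(act a ^^ m) v = 0"
  shows "locally_nilpotent (act a)"
  unfolding locally_nilpotent_def
proof
  fix u
  obtain u' where u': "u' \<in> V.span {foldr act w v | w. w \<in> lists L}" "act a u = act a u'"
    using v a(1) unfolding cyclic_vector_def by blast
  have "\<exists>k. (act a ^^ k) u' = 0"
    using u'(1)
  proof (induction rule: V.span_induct_alt)
    case base
    show ?case by (intro exI[of _ 0]) simp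
  next
    case (step c x y)
    obtain k where k: "(act a ^^ k) y = 0" using step.IH by blast
    obtain l where l: "(act a ^^ l) x = 0"
      using step.hyps locally_nilpotent_at_word[OF a] by blast
    interpret Vector_Spaces.linear vsc vsc "act a ^^ (k + l)" by (rule linear_funpow[OF act_linear[OF a(1)]])
    have "(act a ^^ (k + l)) (vsc c x + y) = 0"
      using linear_funpow_mono[OF act_linear[OF a(1)] k, of "k + l"]
        linear_funpow_mono[OF act_linear[OF a(1)] l, of "k + l"]
      by (simp add: add scale)
    then show ?case by blast
  qed
  then obtain k where "(act a ^^ k) u' = 0" by blast
  then have "(act a ^^ Suc k) u' = 0" by (simp add: act_right(3) a(1))
  \<comment> \<open>The first application of \<open>a\<close> exchanges u for u', hence one power
    more.\<close>
  then have "(act a ^^ Suc k) u = 0" by (simp only: funpow_Suc_right o_apply u'(2))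
  then show "\<exists>k. (act a ^^ k) u = 0" by blast
qed

text \<open>Moving \<open>a\<close> past a letter \<open>b\<close> costs [a, b], which lies in J
  again.\<close>

lemma annihilating_ideal:
  assumes J: "J \<subseteq> L" "\<And>a b. a \<in> J \<Longrightarrow> b \<in> L \<Longrightarrow> br a b \<in> J"
    and v: "cyclic_vector v" "\<And>a. a \<in> J \<Longrightarrow> act a v = 0" and a: "a \<in> J"
  shows "act a u = 0"
proof -
  have word: "\<forall>a\<in>J. act a (foldr act w v) = 0" if "w \<in> lists L" for w
    using that
  proof (induction w rule: list.induct)
    case (Cons b w)
    then have b: "b \<in> L" "w \<in> lists L" by auto
    show ?case
    proof
      fix a assume a: "a \<in> J"
      have "act a (act b (foldr act w v)) = act (br a b) (foldr act w v) + act b (act a (foldr act w v))"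
        using act_br[of a b "foldr act w v"] a b(1) J(1) by auto
      then show "act a (foldr act (b # w) v) = 0"
        using Cons.IH[OF b(2)] a J(2)[OF a b(1)] by (simp add: act_right(3)[OF b(1)])
    qed
  qed (simp add: v(2))
  obtain u' where u': "u' \<in> V.span {foldr act w v | w. w \<in> lists L}" "act a u = act a u'"
    using v(1) a J(1) unfolding cyclic_vector_def by blast
  have "act a u' = 0"
    using u'(1)
  proof (induction rule: V.span_induct_alt)
    case base
    show ?case using a J(1) by (auto intro: act_right(3))
  next
    case (step c x y)
    have "a \<in> L" using a J(1) by blast
    then show ?case using step word a by (auto simp: act_right)
  qed
  then show ?thesis by (simp add: u'(2))
qed

text \<open>Modulo J, which acts by zero, finitely many nilpotent elements span L. Their commutators
  lie in L and so act as combinations of them, which is the condition of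
  \<open>words_in_finite_span\<close>.\<close>

lemma finite_generation:
  assumes nil: "L \<subseteq> span nil_elements"
    and J: "J \<subseteq> L" "\<And>a u. a \<in> J \<Longrightarrow> act a u = 0"
    and G: "finite G" "G \<subseteq> L" "L \<subseteq> span (G \<union> J)"
  shows "\<exists>B. finite B \<and> (\<forall>w\<in>lists L. foldr act w v \<in> V.span B)"
proof -
  have "\<forall>g\<in>G. \<exists>T. finite T \<and> T \<subseteq> nil_elements \<and> g \<in> span T"
    using G(2) nil finite_subset_span by blast
  then obtain T where T: "\<And>g. g \<in> G \<Longrightarrow> finite (T g) \<and> T g \<subseteq> nil_elements \<and> g \<in> span (T g)"
    by metis
  define P where "P = (\<Union>g\<in>G. T g)"
  have P: "finite P" "P \<subseteq> nil_elements" using T G(1) by (auto simp: P_def)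
  have "span (G \<union> J) \<subseteq> span (P \<union> J)"
  proof (rule span_minimal[OF _ subspace_span], rule Un_least)
    show "G \<subseteq> span (P \<union> J)"
    proof
      fix g assume g: "g \<in> G"
      then have "g \<in> span (T g)" using T by blast
      moreover have "T g \<subseteq> P \<union> J" using g by (auto simp: P_def)
      ultimately show "g \<in> span (P \<union> J)" using span_mono by blast
    qed
    show "J \<subseteq> span (P \<union> J)" by (auto intro: span_base)
  qed
  then have LP: "L \<subseteq> span (P \<union> J)" using G(3) by blast
  obtain X d where X: "P = X ` {..<d::nat}"
    using P(1) by (metis finite_imp_nat_seg_image_inj_on lessThan_def)
  have XL: "X i \<in> L" "locally_nilpotent (act (X i))" if "i < d" for i
    using P(2) that by (auto simp: X nil_elements_def)
  have act_span: "act a u \<in> V.span ((\<lambda>k. act (X k) u) ` {..<d})" if "a \<in> L" for a u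
  proof -
    have "a \<in> span (P \<union> J)" using LP that by blast
    then have "a \<in> L \<and> act a u \<in> V.span ((\<lambda>k. act (X k) u) ` {..<d})"
    proof (induction rule: span_induct_alt)
      case base
      show ?case by (simp add: act_0_left subspace_0[OF L_subspace] V.span_zero)
    next
      case (step c x y)
      have x: "x \<in> L" using step.hyps P(2) J(1) by (auto simp: nil_elements_def)
      have "act x u \<in> V.span ((\<lambda>k. act (X k) u) ` {..<d})"
        using step.hyps J(2) by (auto simp: X V.span_zero intro: V.span_base)
      then show ?case
        using x step.IH by (auto simp: act_add_left act_scale_left subspace_add[OF L_subspace]
            subspace_scale[OF L_subspace] intro!: V.span_add V.span_scale)
    qed
    then show ?thesis by blast
  qed
  obtain B where B: "finite B" "\<And>w. set w \<subseteq> {..<d} \<Longrightarrow> foldr (\<lambda>k. act (X k)) w v \<in> V.span B"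
    using V.words_in_finite_span[of d "\<lambda>k. act (X k)" v] XL act_linear act_span L_br
    by (metis (no_types, lifting) act_br)
  \<comment> \<open>Stable under each \<open>X k\<close>, hence under all of L, so that it contains
    every word over L applied to v.\<close>
  let ?U = "V.span {foldr (\<lambda>k. act (X k)) w v | w. set w \<subseteq> {..<d}}"
  have XU: "act (X k) u \<in> ?U" if "k < d" "u \<in> ?U" for k u
    using that(2)
  proof (induction rule: V.span_induct_alt)
    case base
    show ?case by (simp add: act_right(3) XL that(1) V.span_zero)
  next
    case (step c x y)
    obtain w where w: "x = foldr (\<lambda>k. act (X k)) w v" "set w \<subseteq> {..<d}" using step.hyps by blast
    then have "act (X k) x = foldr (\<lambda>k. act (X k)) (k # w) v" "set (k # w) \<subseteq> {..<d}"
      using that(1) by simp_all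
    then have "act (X k) x \<in> ?U" by (intro V.span_base) blast
    with step.IH show ?case by (simp add: act_right XL that(1) V.span_add V.span_scale)
  qed
  have "foldr act w v \<in> ?U" if "w \<in> lists L" for w
    using that
  proof (induction w rule: list.induct)
    case Nil
    have "foldr (\<lambda>k. act (X k)) [] v \<in> {foldr (\<lambda>k. act (X k)) w v | w. set w \<subseteq> {..<d}}"
      by (intro CollectI exI[of _ "[]"]) simp
    from V.span_base[OF this] show ?case by simp
  next
    case (Cons b w)
    then have b: "b \<in> L" "w \<in> lists L" by auto
    have "(\<lambda>k. act (X k) (foldr act w v)) ` {..<d} \<subseteq> ?U"
      using XU Cons.IH[OF b(2)] by blast
    then have "V.span ((\<lambda>k. act (X k) (foldr act w v)) ` {..<d}) \<subseteq> ?U"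
      by (rule V.span_minimal) (rule V.subspace_span)
    then show ?case using act_span[OF b(1)] by auto
  qed
  moreover have "?U \<subseteq> V.span B"
    using B(2) by (intro V.span_minimal V.subspace_span) blast
  ultimately show ?thesis using B(1) by blast
qed

end

section \<open>Realisation of a cyclic module on the space of words\<close>

lemma keys_subset_span_words:
  assumes "Poly_Mapping.keys p \<subseteq> A"
  shows "p \<in> words.span (word ` A)"
proof -
  have "p = (\<Sum>z\<in>Poly_Mapping.keys p. wscale (Poly_Mapping.lookup p z) (word z))"
    by (rule poly_mapping_eqI)
      (simp add: wscale_single lookup_sum lookup_single when_def sum.delta' in_keys_iff)
  also have "\<dots> \<in> words.span (word ` A)"
    using assms by (intro words.span_sum words.span_scale words.span_base) auto
  finally show ?thesis .
qed

lemma subspace_keys: "words.subspace {p :: 'l list \<Rightarrow>\<^sub>0 complex. Poly_Mapping.keys p \<subseteq> A}"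
proof (rule words.subspaceI)
  fix p q :: "'l list \<Rightarrow>\<^sub>0 complex"
  assume "p \<in> {p. Poly_Mapping.keys p \<subseteq> A}" "q \<in> {p. Poly_Mapping.keys p \<subseteq> A}"
  then show "p + q \<in> {p. Poly_Mapping.keys p \<subseteq> A}" using Poly_Mapping.keys_add[of p q] by blast
next
  fix p :: "'l list \<Rightarrow>\<^sub>0 complex" and c
  assume "p \<in> {p. Poly_Mapping.keys p \<subseteq> A}"
  then show "wscale c p \<in> {p. Poly_Mapping.keys p \<subseteq> A}" using keys_wscale[of c p] by blast
qed simp

lemma keys_sandwich: "Poly_Mapping.keys (sandwich u p w) \<subseteq> (\<lambda>z. u @ z @ w) ` Poly_Mapping.keys p"
proof -
  have "sandwich u p w \<in> {q. Poly_Mapping.keys q \<subseteq> (\<lambda>z. u @ z @ w) ` Poly_Mapping.keys p}"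
    unfolding sandwich_def by (intro words.subspace_sum[OF subspace_keys]) auto
  then show ?thesis by simp
qed

lemma sandwich_linear: "Vector_Spaces.linear wscale wscale (\<lambda>p. sandwich u p w)"
  by (rule Vector_Spaces.linear_iff[THEN iffD2])
    (simp add: sandwich_add sandwich_wscale words.vector_space_axioms)

lemma (in lie_algebra) relation_space_subset:
  assumes L: "subspace L" "\<And>a b. a \<in> L \<Longrightarrow> b \<in> L \<Longrightarrow> br a b \<in> L"
    and S: "\<And>s. s \<in> S \<Longrightarrow> Poly_Mapping.keys s \<subseteq> lists L"
  shows "relation_space sc br L S \<subseteq> {p. Poly_Mapping.keys p \<subseteq> lists L}"
  unfolding relation_space_def
proof (rule words.span_minimal[OF _ subspace_keys], rule Un_least)
  have w: "word z \<in> {p. Poly_Mapping.keys p \<subseteq> lists L}" if "z \<in> lists L" for z using that by simp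
  have r: "r \<in> {p. Poly_Mapping.keys p \<subseteq> lists L}" if "r \<in> enveloping_relations sc br L" for r
    using that unfolding enveloping_relations_def
    by (elim UnE CollectE exE conjE; hypsubst; intro words.subspace_diff[OF subspace_keys]
        words.subspace_scale[OF subspace_keys] w)
      (auto intro: subspace_add[OF L(1)] subspace_scale[OF L(1)] L(2))
  show "{sandwich u r w | u r w. u \<in> lists L \<and> w \<in> lists L \<and> r \<in> enveloping_relations sc br L}
      \<subseteq> {p. Poly_Mapping.keys p \<subseteq> lists L}"
    using r keys_sandwich by fastforce
  show "{sandwich u s [] | u s. u \<in> lists L \<and> s \<in> S} \<subseteq> {p. Poly_Mapping.keys p \<subseteq> lists L}"
    using S keys_sandwich by fastforce
qed

text \<open>
  A projection \<open>\<pi>\<close> with kernel \<open>N\<close> on the words over \<open>L\<close> identifies the cyclic module with a subspace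
  of the space of words, so that \<open>L\<close> acts on a whole type.
\<close>

lemma (in lie_algebra) cyclic_module_representation:
  assumes L: "subspace L" "\<And>a b. a \<in> L \<Longrightarrow> b \<in> L \<Longrightarrow> br a b \<in> L"
    and S: "\<And>s. s \<in> S \<Longrightarrow> Poly_Mapping.keys s \<subseteq> lists L"
  defines "N \<equiv> relation_space sc br L S" and "W \<equiv> {p. Poly_Mapping.keys p \<subseteq> lists L}"
  obtains \<pi> where "Vector_Spaces.linear wscale wscale \<pi>" "\<And>p. p \<in> N \<Longrightarrow> \<pi> p = 0" "\<And>p. \<pi> p \<in> W"
    "\<And>p. p \<in> W \<Longrightarrow> p - \<pi> p \<in> N"
    "lie_representation sc br wscale L (\<lambda>a p. \<pi> (sandwich [a] (\<pi> p) []))"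
    "\<And>w. w \<in> lists L \<Longrightarrow> foldr (\<lambda>a p. \<pi> (sandwich [a] (\<pi> p) [])) w (\<pi> (word [])) = \<pi> (word w)"
    "lie_representation.cyclic_vector wscale L (\<lambda>a p. \<pi> (sandwich [a] (\<pi> p) [])) (\<pi> (word []))"
proof -
  have NW: "N \<subseteq> W" unfolding N_def W_def by (rule relation_space_subset[OF L S])
  have W: "words.subspace W" unfolding W_def by (rule subspace_keys)
  have N: "words.subspace N" unfolding N_def by (rule relation_space_subspace)
  obtain B0 where B0: "B0 \<subseteq> N" "words.independent B0" "N \<subseteq> words.span B0"
    using words.maximal_independent_subset[of N] by blast
  obtain B where B: "B0 \<subseteq> B" "B \<subseteq> W" "words.independent B" "W \<subseteq> words.span B"
    using words.maximal_independent_subset_extend[of B0 W] B0 NW by blast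
  \<comment> \<open>The projection kills the basis \<open>B0\<close> of \<open>N\<close> and fixes
    the remaining basis vectors of \<open>W\<close>; prescribing its range keeps \<pi> p in
    \<open>W\<close> even for p outside \<open>W\<close>.\<close>
  define f where "f x = (if x \<in> B0 then 0 else x)" for x :: "'l list \<Rightarrow>\<^sub>0 complex"
  interpret vector_space_pair wscale wscale by unfold_locales
  obtain \<pi> where \<pi>: "Vector_Spaces.linear wscale wscale \<pi>" "\<forall>x\<in>B. \<pi> x = f x" "range \<pi> = words.span (f ` B)"
    using linear_independent_extend_subspace[OF B(3), of f] by blast
  interpret \<pi>: Vector_Spaces.linear wscale wscale \<pi> by (rule \<pi>(1))
  have \<pi>N: "\<pi> p = 0" if "p \<in> N" for p
  proof -
    have "p \<in> words.span B0" using that B0(3) by blast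
    then show ?thesis
    proof (induction rule: words.span_induct_alt)
      case (step c x y)
      have "\<pi> x = 0" using \<pi>(2) step.hyps B(1) by (auto simp: f_def)
      with step.IH show ?case by (simp add: \<pi>.add \<pi>.scale)
    qed (simp add: \<pi>.zero)
  qed
  have \<pi>W: "\<pi> p \<in> W" for p
  proof -
    have "f ` B \<subseteq> W" using B(2) words.subspace_0[OF W] by (auto simp: f_def)
    then have "words.span (f ` B) \<subseteq> W" by (rule words.span_minimal[OF _ W])
    then show ?thesis using \<pi>(3) by blast
  qed
  have \<pi>d: "p - \<pi> p \<in> N" if "p \<in> W" for p
  proof -
    have "p \<in> words.span B" using that B(4) by blast
    then show ?thesis
    proof (induction rule: words.span_induct_alt)
      case base
      show ?case using words.subspace_0[OF N] by (simp add: \<pi>.zero)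
    next
      case (step c x y)
      have "x - \<pi> x \<in> N" using \<pi>(2) step.hyps B0(1) words.subspace_0[OF N] by (auto simp: f_def)
      then have "wscale c (x - \<pi> x) + (y - \<pi> y) \<in> N"
        by (rule words.subspace_add[OF N words.subspace_scale[OF N] step.IH])
      then show ?case by (simp add: \<pi>.add \<pi>.scale words.scale_right_diff_distrib algebra_simps)
    qed
  qed
  have \<pi>eq: "\<pi> p = \<pi> q" if "p - q \<in> N" for p q
    using \<pi>N[OF that] by (simp add: \<pi>.diff)
  have sW: "sandwich [a] p [] \<in> W" if "a \<in> L" "p \<in> W" for a p
    using that keys_sandwich[of "[a]" p "[]"] unfolding W_def by fastforce
  have sN: "sandwich [a] p [] \<in> N" if "a \<in> L" "p \<in> N" for a p
    using that unfolding N_def by (rule sandwich_relation_space)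
  have \<pi>s: "\<pi> (sandwich [a] (\<pi> p) []) = \<pi> (sandwich [a] p [])" if "a \<in> L" "p \<in> W" for a p
    using sN[OF that(1) \<pi>d[OF that(2)]] by (intro \<pi>eq[symmetric]) (simp add: sandwich_minus)
  have \<pi>\<pi>: "\<pi> (\<pi> p) = \<pi> p" if "p \<in> W" for p
    using \<pi>d[OF that] by (intro \<pi>eq[symmetric])
  \<comment> \<open>The inner \<pi> brings an arbitrary combination of words into \<open>W\<close>,
    where the relations of the enveloping algebra hold modulo \<open>N\<close>.\<close>
  let ?act = "\<lambda>a p. \<pi> (sandwich [a] (\<pi> p) [])"
  have car: "rel_coset N p \<in> carrier (cyclic_module sc br L S)" if "p \<in> W" for p
    using that by (auto simp: cyclic_module_simps N_def W_def)
  have rep: "lie_representation sc br wscale L ?act"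
  proof (intro lie_representation.intro lie_representation_axioms.intro
      lie_algebra_axioms words.vector_space_axioms L)
    fix a b u c assume a: "a \<in> L"
    interpret s: Vector_Spaces.linear wscale wscale "\<lambda>p. sandwich [a] p []" by (rule sandwich_linear)
    show "Vector_Spaces.linear wscale wscale (?act a)"
      by (rule Vector_Spaces.linear_iff[THEN iffD2])
        (simp add: \<pi>.add \<pi>.scale s.add s.scale words.vector_space_axioms)
    have sca: "sc c a \<in> L" by (rule subspace_scale[OF L(1) a])
    have "rel_coset N (sandwich [sc c a] (\<pi> u) []) = rel_coset N (wscale c (sandwich [a] (\<pi> u) []))"
      using cyclic_act_linear_left(2)[OF a a _ sca car[unfolded N_def, OF \<pi>W[of u]]] subspace_add[OF L(1) a a] sca a
      by (simp add: cyclic_act_rel_coset cyclic_module_simps N_def)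
    then show "?act (sc c a) u = wscale c (?act a u)"
      unfolding N_def rel_coset_eq_iff by (subst \<pi>.scale[symmetric]) (intro \<pi>eq, simp add: N_def)
    assume b: "b \<in> L"
    have ab: "a + b \<in> L" "br a b \<in> L" using subspace_add[OF L(1) a b] L(2)[OF a b] by simp_all
    have "rel_coset N (sandwich [a + b] (\<pi> u) [])
        = rel_coset N (sandwich [a] (\<pi> u) [] + sandwich [b] (\<pi> u) [])"
      using cyclic_act_linear_left(1)[OF a b ab(1) sca car[unfolded N_def, OF \<pi>W[of u]]] a b ab
      by (simp add: cyclic_act_rel_coset cyclic_module_simps N_def)
    then show "?act (a + b) u = ?act a u + ?act b u"
      unfolding N_def rel_coset_eq_iff by (subst \<pi>.add[symmetric]) (intro \<pi>eq, simp add: N_def)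
    have "rel_coset N (sandwich [br a b] (\<pi> u) [] + sandwich [b] (sandwich [a] (\<pi> u) []) [])
        = rel_coset N (sandwich [a] (sandwich [b] (\<pi> u) []) [])"
      using cyclic_act_bracket[OF a b ab(2) car[unfolded N_def, OF \<pi>W[of u]]] a b ab
      by (simp add: cyclic_act_rel_coset cyclic_module_simps N_def)
    then have "\<pi> (sandwich [br a b] (\<pi> u) [] + sandwich [b] (sandwich [a] (\<pi> u) []) [])
        = \<pi> (sandwich [a] (sandwich [b] (\<pi> u) []) [])"
      unfolding N_def rel_coset_eq_iff by (intro \<pi>eq) (simp add: N_def)
    moreover have "?act a (?act b u) = \<pi> (sandwich [a] (sandwich [b] (\<pi> u) []) [])"
      using \<pi>s[OF a \<pi>W] \<pi>s[OF a sW[OF b \<pi>W]] \<pi>\<pi>[OF sW[OF b \<pi>W]] by simp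
    moreover have "?act b (?act a u) = \<pi> (sandwich [b] (sandwich [a] (\<pi> u) []) [])"
      using \<pi>s[OF b \<pi>W] \<pi>s[OF b sW[OF a \<pi>W]] \<pi>\<pi>[OF sW[OF a \<pi>W]] by simp
    ultimately show "?act (br a b) u = ?act a (?act b u) - ?act b (?act a u)"
      by (simp add: \<pi>.add eq_diff_eq)
  qed
  have fold: "foldr ?act w (\<pi> (word [])) = \<pi> (word w)" if "w \<in> lists L" for w
    using that
  proof (induction w rule: list.induct)
    case (Cons a w)
    then have a: "a \<in> L" "w \<in> lists L" by auto
    have "word w \<in> W" using a(2) by (simp add: W_def)
    then show ?case using Cons.IH[OF a(2)] \<pi>\<pi>[of "word w"] \<pi>s[OF a(1), of "word w"] by simp
  qed simp
  have "lie_representation.cyclic_vector wscale L ?act (\<pi> (word []))"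
    unfolding lie_representation.cyclic_vector_def[OF rep]
  proof
    fix u
    have "\<pi> u \<in> words.span (word ` lists L)"
      using \<pi>W[of u] unfolding W_def by (intro keys_subset_span_words) simp
    then have "\<pi> (\<pi> u) \<in> words.span (\<pi> ` word ` lists L)"
      unfolding \<pi>.span_image by blast
    moreover have "\<pi> ` word ` lists L = {foldr ?act w (\<pi> (word [])) | w. w \<in> lists L}"
      unfolding Setcompr_eq_image image_image by (rule image_cong[OF refl]) (rule fold[symmetric])
    ultimately have "\<pi> (\<pi> u) \<in> words.span {foldr ?act w (\<pi> (word [])) | w. w \<in> lists L}" by simp
    moreover have "?act a u = ?act a (\<pi> (\<pi> u))" if "a \<in> L" for a
      using \<pi>s[OF that \<pi>W] \<pi>s[OF that \<pi>W[of "\<pi> u"]] by simp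
    ultimately show "\<exists>u'\<in>words.span {foldr ?act w (\<pi> (word [])) | w. w \<in> lists L}. \<forall>a\<in>L. ?act a u = ?act a u'"
      by blast
  qed
  from that[OF \<pi>(1) \<pi>N \<pi>W \<pi>d rep fold this] show ?thesis .
qed

lemma cyclic_module_fin_dim:
  assumes \<pi>: "Vector_Spaces.linear wscale wscale \<pi>" "\<And>p. Poly_Mapping.keys (\<pi> p) \<subseteq> lists L"
      "\<And>p. Poly_Mapping.keys p \<subseteq> lists L \<Longrightarrow> p - \<pi> p \<in> relation_space sc br L S"
    and B: "finite B" "\<And>w. w \<in> lists L \<Longrightarrow> \<pi> (word w) \<in> words.span B"
  shows "vectorspace.fin_dim class_ring (cyclic_module sc br L S)"
proof -
  let ?N = "relation_space sc br L S" and ?M = "cyclic_module sc br L S"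
  interpret M: vectorspace class_ring ?M by (rule cyclic_module_vectorspace)
  interpret \<pi>: Vector_Spaces.linear wscale wscale \<pi> by (rule \<pi>(1))
  \<comment> \<open>\<open>B\<close> may involve letters outside \<open>L\<close>; a maximal
    independent set \<open>C\<close> of images is written over \<open>L\<close> and is finite
    because it lies in the span of \<open>B\<close>.\<close>
  obtain C where C: "C \<subseteq> \<pi> ` word ` lists L" "words.independent C" "\<pi> ` word ` lists L \<subseteq> words.span C"
    using words.maximal_independent_subset[of "\<pi> ` word ` lists L"] by blast
  have "\<pi> ` word ` lists L \<subseteq> words.span B" using B(2) by auto
  then have fin: "finite C" using words.independent_span_bound[OF B(1) C(2)] C(1) by blast
  let ?A = "rel_coset ?N ` C"
  have CL: "Poly_Mapping.keys c \<subseteq> lists L" if "c \<in> C" for c using C(1) that \<pi>(2) by blast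
  have A: "?A \<subseteq> carrier ?M" using CL by (auto simp: cyclic_module_simps)
  note sub = M.span_is_submodule[OF A, unfolded LinearCombinations.submodule_def]
  have span: "rel_coset ?N p \<in> M.span ?A" if "p \<in> words.span C" for p
    using that
  proof (induction rule: words.span_induct_alt)
    case base
    show ?case using sub by (simp add: cyclic_module_simps)
  next
    case (step c x y)
    have "rel_coset ?N x \<in> M.span ?A" using M.in_own_span[OF A] step.hyps by blast
    then have "c \<odot>\<^bsub>?M\<^esub> rel_coset ?N x \<oplus>\<^bsub>?M\<^esub> rel_coset ?N y \<in> M.span ?A"
      using sub step.IH by (simp add: class_ring_simps)
    then show ?case by (simp add: cyclic_module_simps)
  qed
  have "carrier ?M \<subseteq> M.span ?A"
  proof
    fix P assume "P \<in> carrier ?M"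
    then obtain p where p: "P = rel_coset ?N p" "Poly_Mapping.keys p \<subseteq> lists L"
      by (auto simp: cyclic_module_simps)
    have "\<pi> p \<in> words.span (\<pi> ` word ` lists L)"
      unfolding \<pi>.span_image using keys_subset_span_words[OF p(2)] by blast
    also have "\<dots> \<subseteq> words.span C" by (rule words.span_minimal[OF C(3) words.subspace_span])
    finally have "rel_coset ?N (\<pi> p) \<in> M.span ?A" by (rule span)
    moreover have "P = rel_coset ?N (\<pi> p)" using \<pi>(3)[OF p(2)] p(1) by (simp add: rel_coset_eq_iff)
    ultimately show "P \<in> M.span ?A" by simp
  qed
  moreover have "M.span ?A \<subseteq> carrier ?M" using sub by blast
  ultimately have "M.span ?A = carrier ?M" by blast
  then show ?thesis unfolding M.fin_dim_def using fin A by blast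
qed

section \<open>The Kirillov-Reshetikhin relations\<close>

context twisted_lie_algebra
begin

lemma part_mod: "part A (k mod 2) = part A k"
  by (cases "even k") (simp_all add: part_def odd_iff_mod_2_eq_one)

lemma eig_Suc_Suc [simp]: "eig (Suc (Suc k)) = eig k"
  by (simp add: eig_def fun_eq_iff)

lemma eig_F: "k \<in> I \<Longrightarrow> eig 0 (F k) = F k + F (\<tau> k)" "k \<in> I \<Longrightarrow> eig 1 (F k) = F k - F (\<tau> k)"
  by (simp_all add: eig_def \<sigma>_F[of k])

lemma eig_height:
  assumes "br \<rho> u = scale c u"
  shows "br \<rho> (eig k u) = scale c (eig k u)"
proof -
  have "\<sigma> \<rho> = \<rho>" using \<rho>_h0 by (simp add: h0_def part_def)
  then have "br \<rho> (\<sigma> u) = scale c (\<sigma> u)" using \<sigma>_br[of \<rho> u] assms by (simp add: \<sigma>_scale)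
  then show ?thesis by (simp add: eig_def br_add_right br_scale_right assms scale_right_distrib mult.commute)
qed

lemma monom_eig_current: "monom (eig k u) k \<in> twisted_current UNIV"
  by (simp add: monom_twisted_current[OF subspace_UNIV] part_mod eig_part)

lemma monom_sum_scale: "monom (scale c u + v) k = current_scale c (monom u k) + monom v k"
  by (simp add: current_scale_monom add_monom)

text \<open>Degree k + 1 splits as 0 + (k + 1) and as 1 + k, so both components of u are available.
  Degree 0 admits no such splitting.\<close>

lemma eig_current_br:
  "current_scale 2 (monom (eig (Suc k) (br u v)) (Suc k)) =
    current_br (monom (eig 0 u) 0) (monom (eig (Suc k) v) (Suc k)) + current_br (monom (eig 1 u) 1) (monom (eig k v) k)"
  using eig_br[of "Suc k" u v] by (simp add: current_scale_monom current_br_monom add_monom)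

text \<open>The variant with u in degrees 2 and 1, for arguments at the generator, which vectors of
  degree 0 need not kill.\<close>

lemma eig_current_br':
  "current_scale 2 (monom (eig k (br u v)) (Suc (Suc k))) =
    current_br (monom (eig 0 u) 2) (monom (eig k v) k) + current_br (monom (eig 1 u) 1) (monom (eig (Suc k) v) (Suc k))"
  using eig_br[of k u v] by (simp add: current_scale_monom current_br_monom add_monom)

lemma monom_coeff_eig:
  assumes "p \<in> twisted_current UNIV"
  shows "monom (coeff p k) k = current_scale (1 / 2) (monom (eig k (coeff p k)) k)"
proof -
  have "coeff p k \<in> part UNIV k" using assms by (simp add: twisted_current_def part_mod)
  then show ?thesis by (simp add: eig_of_part current_scale_monom)
qed

lemma eig_basic_induct:
  assumes "s \<in> basic_vectors" "\<And>w. w \<in> lists I \<Longrightarrow> w \<noteq> [] \<Longrightarrow> P (lie.brw F w)"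
    "\<And>w. w \<in> lists I \<Longrightarrow> w \<noteq> [] \<Longrightarrow> P (lie.brw E w)" "\<And>j. j \<in> I \<Longrightarrow> P (H j)"
  shows "P s"
  using assms unfolding basic_vectors_def by blast

lemma eig_linear_induct:
  assumes "current.subspace T" "\<And>s. s \<in> basic_vectors \<Longrightarrow> monom (eig k s) k \<in> T"
  shows "monom (eig k u) k \<in> T"
proof -
  have "u \<in> span basic_vectors" by (simp add: span_basic_vectors)
  then show ?thesis
  proof (induction rule: span_induct_alt)
    case base
    have "eig k 0 = 0" by (simp add: eig_def \<sigma>_0)
    then show ?case using current.subspace_0[OF assms(1)] by simp
  next
    case (step c s y)
    show ?case
      unfolding eig_add eig_scale monom_sum_scale
      by (intro current.subspace_add current.subspace_scale assms step.hyps step.IH)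
  qed
qed

end

context twisted_KR
begin

lemma monom_x_current: "j \<in> {1..n} \<Longrightarrow> even k \<Longrightarrow> monom (x j) k \<in> twisted_current UNIV"
  using x[of j] by (auto simp: monom_twisted_current[OF subspace_UNIV] weight_space_def)

lemma monom_y_current: "j \<in> {1..n} \<Longrightarrow> odd k \<Longrightarrow> monom (y j) k \<in> twisted_current UNIV"
  using y[of j] y_zero[of j] current.subspace_0[OF subspace_twisted_current[OF subspace_UNIV]]
  by (cases "\<alpha> j \<in> roots 1 \<inter> nonneg_span \<alpha>")
    (auto simp: monom_twisted_current[OF subspace_UNIV] weight_space_def odd_iff_mod_2_eq_one)

lemma keys_KR_relations:
  assumes i: "i \<in> {1..n}" and s: "s \<in> KR_relations m i"
  shows "Poly_Mapping.keys s \<subseteq> lists (twisted_current UNIV)"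
proof -
  have sub: "words.subspace {p :: 'a poly list \<Rightarrow>\<^sub>0 complex. Poly_Mapping.keys p \<subseteq> lists (twisted_current UNIV)}"
    by (rule subspace_keys)
  have cur: "p \<in> twisted_current UNIV" if "p \<in> twisted_current A" for p A
    using that by (auto simp: twisted_current_def part_def)
  have hL: "monom b (2 * r - \<epsilon>) \<in> twisted_current UNIV" if "\<epsilon> \<in> {0, 1}" "b \<in> part \<h> \<epsilon>" "r \<ge> 1" for b r \<epsilon>
  proof -
    have "(2 * r - \<epsilon>) mod 2 = \<epsilon> mod 2" using that(1,3) by (auto; presburger)
    then show ?thesis using that(2) by (simp add: monom_twisted_current[OF subspace_UNIV] part_mod) (simp add: part_def)
  qed
  have h0L: "monom b 0 \<in> twisted_current UNIV" if "b \<in> h0" for b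
    using that by (auto simp: monom_twisted_current[OF subspace_UNIV] h0_def part_def)
  have "Poly_Mapping.keys (word [monom b 0] - Poly_Mapping.single [] c) \<subseteq> lists (twisted_current UNIV)" if "b \<in> h0" for b c
    using words.subspace_diff[OF sub, of "word [monom b 0]" "Poly_Mapping.single [] c"] h0L[OF that] by simp
  note h0_diff = this
  consider p where "s = word [p]" "p \<in> twisted_current npos"
    | b where "s = word [monom b 0] - Poly_Mapping.single [] (of_nat m * \<omega> i b)" "b \<in> h0"
    | b r \<epsilon> where "s = word [monom b (2 * r - \<epsilon>)]" "\<epsilon> \<in> {0, 1}" "b \<in> part \<h> \<epsilon>" "r \<ge> 1"
    | j where "s = word [monom (x j) 0]" "j \<in> {1..n}"
    | "s = word (replicate (m + 1) (monom (x i) 0))" | "s = word [monom (x i) 2]" | "s = word [monom (y i) 1]"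
    using s unfolding KR_relations_def by blast
  then show ?thesis
  proof cases
    case 2
    then show ?thesis using h0_diff by simp
  next
    case (3 b r \<epsilon>)
    then show ?thesis using hL[OF 3(2-4)] by simp
  next
    case 5
    then show ?thesis using monom_x_current[OF i, of 0] by (auto simp: in_lists_conv_set)
  qed (use cur monom_x_current[of _ 0] monom_x_current[OF i, of 2] monom_y_current[OF i, of 1] in simp_all)
qed

section \<open>Elements that kill the generator\<close>

context
  fixes vsc :: "complex \<Rightarrow> 'v::ab_group_add \<Rightarrow> 'v" and act and v :: 'v and m i :: nat
  assumes rep: "lie_representation current_scale current_br vsc (twisted_current UNIV) act"
    and cyc: "lie_representation.cyclic_vector vsc (twisted_current UNIV) act v"
    and i: "i \<in> {1..n}"
    and killed: "\<And>p. word [p] \<in> KR_relations m i \<Longrightarrow> act p v = 0"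
    and power: "(act (monom (x i) 0) ^^ (m + 1)) v = 0"
begin

interpretation R: lie_representation current_scale current_br vsc "twisted_current UNIV" act
  by (rule rep)

lemma kill_br:
  assumes "p \<in> twisted_current UNIV" "q \<in> twisted_current UNIV" "act p v = 0" "act q v = 0"
  shows "act (current_br p q) v = 0"
  using assms by (simp add: R.act_br R.act_right(3))

lemma kill_scale:
  assumes "p \<in> twisted_current UNIV" "c \<noteq> 0" "act (current_scale c p) v = 0"
  shows "act p v = 0"
  using assms by (simp add: R.act_scale_left)

lemma kill_E:
  assumes w: "w \<in> lists I" "w \<noteq> []"
  shows "act (monom (eig k (lie.brw E w)) k) v = 0"
proof (rule killed)
  have "map \<tau> w \<in> lists I" using w(1) \<tau>_I by (auto simp: in_lists_conv_set)
  then have "eig k (lie.brw E w) \<in> npos"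
    unfolding eig_def using w
    by (auto simp: \<sigma>_wordE intro!: npos_brw subspace_add[OF subspace_npos] subspace_scale[OF subspace_npos])
  then have "eig k (lie.brw E w) \<in> part npos k" using eig_part[of k "lie.brw E w"] by (simp add: part_def)
  then have "monom (eig k (lie.brw E w)) k \<in> twisted_current npos"
    by (simp add: monom_twisted_current[OF subspace_npos] part_mod)
  then show "word [monom (eig k (lie.brw E w)) k] \<in> KR_relations m i"
    unfolding KR_relations_def by blast
qed

lemma kill_h:
  assumes b: "b \<in> part \<h> k" and k: "k \<ge> 1"
  shows "act (monom b k) v = 0"
proof (rule killed)
  \<comment> \<open>Half of k, rounded up: the relations write the degree as 2 r -
    \<epsilon>.\<close>
  define r where "r = (k + k mod 2) div 2"
  have "k = 2 * r - k mod 2" "r \<ge> 1" "k mod 2 \<in> {0, 1}" using k by (auto simp: r_def; presburger)+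
  moreover have "b \<in> part \<h> (k mod 2)" using b by (simp add: part_mod)
  ultimately have "word [monom b k] \<in> {word [monom b (2 * r - \<epsilon>)] | b r \<epsilon>. \<epsilon> \<in> {0, 1} \<and> b \<in> part \<h> \<epsilon> \<and> r \<ge> 1}"
    by (metis (mono_tags, lifting) mem_Collect_eq)
  then show "word [monom b k] \<in> KR_relations m i" unfolding KR_relations_def by blast
qed

lemma kill_H:
  assumes j: "j \<in> I" and k: "k \<ge> 1"
  shows "act (monom (eig k (H j)) k) v = 0"
proof (rule kill_h[OF _ k])
  have "eig k (H j) \<in> \<h>"
    unfolding eig_def \<h>_def \<sigma>_H[OF j] using j \<tau>_I[OF j] by (intro span_add span_scale span_base imageI)
  then show "eig k (H j) \<in> part \<h> k" using eig_part[of k "H j"] by (simp add: part_def)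
qed

text \<open>\<rho> \<otimes> t^(2s) kills the generator for s > 0 and \<rho> acts on f by -1, so
  this bracket only shifts the degree.\<close>

lemma kill_raise:
  assumes f: "monom f k \<in> twisted_current UNIV" "act (monom f k) v = 0" "br \<rho> f = scale (-1) f"
  shows "act (monom f (k + 2 * s)) v = 0"
proof (cases "s = 0")
  case False
  have "\<rho> \<in> part \<h> (2 * s)" using \<rho>_h0 by (simp add: h0_def part_def)
  then have \<rho>: "act (monom \<rho> (2 * s)) v = 0" "monom \<rho> (2 * s) \<in> twisted_current UNIV"
    using kill_h[of \<rho> "2 * s"] False by (auto simp: monom_twisted_current[OF subspace_UNIV] part_def)
  have "current_br (monom \<rho> (2 * s)) (monom f k) = current_scale (-1) (monom f (k + 2 * s))"
    by (simp only: current_br_monom f(3) current_scale_monom add.commute)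
  then have "act (current_scale (-1) (monom f (k + 2 * s))) v = 0"
    using kill_br[OF \<rho>(2) f(1) \<rho>(1) f(2)] by simp
  moreover have "monom f (k + 2 * s) \<in> twisted_current UNIV"
    using f(1) by (simp add: monom_twisted_current[OF subspace_UNIV])
  ultimately show ?thesis using kill_scale by (metis neg_equal_0_iff_equal zero_neq_one)
qed (simp add: f(2))

text \<open>Degrees 1 and 2 are the base cases for \<open>kill_raise\<close>. If j = i they are
  defining relations; otherwise they follow from x j in degree 0 by bracketing with Cartan elements
  of degrees 1 and 2.\<close>

lemma F_generator:
  assumes k: "k \<in> I"
  shows nilpotent_F: "\<exists>q. (act (monom (eig 0 (F k)) 0) ^^ q) v = 0"
    and kill_F: "s \<ge> 1 \<Longrightarrow> act (monom (eig s (F k)) s) v = 0"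
proof -
  obtain j c d where j: "j \<in> {1..n}" "F k + F (\<tau> k) = scale c (x j)" "F k - F (\<tau> k) = scale d (y j)"
  proof -
    have "n \<ge> 1" using i by simp
    then show ?thesis using simple_root_vectors[OF k] that by blast
  qed
  have x: "monom (eig 0 (F k)) t = current_scale c (monom (x j) t)" for t
    unfolding eig_F(1)[OF k] j(2) by (rule current_scale_monom[symmetric])
  have y: "monom (eig 1 (F k)) t = current_scale d (monom (y j) t)" for t
    unfolding eig_F(2)[OF k] j(3) by (rule current_scale_monom[symmetric])
  have h: "br \<rho> (eig t (F k)) = scale (-1) (eig t (F k))" for t by (rule eig_height[OF \<rho>_F[OF k]])
  have x0: "act (monom (eig 0 (F k)) 0) v = 0" if "j \<noteq> i"
  proof -
    have "word [monom (x j) 0] \<in> KR_relations m i" using j(1) that unfolding KR_relations_def by blast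
    then show ?thesis
      using killed[of "monom (x j) 0"] monom_x_current[OF j(1), of 0] by (simp add: x R.act_scale_left)
  qed
  have x2: "act (monom (eig 0 (F k)) 2) v = 0"
  proof (cases "j = i")
    case True
    have "word [monom (x i) 2] \<in> KR_relations m i" unfolding KR_relations_def by blast
    then show ?thesis
      using killed[of "monom (x j) 2"] monom_x_current[OF j(1), of 2] True by (simp add: x R.act_scale_left)
  next
    case False
    then show ?thesis using kill_raise[OF monom_eig_current x0 h, of 1] by (simp add: numeral_2_eq_2)
  qed
  have y1: "act (monom (eig 1 (F k)) 1) v = 0"
  proof (cases "j = i")
    case True
    have "word [monom (y i) 1] \<in> KR_relations m i" unfolding KR_relations_def by blast
    then show ?thesis
      unfolding y using killed[of "monom (y j) 1"] monom_y_current[OF j(1), of 1] True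
      by (simp add: R.act_scale_left)
  next
    case False
    show ?thesis
    proof (cases "\<tau> k = k")
      case True
      then have "eig 1 (F k) = 0" using eig_F(2)[OF k] by simp
      then show ?thesis by (simp add: R.act_0_left)
    next
      case \<tau>: False
      \<comment> \<open>The factor with which H k - H (\<tau> k) turns F k + F (\<tau> k) into F k -
        F (\<tau> k); an off-diagonal entry is at most 0, so it is non-zero.\<close>
      let ?c = "of_int (a (\<tau> k) k - 2) :: complex"
      have "a k (\<tau> k) = a (\<tau> k) k"
        using cartan_diagram_aut[OF admissible k \<tau>_I[OF k]] \<tau>_\<tau>[OF k] by simp
      then have "br (eig 1 (H k)) (eig 0 (F k)) = scale ?c (eig 1 (F k))"
        unfolding eig_F[OF k] eig_def[of 1 "H k"] \<sigma>_H[OF k]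
        by (simp add: lie.br_diff_left br_add_right HF[OF k k] HF[OF k \<tau>_I[OF k]] HF[OF \<tau>_I[OF k] k]
            HF[OF \<tau>_I[OF k] \<tau>_I[OF k]] cartan_diag scale_left_diff_distrib scale_right_diff_distrib)
      then have "current_br (monom (eig 1 (H k)) 1) (monom (eig 0 (F k)) 0) = current_scale ?c (monom (eig 1 (F k)) 1)"
        by (simp add: current_br_monom current_scale_monom)
      then have "act (current_scale ?c (monom (eig 1 (F k)) 1)) v = 0"
        using kill_br[OF monom_eig_current monom_eig_current kill_H[OF k, of 1] x0[OF False]] by simp
      moreover have "a (\<tau> k) k \<le> 0" using \<tau> by (rule cartan_offdiag)
      then have "?c \<noteq> 0" unfolding of_int_eq_0_iff by simp
      ultimately show ?thesis using kill_scale[OF monom_eig_current] by blast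
    qed
  qed
  show "\<exists>q. (act (monom (eig 0 (F k)) 0) ^^ q) v = 0"
  proof (cases "j = i")
    case True
    have "(act (monom (eig 0 (F k)) 0) ^^ (m + 1)) v = 0"
      unfolding x True R.funpow_scale_act[OF monom_x_current[OF i even_zero]] power by simp
    then show ?thesis by blast
  next
    case False
    then show ?thesis using x0 by (intro exI[of _ 1]) simp
  qed
  show "act (monom (eig s (F k)) s) v = 0" if s: "s \<ge> 1"
  proof (cases "even s")
    case True
    then obtain r where "s = 2 + 2 * r" using s by (metis add_2_eq_Suc dvd_def mult_Suc_right not0_implies_Suc not_one_le_zero mult_0_right)
    moreover have "eig s = eig 0" using True by (simp add: eig_def fun_eq_iff)
    ultimately show ?thesis using kill_raise[OF _ x2 h, of r] monom_eig_current[of 2] by (simp add: numeral_2_eq_2)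
  next
    case False
    then obtain r where "s = 1 + 2 * r" by (metis oddE add.commute)
    moreover have "eig s = eig 1" using False by (simp add: eig_def fun_eq_iff)
    ultimately show ?thesis using kill_raise[OF monom_eig_current y1 h, of r] by simp
  qed
qed

section \<open>Spanning by nilpotent elements\<close>

lemma nil_elementI:
  assumes "br \<rho> u = scale (of_int l) u" "l \<noteq> 0" "(act (monom (eig k u) k) ^^ q) v = 0"
  shows "monom (eig k u) k \<in> R.nil_elements"
proof -
  have nil: "locally_nilpotent (current_br (monom (eig k u) k))"
    by (rule current_ad_nilpotent[OF ad_nilpotent[OF eig_height[OF assms(1)] assms(2)]])
  then have "locally_nilpotent (act (monom (eig k u) k))"
    by (rule R.locally_nilpotent_from_generator[OF cyc monom_eig_current _ assms(3)])
  then show ?thesis using nil by (simp add: R.nil_elements_def monom_eig_current)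
qed

lemma E_nil: "w \<in> lists I \<Longrightarrow> w \<noteq> [] \<Longrightarrow> monom (eig k (lie.brw E w)) k \<in> R.nil_elements"
  by (rule nil_elementI[where l = "int (length w)" and q = 1]) (simp_all add: \<rho>_wordE kill_E)

lemma F_nil: "j \<in> I \<Longrightarrow> monom (eig k (F j)) k \<in> R.nil_elements"
proof -
  assume j: "j \<in> I"
  have "\<exists>q. (act (monom (eig k (F j)) k) ^^ q) v = 0"
  proof (cases "k = 0")
    case True
    then show ?thesis using nilpotent_F[OF j] by simp
  next
    case False
    then show ?thesis using kill_F[OF j, of k] by (intro exI[of _ 1]) simp
  qed
  then obtain q where "(act (monom (eig k (F j)) k) ^^ q) v = 0" by blast
  then show ?thesis using \<rho>_F[OF j] by (intro nil_elementI[where l = "-1"]) simp_all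
qed

lemma span_nil_half:
  assumes "current_scale 2 p \<in> current.span R.nil_elements"
  shows "p \<in> current.span R.nil_elements"
  using current.span_scale[OF assms, of "1 / 2"] by simp

text \<open>In degree 0 the vectors of \<g>_1 are absent and \<open>eig_current_br\<close> does not
  apply; the folded generators have to produce the fixed part on their own.\<close>

lemma F_word_0_span:
  assumes w: "w \<in> lists I" "w \<noteq> []"
  shows "monom (eig 0 (lie.brw F w)) 0 \<in> current.span R.nil_elements"
proof -
  let ?m = "{u. monom u 0 \<in> current.span R.nil_elements}"
  have "lie.brw F w + \<sigma> (lie.brw F w) \<in> ?m"
  proof (rule fixed_words_in_subalgebra[OF _ _ _ _ w])
    show "subspace ?m"
      by (rule subspaceI)
        (simp_all add: current.span_zero current.span_add current.span_scale flip: add_monom current_scale_monom)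
    show "br u u' \<in> ?m" if "u \<in> ?m" "u' \<in> ?m" for u u'
      using R.span_nil_elements_br[of "monom u 0" "monom u' 0"] that by (simp add: current_br_monom)
    fix j assume j: "j \<in> I"
    have "eig 0 (E j) = E j + E (\<tau> j)" by (simp add: eig_def \<sigma>_E[OF j])
    then show "E j + E (\<tau> j) \<in> ?m" using E_nil[of "[j]" 0] j by (simp add: current.span_base)
    show "F j + F (\<tau> j) \<in> ?m" using F_nil[OF j, of 0] by (simp add: eig_F[OF j] current.span_base)
  qed
  then show ?thesis by (simp add: eig_def)
qed

lemma F_word_span:
  assumes "w \<in> lists I" "w \<noteq> []"
  shows "monom (eig k (lie.brw F w)) k \<in> current.span R.nil_elements"
  using assms
proof (induction w arbitrary: k rule: list.induct)
  case (Cons j w)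
  then have j: "j \<in> I" "w \<in> lists I" by auto
  show ?case
  proof (cases "w = []")
    case True
    then show ?thesis using F_nil[OF j(1)] by (simp add: current.span_base)
  next
    case False
    note IH = Cons.IH[OF j(2) False]
    show ?thesis
    proof (cases k)
      case 0
      then show ?thesis using F_word_0_span Cons.prems by simp
    next
      case (Suc k')
      have "current_scale 2 (monom (eig (Suc k') (br (F j) (lie.brw F w))) (Suc k')) \<in> current.span R.nil_elements"
        unfolding eig_current_br
        by (intro current.span_add R.span_nil_elements_br IH current.span_base F_nil[OF j(1)])
      then show ?thesis using Suc False span_nil_half by (simp add: lie.brw_Cons)
    qed
  qed
qed simp

lemma H_span:
  assumes j: "j \<in> I"
  shows "monom (eig k (H j)) k \<in> current.span R.nil_elements"
proof (cases k)
  case 0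
  define s where "s = (if \<tau> j = j then 2 else 1 :: real)"
  have EF0: "eig 0 (E j) = E j + E (\<tau> j)" "eig 0 (H j) = H j + H (\<tau> j)"
    by (simp_all add: eig_def \<sigma>_E[OF j] \<sigma>_H[OF j])
  have E: "monom (eig 0 (E j)) 0 \<in> current.span R.nil_elements" using E_nil[of "[j]" 0] j by (simp add: current.span_base)
  have F: "monom (eig 0 (F j)) 0 \<in> current.span R.nil_elements" using F_nil[OF j] by (rule current.span_base)
  have "current_scale (complex_of_real s) (monom (eig 0 (H j)) 0) \<in> current.span R.nil_elements"
    using R.span_nil_elements_br[OF E F] folded_EF[OF j s_def]
    by (simp add: current_br_monom EF0 eig_F[OF j] current_scale_monom)
  from current.span_scale[OF this, of "inverse (complex_of_real s)"] show ?thesis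
    using 0 by (simp add: s_def split: if_splits)
next
  case (Suc k')
  have E: "monom (eig t (E j)) t \<in> current.span R.nil_elements" for t
    using E_nil[of "[j]" t] j by (simp add: current.span_base)
  have "current_scale 2 (monom (eig (Suc k') (br (E j) (F j))) (Suc k')) \<in> current.span R.nil_elements"
    unfolding eig_current_br
    by (intro current.span_add R.span_nil_elements_br E current.span_base F_nil[OF j])
  then show ?thesis using Suc span_nil_half EF[OF j j] by simp
qed

lemma current_subset_span_nil: "twisted_current UNIV \<subseteq> current.span R.nil_elements"
proof
  fix p :: "'a poly" assume p: "p \<in> twisted_current UNIV"
  have "monom (eig k u) k \<in> current.span R.nil_elements" for k u
  proof (rule eig_linear_induct[OF current.subspace_span])
    fix s assume "s \<in> basic_vectors"
    then show "monom (eig k s) k \<in> current.span R.nil_elements"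
      by (rule eig_basic_induct) (simp_all only: F_word_span H_span E_nil current.span_base not_False_eq_True)
  qed
  then have "monom (coeff p k) k \<in> current.span R.nil_elements" for k
    unfolding monom_coeff_eig[OF p] by (rule current.span_scale)
  then have "(\<Sum>k\<le>degree p. monom (coeff p k) k) \<in> current.span R.nil_elements"
    by (intro current.span_sum)
  then show "p \<in> current.span R.nil_elements" by (simp add: poly_as_sum_of_monoms)
qed

text \<open>F j in degree 0 need not kill the generator, so each letter is placed in degree 1 or 2;
  this costs up to two degrees per letter.\<close>

lemma kill_F_word:
  assumes "w \<in> lists I" "w \<noteq> []" "k \<ge> 2 * length w"
  shows "act (monom (eig k (lie.brw F w)) k) v = 0"
  using assms
proof (induction w arbitrary: k rule: list.induct)
  case (Cons j w)
  then have j: "j \<in> I" "w \<in> lists I" by auto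
  show ?case
  proof (cases "w = []")
    case True
    then show ?thesis using kill_F[OF j(1), of k] Cons.prems(3) by simp
  next
    case False
    obtain k' where k': "k = Suc (Suc k')" "k' \<ge> 2 * length w"
      using Cons.prems(3) by (cases k rule: nat.exhaust; cases "k - 1") auto
    have L: "monom (eig 0 (F j)) 2 \<in> twisted_current UNIV" "act (monom (eig 0 (F j)) 2) v = 0"
      using monom_eig_current[of 2 "F j"] kill_F[OF j(1), of 2] by (simp_all add: numeral_2_eq_2)
    have "act (current_scale 2 (monom (eig k' (br (F j) (lie.brw F w))) (Suc (Suc k')))) v = 0"
      unfolding eig_current_br'
      using kill_br[OF L(1) monom_eig_current L(2) Cons.IH[OF j(2) False k'(2)]]
        kill_br[OF monom_eig_current monom_eig_current kill_F[OF j(1), of 1] Cons.IH[OF j(2) False, of "Suc k'"]] k'(2)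
      by (subst R.act_add_left) (simp_all add: twisted_current_br L monom_eig_current)
    then show ?thesis
      using kill_scale[of "monom (eig k' (br (F j) (lie.brw F w))) (Suc (Suc k'))" 2]
        monom_eig_current[of "Suc (Suc k')"] False by (simp add: k' lie.brw_Cons)
  qed
qed simp

lemma high_degree_kill: "\<exists>K. \<forall>k\<ge>K. \<forall>u. act (monom (eig k u) k) v = 0"
proof -
  obtain K where K: "\<And>w. w \<in> lists I \<Longrightarrow> length w \<ge> K \<Longrightarrow> lie.brw F w = 0"
    using long_words_0 by blast
  show ?thesis
  \<comment> \<open>Non-zero words in F have fewer than K letters; the extra 1 makes the degree
    positive for the Cartan elements.\<close>
  proof (intro exI[of _ "2 * K + 1"] allI impI)
    fix k u assume k: "2 * K + 1 \<le> k"
    let ?T = "{p \<in> twisted_current UNIV. act p v = 0}"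
    have "monom (eig k u) k \<in> ?T"
    proof (rule eig_linear_induct)
      show "current.subspace ?T"
        by (rule current.subspaceI)
          (auto simp: R.act_0_left R.act_add_left R.act_scale_left intro: current.subspace_0[OF R.L_subspace]
            current.subspace_add[OF R.L_subspace] current.subspace_scale[OF R.L_subspace])
      fix s assume "s \<in> basic_vectors"
      then have "act (monom (eig k s) k) v = 0"
      proof (rule eig_basic_induct)
        fix w assume w: "w \<in> lists I" "w \<noteq> []"
        show "act (monom (eig k (lie.brw E w)) k) v = 0" by (rule kill_E[OF w])
        show "act (monom (eig k (lie.brw F w)) k) v = 0"
        proof (cases "length w \<ge> K")
          case True
          then show ?thesis using K[OF w(1)] by (simp add: eig_def \<sigma>_0 R.act_0_left)
        next
          case False
          then show ?thesis using k by (intro kill_F_word[OF w]) simp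
        qed
      qed (rule kill_H, use k in simp_all)
      then show "monom (eig k s) k \<in> ?T" by (simp add: monom_eig_current)
    qed
    then show "act (monom (eig k u) k) v = 0" by simp
  qed
qed

lemma KR_finite_generation: "\<exists>B. finite B \<and> (\<forall>w\<in>lists (twisted_current UNIV). foldr act w v \<in> R.V.span B)"
proof -
  obtain K where K: "\<And>k u. k \<ge> K \<Longrightarrow> act (monom (eig k u) k) v = 0" using high_degree_kill by blast
  \<comment> \<open>The elements divisible by t^K: an ideal that kills the generator, with finitely
    many elements spanning a complement together with it.\<close>
  define J where "J = {p \<in> twisted_current (UNIV :: 'a set). \<forall>k<K. coeff p k = 0}"
  have J: "J \<subseteq> twisted_current UNIV" by (auto simp: J_def)
  have J_br: "current_br p q \<in> J" if "p \<in> J" "q \<in> twisted_current UNIV" for p q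
  proof -
    have "coeff (current_br p q) k = 0" if "k < K" for k
      unfolding current_br_def coeff_sum using \<open>p \<in> J\<close> that by (intro sum.neutral ballI) (auto simp: J_def)
    then show ?thesis using that twisted_current_br[of p q] by (auto simp: J_def)
  qed
  have "act p v = 0" if p: "p \<in> J" for p
  proof -
    have pL: "p \<in> twisted_current UNIV" using p J by blast
    have "act (monom (coeff p k) k) v = 0" for k
    proof (cases "k < K")
      case True
      then show ?thesis using p by (simp add: J_def R.act_0_left)
    next
      case False
      then show ?thesis unfolding monom_coeff_eig[OF pL] by (simp add: R.act_scale_left monom_eig_current K)
    qed
    moreover have "monom (coeff p k) k \<in> twisted_current UNIV" for k
      unfolding monom_coeff_eig[OF pL] by (intro current.subspace_scale[OF R.L_subspace] monom_eig_current)
    ultimately have "act (\<Sum>k\<le>degree p. monom (coeff p k) k) v = 0"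
      by (simp add: R.act_sum_left)
    then show ?thesis by (simp add: poly_as_sum_of_monoms)
  qed
  then have J0: "act p u = 0" if "p \<in> J" for p u
    using R.annihilating_ideal[OF J J_br cyc] that by blast
  obtain B where B: "finite B" "span B = UNIV" using finite_dim by blast
  define G where "G = (\<lambda>(b, k). monom (eig k b) k) ` (B \<times> {..<K})"
  have G: "finite G" "G \<subseteq> twisted_current UNIV"
    using B(1) monom_eig_current by (auto simp: G_def)
  have eigG: "monom (eig k u) k \<in> current.span (G \<union> J)" if "k < K" for k u
  proof -
    have "u \<in> span B" by (simp add: B(2))
    then show ?thesis
    proof (induction rule: span_induct_alt)
      case base
      show ?case by (simp add: eig_def \<sigma>_0 current.span_zero)
    next
      case (step c b y)
      have "monom (eig k b) k \<in> G" using step.hyps that by (auto simp: G_def)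
      then show ?case
        unfolding eig_add eig_scale monom_sum_scale
        by (intro current.span_add current.span_scale step.IH current.span_base) simp
    qed
  qed
  have "p \<in> current.span (G \<union> J)" if p: "p \<in> twisted_current UNIV" for p
  proof -
    let ?q = "\<Sum>k<K. monom (coeff p k) k"
    have mL: "monom (coeff p k) k \<in> twisted_current UNIV" for k
      unfolding monom_coeff_eig[OF p] by (intro current.subspace_scale[OF R.L_subspace] monom_eig_current)
    have "?q \<in> current.span (G \<union> J)"
      by (rule current.span_sum) (simp only: monom_coeff_eig[OF p] lessThan_iff current.span_scale eigG)
    moreover have "p - ?q \<in> J"
    proof -
      have "p - ?q \<in> twisted_current UNIV"
        by (intro current.subspace_diff[OF R.L_subspace] current.subspace_sum[OF R.L_subspace] mL p)
      moreover have "coeff (p - ?q) k = 0" if "k < K" for k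
        using that by (simp add: coeff_sum sum.delta)
      ultimately show ?thesis by (simp add: J_def)
    qed
    then have "p - ?q \<in> current.span (G \<union> J)" by (intro current.span_base) simp
    ultimately have "?q + (p - ?q) \<in> current.span (G \<union> J)" by (rule current.span_add)
    then show ?thesis by simp
  qed
  then have "twisted_current UNIV \<subseteq> current.span (G \<union> J)" by (rule subsetI)
  from R.finite_generation[OF current_subset_span_nil J J0 G this] show ?thesis .
qed

end

theorem KR_fin_dim:
  assumes i: "i \<in> {1..n}"
  shows "vectorspace.fin_dim class_ring (KR m i)"
proof -
  let ?L = "twisted_current (UNIV :: 'a set)" and ?S = "KR_relations m i"
  note L = subspace_twisted_current[OF subspace_UNIV] twisted_current_br
  have kS: "Poly_Mapping.keys s \<subseteq> lists ?L" if "s \<in> ?S" for s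
    using keys_KR_relations[OF i that] .
  obtain \<pi> where \<pi>: "Vector_Spaces.linear wscale wscale \<pi>"
    "\<And>p. p \<in> relation_space current_scale current_br ?L ?S \<Longrightarrow> \<pi> p = 0"
    "\<And>p. \<pi> p \<in> {p. Poly_Mapping.keys p \<subseteq> lists ?L}"
    "\<And>p. p \<in> {p. Poly_Mapping.keys p \<subseteq> lists ?L} \<Longrightarrow> p - \<pi> p \<in> relation_space current_scale current_br ?L ?S"
    and rep: "lie_representation current_scale current_br wscale ?L (\<lambda>a p. \<pi> (sandwich [a] (\<pi> p) []))"
    and fold: "\<And>w. w \<in> lists ?L \<Longrightarrow> foldr (\<lambda>a p. \<pi> (sandwich [a] (\<pi> p) [])) w (\<pi> (word [])) = \<pi> (word w)"
    and cyc: "lie_representation.cyclic_vector wscale ?L (\<lambda>a p. \<pi> (sandwich [a] (\<pi> p) [])) (\<pi> (word []))"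
    by (rule current.cyclic_module_representation[where L = ?L and S = ?S, OF L(1)])
      (rule L(2) kS that; assumption)+
  let ?act = "\<lambda>a p. \<pi> (sandwich [a] (\<pi> p) [])" and ?v = "\<pi> (word [])"
  have \<pi>S: "\<pi> s = 0" if "s \<in> ?S" for s
  proof -
    have "rel_coset (relation_space current_scale current_br ?L ?S) s
        = rel_coset (relation_space current_scale current_br ?L ?S) 0"
      using cyclic_gen_relations[OF that, of current_scale current_br ?L] by (simp add: cyclic_module_simps)
    then show ?thesis using \<pi>(2)[of s] by (simp add: rel_coset_eq_iff)
  qed
  have "?act p ?v = 0" if p: "word [p] \<in> ?S" for p
  proof -
    have "[p] \<in> lists ?L" using keys_KR_relations[OF i p] by simp
    then show ?thesis using fold[of "[p]"] \<pi>S[OF p] by simp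
  qed
  moreover have "(?act (monom (x i) 0) ^^ (m + 1)) ?v = 0"
  proof -
    have rep_foldr: "foldr f (replicate k a) u = (f a ^^ k) u" for f :: "'a poly \<Rightarrow> _ \<Rightarrow> _" and k a u
      by (induction k) simp_all
    have "replicate (m + 1) (monom (x i) 0) \<in> lists ?L"
      using monom_x_current[OF i, of 0] by (auto simp: in_lists_conv_set)
    from fold[OF this] have "(?act (monom (x i) 0) ^^ (m + 1)) ?v = \<pi> (word (replicate (m + 1) (monom (x i) 0)))"
      by (simp only: rep_foldr)
    also have "\<dots> = 0" by (rule \<pi>S) (simp add: KR_relations_def)
    finally show ?thesis .
  qed
  ultimately obtain B where "finite B" "\<And>w. w \<in> lists ?L \<Longrightarrow> foldr ?act w ?v \<in> words.span B"
    using KR_finite_generation[OF rep cyc i, of m] by blast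
  then show ?thesis
    unfolding KR_def using \<pi> fold by (intro cyclic_module_fin_dim[of \<pi> ?L _ _ _ B]) auto
qed

end

theorem mainTheorem4:
  fixes scale :: "complex \<Rightarrow> 'a::ab_group_add \<Rightarrow> 'a"
    and m i :: nat
  assumes "twisted_KR scale br X n E F H \<sigma> \<alpha> \<alpha>c \<omega> x y"
    and "i \<in> {1..n}"
  shows "vectorspace.fin_dim class_ring (twisted_KR.KR scale br X n E H \<sigma> \<omega> x y m i)"
  by (rule twisted_KR.KR_fin_dim[OF assms])

end
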